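(* The nilshadow $\operatorname{nilsh}(\mathfrak s)$ of a solvable Lie algebra $\mathfrak s$ over $\mathbb K$ is an elementary linear deformation of $\mathfrak s$, and in particular $$\dim TH^p(\mathfrak s)=\dim H^p(\operatorname{nilsh}(\mathfrak s))$$ for all $p=0,\dots,\dim\mathfrak s$, where $H^p(\operatorname{nilsh}(\mathfrak s))$ is cohomology with trivial coefficients.
   Context: $\mathbb K$ is an algebraically closed field of characteristic $0$; all Lie algebras and modules are finite dimensional over $\mathbb K$. Total cohomology: $\Gamma_\circ^p(\mathfrak g)$ is the (finite) set of equivalence classes of irreducible finite dimensional $\mathfrak g$-modules $V$ with $H^p(\mathfrak g,V)\ne0$, and $TH^p(\mathfrak g)=\bigoplus_{V\in\Gamma_\circ^p(\mathfrak g)}H^p(\mathfrak g,V)$. Nilshadow: let $\mathfrak n$ be the nilradical of $\mathfrak s$. For $X\in\mathfrak s$ let $\operatorname{ad}(X)=\operatorname{ad}(X)_s+\operatorname{ad}(X)_n$ be the Jordan decomposition in $\operatorname{End}(\mathfrak s)$; both parts are derivations of $\mathfrak s$ with image in $\mathfrak n$. Choose a Cartan subalgebra of $\mathfrak s$ and a vector subspace $\mathfrak a$ of it with $\mathfrak s=\mathfrak a\oplus\mathfrak n$ as vector spaces (this exists, and $\{\operatorname{ad}(X)_s:X\in\mathfrak a\}$ is an abelian subalgebra of semisimple derivations vanishing on $\mathfrak a$ and preserving $\mathfrak n$). Writing $X=X_{\mathfrak a}+X_{\mathfrak n}$, the nilshadow $\operatorname{nilsh}(\mathfrak s)$ is the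 vector space $\mathfrak s$ with the bracket $$[X,Y]_{\operatorname{nilsh}}=[X,Y]-\operatorname{ad}(X_{\mathfrak a})_s(Y)+\operatorname{ad}(Y_{\mathfrak a})_s(X),$$ which is a nilpotent Lie algebra (independent of choices up to isomorphism). Extensions: for Lie algebras $\mathfrak a,\mathfrak h$ and linear maps $\alpha:\mathfrak a\to\operatorname{Der}(\mathfrak h)$, $\rho:\Lambda^2\mathfrak a\to\mathfrak h$ satisfying, for all $X,Y,Z\in\mathfrak a$, $[\alpha(X),\alpha(Y)]=\alpha([X,Y]_{\mathfrak a})+\operatorname{ad}_{\mathfrak h}(\rho(X\wedge Y))$ and $\circlearrowleft\alpha(X)(\rho(Y\wedge Z))=\circlearrowleft\rho([X,Y]_{\mathfrak a}\wedge Z)$ ($\circlearrowleft$ = cyclic sum), $\mathfrak g_{\alpha,\rho}=\mathfrak a\oplus_{\alpha,\rho}\mathfrak h$ denotes the Lie algebra on $\mathfrak a\oplus\mathfrak h$ with $[X,Y]=[X,Y]_{\mathfrak a}+\rho(X\wedge Y)$, $[X,H]=\alpha(X)(H)$, $[H,K]=[H,K]_{\mathfrak h}$ for $X,Y\in\mathfrak a$, $H,K\in\mathfrak h$. Elementary linear deformation: when $\mathfrak a$ is abelian, $\mathfrak g_{\alpha+\beta,\rho}$ is an elementary linear deformation of $\mathfrak g_{\alpha,\rho}$ if $\beta:\mathfrak a\to\operatorname{Der}(\mathfrak h)$ is linear and, for all $X,Y,Z\in\mathfrak a$, $[\beta(X),\beta(Y)]=0$, $[\alpha(X),\beta(Y)]=0$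 and $\beta(X)(\rho(Y\wedge Z))=0$. In the statement, $\mathfrak s=\mathfrak a\oplus\mathfrak n$ is viewed as the extension $\mathfrak a\oplus_{\alpha,\rho}\mathfrak n$ of the abelian Lie algebra $\mathfrak a\simeq\mathfrak s/\mathfrak n$ by $\mathfrak n$, with $\alpha(X)=\operatorname{ad}(X)|_{\mathfrak n}$ and $\rho(X\wedge Y)=[X,Y]$ for $X,Y\in\mathfrak a$. *)

theory Defs
  imports
    "HOL-Library.FuncSet"
    "HOL-Library.Function_Algebras"
    "HOL-Library.Product_Plus"
    "HOL-Computational_Algebra.Polynomial"
    "Jordan_Normal_Form.VS_Connect"
begin

text \<open>
  Lie algebras, modules and cochain spaces are finite-dimensional subspaces of ambient vector spaces
  (in the sense of theory \<open>Vector_Spaces\<close>, with the scalar multiplication as an explicit parameter).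
  Quotient spaces and direct sums, which cannot be such subspaces, are module records over
  \<open>class_ring\<close>, so that their dimension is \<open>vectorspace.dim class_ring\<close>.
\<close>

section \<open>Linear algebra\<close>

abbreviation lin_span :: "('k::field \<Rightarrow> 'v::ab_group_add \<Rightarrow> 'v) \<Rightarrow> 'v set \<Rightarrow> 'v set" where
  "lin_span \<equiv> Modules.module.span"

abbreviation lin_subspace :: "('k::field \<Rightarrow> 'v::ab_group_add \<Rightarrow> 'v) \<Rightarrow> 'v set \<Rightarrow> bool" where
  "lin_subspace \<equiv> Modules.module.subspace"

definition fd_subspace :: "('k::field \<Rightarrow> 'v::ab_group_add \<Rightarrow> 'v) \<Rightarrow> 'v set \<Rightarrow> bool" where
  "fd_subspace s V \<longleftrightarrow> (\<exists>B. finite B \<and> V = lin_span s B)"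

definition lin_on :: "('k \<Rightarrow> 'v \<Rightarrow> 'v) \<Rightarrow> ('k \<Rightarrow> 'w \<Rightarrow> 'w) \<Rightarrow> 'v::ab_group_add set \<Rightarrow> ('v \<Rightarrow> 'w::ab_group_add) \<Rightarrow> bool" where
  "lin_on s t V f \<longleftrightarrow>
     (\<forall>x\<in>V. \<forall>y\<in>V. f (x + y) = f x + f y) \<and> (\<forall>c. \<forall>x\<in>V. f (s c x) = t c (f x))"

definition direct_decomposition ::
  "('k::field \<Rightarrow> 'v::ab_group_add \<Rightarrow> 'v) \<Rightarrow> 'v set \<Rightarrow> 'v set \<Rightarrow> 'v set \<Rightarrow> bool" where
  "direct_decomposition s V U W \<longleftrightarrow>
     lin_subspace s U \<and> lin_subspace s W \<and> U \<inter> W = {0} \<and> V = {u + w |u w. u \<in> U \<and> w \<in> W}"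

definition component :: "'v::ab_group_add set \<Rightarrow> 'v set \<Rightarrow> 'v \<Rightarrow> 'v" where
  "component U W x = (THE u. u \<in> U \<and> x - u \<in> W)"

definition semisimple_endo :: "('k::field \<Rightarrow> 'v::ab_group_add \<Rightarrow> 'v) \<Rightarrow> ('v \<Rightarrow> 'v) \<Rightarrow> bool" where
  "semisimple_endo s S \<longleftrightarrow> Vector_Spaces.linear s s S \<and>
     (\<forall>W. lin_subspace s W \<and> S ` W \<subseteq> W \<longrightarrow>
        (\<exists>U. direct_decomposition s UNIV W U \<and> S ` U \<subseteq> U))"

definition nilpotent_endo :: "('k::field \<Rightarrow> 'v::ab_group_add \<Rightarrow> 'v) \<Rightarrow> ('v \<Rightarrow> 'v) \<Rightarrow> bool" where
  "nilpotent_endo s T \<longleftrightarrow> Vector_Spaces.linear s s T \<and> (\<exists>n. T ^^ n = (\<lambda>_. 0))"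

definition jordan_decomposition ::
  "('k::field \<Rightarrow> 'v::ab_group_add \<Rightarrow> 'v) \<Rightarrow> ('v \<Rightarrow> 'v) \<Rightarrow> ('v \<Rightarrow> 'v) \<Rightarrow> ('v \<Rightarrow> 'v) \<Rightarrow> bool" where
  "jordan_decomposition s T S M \<longleftrightarrow>
     semisimple_endo s S \<and> nilpotent_endo s M \<and> S \<circ> M = M \<circ> S \<and> T = (\<lambda>x. S x + M x)"

definition semisimple_part ::
  "('k::field \<Rightarrow> 'v::ab_group_add \<Rightarrow> 'v) \<Rightarrow> ('v \<Rightarrow> 'v) \<Rightarrow> ('v \<Rightarrow> 'v)" where
  "semisimple_part s T = (THE S. \<exists>M. jordan_decomposition s T S M)"

text \<open>
  The fields \<open>mult\<close> and \<open>one\<close> of the records below are irrelevant for modules. The elements of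
  the quotient of \<open>Z\<close> by \<open>B\<close> are the cosets of \<open>B\<close>; adding \<open>B\<close> in \<open>smult\<close> matters for the scalar 0.
\<close>

definition quotient_space ::
  "('k \<Rightarrow> 'v::ab_group_add \<Rightarrow> 'v) \<Rightarrow> 'v set \<Rightarrow> 'v set \<Rightarrow> ('k, 'v set) module" where
  "quotient_space s Z B = \<lparr>
     carrier = {(\<lambda>b. z + b) ` B |z. z \<in> Z},
     mult = (\<lambda>_ _. B), one = B, zero = B,
     add = (\<lambda>C D. {c + d |c d. c \<in> C \<and> d \<in> D}),
     smult = (\<lambda>a C. {s a c + b |c b. c \<in> C \<and> b \<in> B}) \<rparr>"

definition direct_sum_space :: "'i set \<Rightarrow> ('i \<Rightarrow> ('k, 'w) module) \<Rightarrow> ('k, 'i \<Rightarrow> 'w) module" where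
  "direct_sum_space I M = \<lparr>
     carrier = {\<phi> \<in> (\<Pi>\<^sub>E i\<in>I. carrier (M i)). finite {i \<in> I. \<phi> i \<noteq> zero (M i)}},
     mult = (\<lambda>_ _. \<lambda>i\<in>I. zero (M i)), one = (\<lambda>i\<in>I. zero (M i)), zero = (\<lambda>i\<in>I. zero (M i)),
     add = (\<lambda>\<phi> \<psi>. \<lambda>i\<in>I. add (M i) (\<phi> i) (\<psi> i)),
     smult = (\<lambda>a \<phi>. \<lambda>i\<in>I. smult (M i) a (\<phi> i)) \<rparr>"

section \<open>Lie algebras\<close>

locale lie_algebra = vector_space scale
  for scale :: "'k::field \<Rightarrow> 'l::ab_group_add \<Rightarrow> 'l" +
  fixes L :: "'l set" and br :: "'l \<Rightarrow> 'l \<Rightarrow> 'l"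
  assumes fin_dim_L: "fd_subspace scale L"
    and br_closed: "x \<in> L \<Longrightarrow> y \<in> L \<Longrightarrow> br x y \<in> L"
    and br_linear_left: "y \<in> L \<Longrightarrow> lin_on scale scale L (\<lambda>x. br x y)"
    and br_linear_right: "x \<in> L \<Longrightarrow> lin_on scale scale L (br x)"
    and br_alternating: "x \<in> L \<Longrightarrow> br x x = 0"
    and jacobi: "x \<in> L \<Longrightarrow> y \<in> L \<Longrightarrow> z \<in> L \<Longrightarrow>
      br x (br y z) + br y (br z x) + br z (br x y) = 0"

definition lie_subalgebra ::
  "('k::field \<Rightarrow> 'l::ab_group_add \<Rightarrow> 'l) \<Rightarrow> 'l set \<Rightarrow> ('l \<Rightarrow> 'l \<Rightarrow> 'l) \<Rightarrow> 'l set \<Rightarrow> bool" where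
  "lie_subalgebra s L br U \<longleftrightarrow> lin_subspace s U \<and> U \<subseteq> L \<and> (\<forall>x\<in>U. \<forall>y\<in>U. br x y \<in> U)"

definition lie_ideal ::
  "('k::field \<Rightarrow> 'l::ab_group_add \<Rightarrow> 'l) \<Rightarrow> 'l set \<Rightarrow> ('l \<Rightarrow> 'l \<Rightarrow> 'l) \<Rightarrow> 'l set \<Rightarrow> bool" where
  "lie_ideal s L br I \<longleftrightarrow> lin_subspace s I \<and> I \<subseteq> L \<and> (\<forall>x\<in>L. \<forall>y\<in>I. br x y \<in> I)"

definition bracket_space ::
  "('k::field \<Rightarrow> 'l::ab_group_add \<Rightarrow> 'l) \<Rightarrow> ('l \<Rightarrow> 'l \<Rightarrow> 'l) \<Rightarrow> 'l set \<Rightarrow> 'l set \<Rightarrow> 'l set" where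
  "bracket_space s br U W = lin_span s {br u w |u w. u \<in> U \<and> w \<in> W}"

definition solvable_lie ::
  "('k::field \<Rightarrow> 'l::ab_group_add \<Rightarrow> 'l) \<Rightarrow> 'l set \<Rightarrow> ('l \<Rightarrow> 'l \<Rightarrow> 'l) \<Rightarrow> bool" where
  "solvable_lie s L br \<longleftrightarrow> (\<exists>n. ((\<lambda>U. bracket_space s br U U) ^^ n) L = {0})"

definition nilpotent_lie ::
  "('k::field \<Rightarrow> 'l::ab_group_add \<Rightarrow> 'l) \<Rightarrow> 'l set \<Rightarrow> ('l \<Rightarrow> 'l \<Rightarrow> 'l) \<Rightarrow> bool" where
  "nilpotent_lie s L br \<longleftrightarrow> (\<exists>n. (bracket_space s br L ^^ n) L = {0})"

definition is_nilradical ::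
  "('k::field \<Rightarrow> 'l::ab_group_add \<Rightarrow> 'l) \<Rightarrow> 'l set \<Rightarrow> ('l \<Rightarrow> 'l \<Rightarrow> 'l) \<Rightarrow> 'l set \<Rightarrow> bool" where
  "is_nilradical s L br N \<longleftrightarrow> lie_ideal s L br N \<and> nilpotent_lie s N br \<and>
     (\<forall>I. lie_ideal s L br I \<and> nilpotent_lie s I br \<longrightarrow> I \<subseteq> N)"

definition cartan_subalgebra ::
  "('k::field \<Rightarrow> 'l::ab_group_add \<Rightarrow> 'l) \<Rightarrow> 'l set \<Rightarrow> ('l \<Rightarrow> 'l \<Rightarrow> 'l) \<Rightarrow> 'l set \<Rightarrow> bool" where
  "cartan_subalgebra s L br H \<longleftrightarrow> lie_subalgebra s L br H \<and> nilpotent_lie s H br \<and>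
     {x \<in> L. \<forall>h\<in>H. br x h \<in> H} = H"

definition derivation_on ::
  "('k \<Rightarrow> 'l::ab_group_add \<Rightarrow> 'l) \<Rightarrow> 'l set \<Rightarrow> ('l \<Rightarrow> 'l \<Rightarrow> 'l) \<Rightarrow> ('l \<Rightarrow> 'l) \<Rightarrow> bool" where
  "derivation_on s L br D \<longleftrightarrow> lin_on s s L D \<and> D ` L \<subseteq> L \<and>
     (\<forall>x\<in>L. \<forall>y\<in>L. D (br x y) = br (D x) y + br x (D y))"

definition lie_isomorphism ::
  "('k::field \<Rightarrow> 'l::ab_group_add \<Rightarrow> 'l) \<Rightarrow> 'l set \<Rightarrow> ('l \<Rightarrow> 'l \<Rightarrow> 'l) \<Rightarrow>
   ('k \<Rightarrow> 'm::ab_group_add \<Rightarrow> 'm) \<Rightarrow> 'm set \<Rightarrow> ('m \<Rightarrow> 'm \<Rightarrow> 'm) \<Rightarrow> ('l \<Rightarrow> 'm) \<Rightarrow> bool" where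
  "lie_isomorphism s L br t M br' f \<longleftrightarrow> lie_algebra s L br \<and> lie_algebra t M br' \<and>
     lin_on s t L f \<and> bij_betw f L M \<and> (\<forall>x\<in>L. \<forall>y\<in>L. f (br x y) = br' (f x) (f y))"

text \<open>\<open>br\<close> is the bracket of a Lie algebra on the whole type, and \<open>semisimple_part s (br X)\<close> is
  the semisimple part of \<open>ad X\<close>.\<close>

definition nilshadow_bracket ::
  "('k::field \<Rightarrow> 'l::ab_group_add \<Rightarrow> 'l) \<Rightarrow> ('l \<Rightarrow> 'l \<Rightarrow> 'l) \<Rightarrow> 'l set \<Rightarrow> 'l set \<Rightarrow> 'l \<Rightarrow> 'l \<Rightarrow> 'l" where
  "nilshadow_bracket s br A N X Y =
     br X Y - semisimple_part s (br (component A N X)) Y + semisimple_part s (br (component A N Y)) X"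

section \<open>Extensions and elementary linear deformations\<close>

text \<open>\<open>\<rho>\<close> is given as an alternating bilinear map instead of a linear map on the exterior square.\<close>

locale lie_extension =
  A: lie_algebra sA A brA + H: lie_algebra sH H brH
  for sA :: "'k::field \<Rightarrow> 'a::ab_group_add \<Rightarrow> 'a" and A brA
    and sH :: "'k \<Rightarrow> 'h::ab_group_add \<Rightarrow> 'h" and H brH +
  fixes \<alpha> :: "'a \<Rightarrow> 'h \<Rightarrow> 'h" and \<rho> :: "'a \<Rightarrow> 'a \<Rightarrow> 'h"
  assumes alpha_derivation: "X \<in> A \<Longrightarrow> derivation_on sH H brH (\<alpha> X)"
    and alpha_linear: "K \<in> H \<Longrightarrow> lin_on sA sH A (\<lambda>X. \<alpha> X K)"
    and rho_closed: "X \<in> A \<Longrightarrow> Y \<in> A \<Longrightarrow> \<rho> X Y \<in> H"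
    and rho_linear_left: "Y \<in> A \<Longrightarrow> lin_on sA sH A (\<lambda>X. \<rho> X Y)"
    and rho_linear_right: "X \<in> A \<Longrightarrow> lin_on sA sH A (\<rho> X)"
    and rho_alternating: "X \<in> A \<Longrightarrow> \<rho> X X = 0"
    and alpha_bracket: "X \<in> A \<Longrightarrow> Y \<in> A \<Longrightarrow> K \<in> H \<Longrightarrow>
      \<alpha> X (\<alpha> Y K) - \<alpha> Y (\<alpha> X K) = \<alpha> (brA X Y) K + brH (\<rho> X Y) K"
    and rho_cyclic: "X \<in> A \<Longrightarrow> Y \<in> A \<Longrightarrow> Z \<in> A \<Longrightarrow>
      \<alpha> X (\<rho> Y Z) + \<alpha> Y (\<rho> Z X) + \<alpha> Z (\<rho> X Y) =
      \<rho> (brA X Y) Z + \<rho> (brA Y Z) X + \<rho> (brA Z X) Y"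

definition prod_scale :: "('k \<Rightarrow> 'a \<Rightarrow> 'a) \<Rightarrow> ('k \<Rightarrow> 'h \<Rightarrow> 'h) \<Rightarrow> 'k \<Rightarrow> 'a \<times> 'h \<Rightarrow> 'a \<times> 'h" where
  "prod_scale sA sH c = (\<lambda>(X, K). (sA c X, sH c K))"

definition extension_bracket ::
  "('a \<Rightarrow> 'a \<Rightarrow> 'a) \<Rightarrow> ('h \<Rightarrow> 'h \<Rightarrow> 'h) \<Rightarrow> ('a \<Rightarrow> 'h \<Rightarrow> 'h) \<Rightarrow> ('a \<Rightarrow> 'a \<Rightarrow> 'h::ab_group_add) \<Rightarrow>
   'a \<times> 'h \<Rightarrow> 'a \<times> 'h \<Rightarrow> 'a \<times> 'h" where
  "extension_bracket brA brH \<alpha> \<rho> = (\<lambda>(X, H) (Y, K). (brA X Y, \<rho> X Y + \<alpha> X K - \<alpha> Y H + brH H K))"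

text \<open>The extension with data \<open>\<alpha> + \<beta>\<close>, \<open>\<rho>\<close> is an elementary linear deformation of the one
  with data \<open>\<alpha>\<close>, \<open>\<rho>\<close>.\<close>

definition elementary_linear_deformation ::
  "('k::field \<Rightarrow> 'a::ab_group_add \<Rightarrow> 'a) \<Rightarrow> 'a set \<Rightarrow> ('a \<Rightarrow> 'a \<Rightarrow> 'a) \<Rightarrow>
   ('k \<Rightarrow> 'h::ab_group_add \<Rightarrow> 'h) \<Rightarrow> 'h set \<Rightarrow> ('h \<Rightarrow> 'h \<Rightarrow> 'h) \<Rightarrow>
   ('a \<Rightarrow> 'h \<Rightarrow> 'h) \<Rightarrow> ('a \<Rightarrow> 'a \<Rightarrow> 'h) \<Rightarrow> ('a \<Rightarrow> 'h \<Rightarrow> 'h) \<Rightarrow> bool" where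
  "elementary_linear_deformation sA A brA sH H brH \<alpha> \<rho> \<beta> \<longleftrightarrow>
     lie_extension sA A brA sH H brH \<alpha> \<rho> \<and>
     (\<forall>X\<in>A. \<forall>Y\<in>A. brA X Y = 0) \<and>
     (\<forall>X\<in>A. derivation_on sH H brH (\<beta> X)) \<and>
     (\<forall>K\<in>H. lin_on sA sH A (\<lambda>X. \<beta> X K)) \<and>
     (\<forall>X\<in>A. \<forall>Y\<in>A. \<forall>K\<in>H. \<beta> X (\<beta> Y K) - \<beta> Y (\<beta> X K) = 0) \<and>
     (\<forall>X\<in>A. \<forall>Y\<in>A. \<forall>K\<in>H. \<alpha> X (\<beta> Y K) - \<beta> Y (\<alpha> X K) = 0) \<and>
     (\<forall>X\<in>A. \<forall>Y\<in>A. \<forall>Z\<in>A. \<beta> X (\<rho> Y Z) = 0)"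

section \<open>Modules and cohomology\<close>

locale lie_module = lie_algebra scale L br + V: vector_space sV
  for scale :: "'k::field \<Rightarrow> 'l::ab_group_add \<Rightarrow> 'l" and L br
    and sV :: "'k \<Rightarrow> 'v::ab_group_add \<Rightarrow> 'v" +
  fixes V :: "'v set" and act :: "'l \<Rightarrow> 'v \<Rightarrow> 'v"
  assumes fin_dim_V: "fd_subspace sV V"
    and act_closed: "x \<in> L \<Longrightarrow> v \<in> V \<Longrightarrow> act x v \<in> V"
    and act_linear_left: "v \<in> V \<Longrightarrow> lin_on scale sV L (\<lambda>x. act x v)"
    and act_linear_right: "x \<in> L \<Longrightarrow> lin_on sV sV V (act x)"
    and act_br: "x \<in> L \<Longrightarrow> y \<in> L \<Longrightarrow> v \<in> V \<Longrightarrow> act (br x y) v = act x (act y v) - act y (act x v)"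

definition irreducible_lie_module ::
  "('k::field \<Rightarrow> 'l::ab_group_add \<Rightarrow> 'l) \<Rightarrow> 'l set \<Rightarrow> ('l \<Rightarrow> 'l \<Rightarrow> 'l) \<Rightarrow>
   ('k \<Rightarrow> 'v::ab_group_add \<Rightarrow> 'v) \<Rightarrow> 'v set \<Rightarrow> ('l \<Rightarrow> 'v \<Rightarrow> 'v) \<Rightarrow> bool" where
  "irreducible_lie_module s L br sV V act \<longleftrightarrow> lie_module s L br sV V act \<and> V \<noteq> {0} \<and>
     (\<forall>W. lin_subspace sV W \<and> W \<subseteq> V \<and> (\<forall>x\<in>L. \<forall>w\<in>W. act x w \<in> W) \<longrightarrow> W = {0} \<or> W = V)"

definition lie_module_isomorphic ::
  "'l set \<Rightarrow> ('k \<Rightarrow> 'v::ab_group_add \<Rightarrow> 'v) \<Rightarrow> 'v set \<Rightarrow> ('l \<Rightarrow> 'v \<Rightarrow> 'v) \<Rightarrow>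
   ('k \<Rightarrow> 'w::ab_group_add \<Rightarrow> 'w) \<Rightarrow> 'w set \<Rightarrow> ('l \<Rightarrow> 'w \<Rightarrow> 'w) \<Rightarrow> bool" where
  "lie_module_isomorphic L sV V act sW W act' \<longleftrightarrow>
     (\<exists>f. lin_on sV sW V f \<and> bij_betw f V W \<and> (\<forall>x\<in>L. \<forall>v\<in>V. f (act x v) = act' x (f v)))"

text \<open>Chevalley--Eilenberg cochains: a \<open>p\<close>-cochain is an alternating \<open>p\<close>-linear map \<open>L \<times> \<dots> \<times> L \<rightarrow> V\<close>,
  represented by a function on lists which vanishes except on lists of length \<open>p\<close> in \<open>L\<close>.\<close>

definition cochains ::
  "('k \<Rightarrow> 'l::ab_group_add \<Rightarrow> 'l) \<Rightarrow> 'l set \<Rightarrow> ('k \<Rightarrow> 'v::ab_group_add \<Rightarrow> 'v) \<Rightarrow> 'v set \<Rightarrow>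
   nat \<Rightarrow> ('l list \<Rightarrow> 'v) set" where
  "cochains s L sV V p = {f.
     (\<forall>xs. \<not> (length xs = p \<and> set xs \<subseteq> L) \<longrightarrow> f xs = 0) \<and>
     (\<forall>xs. length xs = p \<and> set xs \<subseteq> L \<longrightarrow>
        f xs \<in> V \<and>
        (\<forall>i<p. lin_on s sV L (\<lambda>x. f (xs[i := x]))) \<and>
        (\<forall>i<p. \<forall>j<p. i \<noteq> j \<and> xs ! i = xs ! j \<longrightarrow> f xs = 0))}"

text \<open>Indices start at 0; \<open>nths xs (- {i, j})\<close> is \<open>xs\<close> with the entries \<open>i\<close> and \<open>j\<close> omitted.\<close>

definition coboundary ::
  "'l set \<Rightarrow> ('l \<Rightarrow> 'l \<Rightarrow> 'l) \<Rightarrow> ('k::field \<Rightarrow> 'v::ab_group_add \<Rightarrow> 'v) \<Rightarrow> ('l \<Rightarrow> 'v \<Rightarrow> 'v) \<Rightarrow>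
   nat \<Rightarrow> ('l list \<Rightarrow> 'v) \<Rightarrow> ('l list \<Rightarrow> 'v)" where
  "coboundary L br sV act p f = (\<lambda>xs.
     if length xs = Suc p \<and> set xs \<subseteq> L then
       (\<Sum>i\<le>p. sV ((-1) ^ i) (act (xs ! i) (f (nths xs (- {i}))))) +
       (\<Sum>(i, j) \<in> {(i, j). i < j \<and> j \<le> p}.
          sV ((-1) ^ (i + j)) (f (br (xs ! i) (xs ! j) # nths xs (- {i, j}))))
     else 0)"

definition cocycles ::
  "('k::field \<Rightarrow> 'l::ab_group_add \<Rightarrow> 'l) \<Rightarrow> 'l set \<Rightarrow> ('l \<Rightarrow> 'l \<Rightarrow> 'l) \<Rightarrow>
   ('k \<Rightarrow> 'v::ab_group_add \<Rightarrow> 'v) \<Rightarrow> 'v set \<Rightarrow> ('l \<Rightarrow> 'v \<Rightarrow> 'v) \<Rightarrow> nat \<Rightarrow> ('l list \<Rightarrow> 'v) set" where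
  "cocycles s L br sV V act p = {f \<in> cochains s L sV V p. coboundary L br sV act p f = (\<lambda>_. 0)}"

definition coboundaries ::
  "('k::field \<Rightarrow> 'l::ab_group_add \<Rightarrow> 'l) \<Rightarrow> 'l set \<Rightarrow> ('l \<Rightarrow> 'l \<Rightarrow> 'l) \<Rightarrow>
   ('k \<Rightarrow> 'v::ab_group_add \<Rightarrow> 'v) \<Rightarrow> 'v set \<Rightarrow> ('l \<Rightarrow> 'v \<Rightarrow> 'v) \<Rightarrow> nat \<Rightarrow> ('l list \<Rightarrow> 'v) set" where
  "coboundaries s L br sV V act p =
     (case p of 0 \<Rightarrow> {\<lambda>_. 0} | Suc q \<Rightarrow> coboundary L br sV act q ` cochains s L sV V q)"

definition lie_cohomology ::
  "('k::field \<Rightarrow> 'l::ab_group_add \<Rightarrow> 'l) \<Rightarrow> 'l set \<Rightarrow> ('l \<Rightarrow> 'l \<Rightarrow> 'l) \<Rightarrow>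
   ('k \<Rightarrow> 'v::ab_group_add \<Rightarrow> 'v) \<Rightarrow> 'v set \<Rightarrow> ('l \<Rightarrow> 'v \<Rightarrow> 'v) \<Rightarrow> nat \<Rightarrow>
   ('k, ('l list \<Rightarrow> 'v) set) module" where
  "lie_cohomology s L br sV V act p =
     quotient_space (\<lambda>c f xs. sV c (f xs))
       (cocycles s L br sV V act p) (coboundaries s L br sV V act p)"

definition trivial_cohomology ::
  "('k::field \<Rightarrow> 'l::ab_group_add \<Rightarrow> 'l) \<Rightarrow> 'l set \<Rightarrow> ('l \<Rightarrow> 'l \<Rightarrow> 'l) \<Rightarrow> nat \<Rightarrow>
   ('k, ('l list \<Rightarrow> 'k) set) module" where
  "trivial_cohomology s L br p = lie_cohomology s L br (*) UNIV (\<lambda>_ _. 0) p"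

section \<open>Total cohomology\<close>

text \<open>
  Every finite-dimensional module is isomorphic to one whose underlying space is a subspace of
  the space of sequences \<open>nat \<Rightarrow> 'k\<close>. Such modules, as pairs of a space and an action,
  therefore represent all equivalence classes of finite-dimensional modules.
\<close>

type_synonym ('k, 'l) seq_module = "(nat \<Rightarrow> 'k) set \<times> ('l \<Rightarrow> (nat \<Rightarrow> 'k) \<Rightarrow> (nat \<Rightarrow> 'k))"

definition seq_scale :: "'k::field \<Rightarrow> (nat \<Rightarrow> 'k) \<Rightarrow> (nat \<Rightarrow> 'k)" where
  "seq_scale c v = (\<lambda>i. c * v i)"

definition irreducible_modules ::
  "('k::field \<Rightarrow> 'l::ab_group_add \<Rightarrow> 'l) \<Rightarrow> 'l set \<Rightarrow> ('l \<Rightarrow> 'l \<Rightarrow> 'l) \<Rightarrow> ('k, 'l) seq_module set" where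
  "irreducible_modules s L br = {(V, act). irreducible_lie_module s L br seq_scale V act}"

definition module_equivalence ::
  "('k::field \<Rightarrow> 'l::ab_group_add \<Rightarrow> 'l) \<Rightarrow> 'l set \<Rightarrow> ('l \<Rightarrow> 'l \<Rightarrow> 'l) \<Rightarrow>
   (('k, 'l) seq_module \<times> ('k, 'l) seq_module) set" where
  "module_equivalence s L br = {((V, act), (W, act')).
     (V, act) \<in> irreducible_modules s L br \<and> (W, act') \<in> irreducible_modules s L br \<and>
     lie_module_isomorphic L seq_scale V act seq_scale W act'}"

definition seq_module_cohomology ::
  "('k::field \<Rightarrow> 'l::ab_group_add \<Rightarrow> 'l) \<Rightarrow> 'l set \<Rightarrow> ('l \<Rightarrow> 'l \<Rightarrow> 'l) \<Rightarrow> nat \<Rightarrow>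
   ('k, 'l) seq_module \<Rightarrow> ('k, ('l list \<Rightarrow> nat \<Rightarrow> 'k) set) module" where
  "seq_module_cohomology s L br p m = lie_cohomology s L br seq_scale (fst m) (snd m) p"

definition Gamma_classes ::
  "('k::field \<Rightarrow> 'l::ab_group_add \<Rightarrow> 'l) \<Rightarrow> 'l set \<Rightarrow> ('l \<Rightarrow> 'l \<Rightarrow> 'l) \<Rightarrow> nat \<Rightarrow>
   ('k, 'l) seq_module set set" where
  "Gamma_classes s L br p =
     {m \<in> irreducible_modules s L br.
        carrier (seq_module_cohomology s L br p m) \<noteq> {zero (seq_module_cohomology s L br p m)}}
     // module_equivalence s L br"

definition total_cohomology ::
  "('k::field \<Rightarrow> 'l::ab_group_add \<Rightarrow> 'l) \<Rightarrow> 'l set \<Rightarrow> ('l \<Rightarrow> 'l \<Rightarrow> 'l) \<Rightarrow> nat \<Rightarrow>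
   ('k, ('k, 'l) seq_module set \<Rightarrow> ('l list \<Rightarrow> nat \<Rightarrow> 'k) set) module" where
  "total_cohomology s L br p =
     direct_sum_space (Gamma_classes s L br p)
       (\<lambda>C. seq_module_cohomology s L br p (SOME m. m \<in> C))"

end

theory Submission
  imports Defs "HOL-Library.Groups_Big_Fun"
begin

text \<open>
  By Lie's theorem \<open>\<ss>\<close> has a full flag of ideals, and comparing semisimple parts along the flag shows that
  \<open>X \<mapsto> \<sigma> X := ad(X_\<aa>)\<^sub>s\<close> is linear; the Cartan subalgebra is killed by every \<open>\<sigma> X\<close>, because its elements act
  nilpotently on it. So the \<open>\<sigma> X\<close> are commuting diagonalizable derivations, and they split the cochains into
  weight spaces \<open>C\<^sub>\<mu>\<close>. Irreducible modules are characters, and on \<open>C\<^sub>\<mu>\<close> the coboundary of the nilshadow with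
  trivial coefficients is the coboundary of \<open>\<ss>\<close> with coefficients in the character \<open>\<mu>\<close>.
  Conversely the complex of \<open>\<ss>\<close> with coefficients in a character \<open>\<mu>\<close> is acyclic outside the weight \<open>\<mu>\<close>, by
  Cartan's homotopy formula: some element acts on the other weight spaces with a nonzero generalized eigenvalue.
  Hence \<open>H\<^sup>p\<close> of the nilshadow is the direct sum over \<open>\<mu>\<close> of the \<open>H\<^sup>p(\<ss>, \<mu>)\<close>.
\<close>

section \<open>Linear algebra\<close>

text \<open>The elements of A lie in a nilpotent algebra but need not commute, so the Jordan
  decompositions of ad X and ad Y cannot simply be added. What survives is that each semisimple part
  kills the other element, so that the semisimple parts commute. The sum of the nilpotent parts is
  nilpotent only because both strictly lower one flag of ideals; this is the first of the two uses
  of Lie's theorem, the other being that irreducible modules are lines. No single identity relates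
  the two complexes: their coboundaries agree only weight space by weight space, each time with a
  different character. A character kills brackets but need not vanish on the nilradical. If it does
  not, it is no weight and its complex is acyclic, so it contributes to neither side. Eigenvectors
  and flags are handled modulo an invariant subspace G, since all spaces are subspaces of a fixed
  type and quotients would leave it. Characteristic 0 is essential in Lie's theorem, where a
  positive integer multiple of a weight has to be cancelled.\<close>

lemma lin_onD_add: "lin_on s t V f \<Longrightarrow> x \<in> V \<Longrightarrow> y \<in> V \<Longrightarrow> f (x + y) = f x + f y"
  and lin_onD_scale: "lin_on s t V f \<Longrightarrow> x \<in> V \<Longrightarrow> f (s c x) = t c (f x)"
  by (auto simp: lin_on_def)

lemma lin_on_subset: "lin_on s t V f \<Longrightarrow> W \<subseteq> V \<Longrightarrow> lin_on s t W f"
  unfolding lin_on_def by blast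

locale linear_space = vector_space scale for scale :: "'k::field \<Rightarrow> 'v::ab_group_add \<Rightarrow> 'v"
begin

lemma lin_onD_zero:
  assumes "lin_on scale t V f" "vector_space t" "subspace V"
  shows "f 0 = 0"
proof -
  interpret t: vector_space t by fact
  show ?thesis
    using lin_onD_scale[OF assms(1) subspace_0[OF assms(3)], of 0] by simp
qed

lemma lin_onD_minus:
  assumes "lin_on scale t V f" "vector_space t" "subspace V" "x \<in> V"
  shows "f (- x) = - f x"
proof -
  interpret t: vector_space t by fact
  show ?thesis
    using lin_onD_scale[OF assms(1) assms(4), of "-1"] by simp
qed

lemma lin_onD_diff:
  assumes "lin_on scale t V f" "vector_space t" "subspace V" "x \<in> V" "y \<in> V"
  shows "f (x - y) = f x - f y"
  using lin_onD_add[OF assms(1,4), of "- y"] lin_onD_minus[OF assms(1-3,5)] assms(3,5) subspace_neg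
  by auto

lemma lin_on_self_zero: "lin_on scale scale V f \<Longrightarrow> subspace V \<Longrightarrow> f 0 = 0"
  using lin_onD_zero vector_space_axioms by blast

lemma lin_on_self_diff:
  "lin_on scale scale V f \<Longrightarrow> subspace V \<Longrightarrow> x \<in> V \<Longrightarrow> y \<in> V \<Longrightarrow> f (x - y) = f x - f y"
  using lin_onD_diff vector_space_axioms by blast

lemma subspace_preimage:
  assumes "lin_on scale t V f" "vector_space t" "subspace V" "lin_subspace t G"
  shows "subspace {v \<in> V. f v \<in> G}"
proof -
  interpret t: vector_space t by fact
  show ?thesis
    using assms(3,4) lin_onD_zero[OF assms(1-3)]
    by (auto simp: subspace_def t.subspace_def lin_onD_add[OF assms(1)] lin_onD_scale[OF assms(1)])
qed

lemma subspace_preimage_UNIV: "lin_on scale scale UNIV f \<Longrightarrow> subspace G \<Longrightarrow> subspace {v. f v \<in> G}"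
  using subspace_preimage[OF _ vector_space_axioms subspace_UNIV, of f G] by simp

lemma lin_on_diff:
  assumes "lin_on scale scale UNIV f" "lin_on scale scale UNIV g"
  shows "lin_on scale scale UNIV (\<lambda>x. f x - g x)"
  using assms unfolding lin_on_def by (simp add: scale_right_diff_distrib)

lemma lin_on_UNIV_linear: "lin_on scale scale UNIV f \<longleftrightarrow> Vector_Spaces.linear scale scale f"
  unfolding lin_on_def Vector_Spaces.linear_def module_hom_def module_hom_axioms_def
  using vector_space_axioms module_axioms by auto

lemma subspace_of_fd:
  assumes "fd_subspace scale V" "subspace W" "W \<subseteq> V"
  shows "fd_subspace scale W"
proof -
  obtain B where B: "finite B" "V = span B"
    using assms(1) by (auto simp: fd_subspace_def)
  obtain C where C: "C \<subseteq> W" "independent C" "W \<subseteq> span C"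
    by (meson basis_exists)
  have "finite C"
    using independent_span_bound[OF B(1) C(2)] C(1) assms(3) B(2) by auto
  moreover have "W = span C"
    using C assms(2) span_minimal by blast
  ultimately show ?thesis
    by (auto simp: fd_subspace_def)
qed

lemma fd_subspace_subspace: "fd_subspace scale V \<Longrightarrow> subspace V"
  by (auto simp: fd_subspace_def)

subsection \<open>Eigenvectors\<close>

text \<open>Horner's scheme for \<open>p(T) v\<close>. It is evaluated at a vector, never formed as
  an operator, because T is linear only on an invariant subspace.\<close>

definition poly_app :: "('v \<Rightarrow> 'v) \<Rightarrow> 'v \<Rightarrow> 'k poly \<Rightarrow> 'v" where
  "poly_app T v p = fold_coeffs (\<lambda>a w. scale a v + T w) p 0"

lemma poly_app_0 [simp]: "poly_app T v 0 = 0"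
  by (simp add: poly_app_def)

text \<open>\<open>fold_coeffs\<close> does nothing on the zero polynomial, and
  \<open>pCons 0 0\<close> is that polynomial; hence the assumption on \<open>T 0\<close>.\<close>

lemma poly_app_pCons:
  assumes "T 0 = 0"
  shows "poly_app T v (pCons a p) = scale a v + T (poly_app T v p)"
  using assms by (cases "a = 0 \<and> p = 0") (auto simp: poly_app_def)

context
  fixes V T
  assumes V: "subspace V" and lin: "lin_on scale scale V T" and inv: "T ` V \<subseteq> V"
begin

private lemma T0: "T 0 = 0"
  using lin V by (rule lin_on_self_zero)

lemma poly_app_closed: "v \<in> V \<Longrightarrow> poly_app T v p \<in> V"
  using inv V by (induction p) (auto simp: poly_app_pCons T0 subspace_0 subspace_add subspace_scale)

lemma poly_app_add: "v \<in> V \<Longrightarrow> poly_app T v (p + q) = poly_app T v p + poly_app T v q"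
proof (induction p arbitrary: q)
  case (pCons a p)
  obtain b q' where q: "q = pCons b q'"
    by (cases q)
  show ?case
    using pCons by (simp add: q poly_app_pCons T0 lin_onD_add[OF lin] poly_app_closed scale_left_distrib)
qed simp

lemma poly_app_smult: "v \<in> V \<Longrightarrow> poly_app T v (Polynomial.smult c p) = scale c (poly_app T v p)"
  by (induction p) (auto simp: poly_app_pCons T0 lin_onD_scale[OF lin] poly_app_closed scale_right_distrib)

lemma poly_app_diff: "v \<in> V \<Longrightarrow> poly_app T v (p - q) = poly_app T v p - poly_app T v q"
  using poly_app_add[of v p "Polynomial.smult (-1) q"] poly_app_smult[of v "-1" q] by simp

lemma poly_app_monom: "v \<in> V \<Longrightarrow> poly_app T v (monom 1 n) = (T ^^ n) v"
  by (induction n) (simp_all add: monom_0 monom_Suc poly_app_pCons T0)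

text \<open>Otherwise every power is independent of the earlier ones, and \<open>card B + 1\<close>
  of them would be independent in a space spanned by \<open>card B\<close> vectors.\<close>

lemma funpow_in_span:
  assumes fd: "fd_subspace scale V" and v: "v \<in> V"
  shows "\<exists>k. (T ^^ k) v \<in> span ((\<lambda>i. (T ^^ i) v) ` {..<k})"
proof -
  let ?S = "\<lambda>k. (\<lambda>i. (T ^^ i) v) ` {..<k}"
  obtain B where B: "finite B" "V = span B"
    using fd by (auto simp: fd_subspace_def)
  have pow: "(T ^^ i) v \<in> V" for i
    using v inv by (induction i) auto
  show ?thesis
  proof (rule ccontr)
    assume *: "\<not> ?thesis"
    have "independent (?S k) \<and> card (?S k) = k" for k
    proof (induction k)
      case (Suc k)
      have "(T ^^ k) v \<notin> ?S k"
        using * span_base by metis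
      then show ?case
        using Suc * by (simp add: lessThan_Suc independent_insert)
    qed (simp add: independent_empty)
    then have ind: "independent (?S (Suc (card B)))" "card (?S (Suc (card B))) = Suc (card B)"
      by blast+
    have "?S (Suc (card B)) \<subseteq> span B"
      using pow B(2) by blast
    then show False
      using independent_span_bound[OF B(1) ind(1)] ind(2) by linarith
  qed
qed

lemma annihilating_poly:
  assumes fd: "fd_subspace scale V" and v: "v \<in> V"
  shows "\<exists>p. p \<noteq> 0 \<and> poly_app T v p = 0"
proof -
  let ?S = "\<lambda>k. (\<lambda>i. (T ^^ i) v) ` {..<k}"
  obtain k where k: "(T ^^ k) v \<in> span (?S k)"
    using funpow_in_span[OF fd v] by blast
  \<comment> \<open>Values at v of the polynomials of degree below k. Stated by coefficients, the
    condition leaves exactly the zero polynomial when k = 0.\<close>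
  let ?R = "{poly_app T v q | q. \<forall>i\<ge>k. coeff q i = 0}"
  have "subspace ?R"
  proof (rule subspaceI)
    show "0 \<in> ?R"
      by (rule CollectI, rule exI[of _ 0]) simp
    show "x + y \<in> ?R" if x: "x \<in> ?R" and y: "y \<in> ?R" for x y
    proof -
      obtain p where p: "x = poly_app T v p" "\<forall>i\<ge>k. coeff p i = 0"
        using x by blast
      obtain q where q: "y = poly_app T v q" "\<forall>i\<ge>k. coeff q i = 0"
        using y by blast
      from p q show ?thesis
        using poly_app_add[OF v] by (intro CollectI exI[of _ "p + q"]) simp
    qed
    show "scale c x \<in> ?R" if x: "x \<in> ?R" for c x
    proof -
      obtain p where "x = poly_app T v p" "\<forall>i\<ge>k. coeff p i = 0"
        using x by blast
      then show ?thesis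
        using poly_app_smult[OF v] by (intro CollectI exI[of _ "Polynomial.smult c p"]) simp
    qed
  qed
  moreover have "?S k \<subseteq> ?R"
  proof (clarify)
    fix i assume "i < k"
    then show "\<exists>q. (T ^^ i) v = poly_app T v q \<and> (\<forall>i\<ge>k. coeff q i = 0)"
      using poly_app_monom[OF v, of i] by (intro exI[of _ "monom 1 i"]) simp
  qed
  ultimately obtain q where q: "(T ^^ k) v = poly_app T v q" "\<forall>i\<ge>k. coeff q i = 0"
    using k span_minimal by blast
  have "coeff (monom 1 k - q) k \<noteq> 0"
    using q(2) by simp
  then have "monom 1 k - q \<noteq> 0"
    by (metis coeff_0)
  moreover have "poly_app T v (monom 1 k - q) = 0"
    using q(1) by (simp add: poly_app_diff[OF v] poly_app_monom[OF v])
  ultimately show ?thesis by blast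
qed

end

end

locale alg_closed_linear_space = linear_space scale
  for scale :: "'k::alg_closed_field \<Rightarrow> 'v::ab_group_add \<Rightarrow> 'v"
begin

text \<open>Working modulo an invariant subspace avoids quotient spaces.\<close>

lemma eigenvector_modulo:
  assumes fd: "fd_subspace scale V" and lin: "lin_on scale scale V T" and inv: "T ` V \<subseteq> V"
    and G: "subspace G" "G \<subset> V" "T ` G \<subseteq> G"
  shows "\<exists>c v. v \<in> V \<and> v \<notin> G \<and> T v - scale c v \<in> G"
proof -
  note V = fd_subspace_subspace[OF fd]
  have T0: "T 0 = 0"
    using lin V by (rule lin_on_self_zero)
  obtain v where v: "v \<in> V" "v \<notin> G"
    using G(2) by blast
  let ?P = "\<lambda>p. p \<noteq> 0 \<and> poly_app T v p \<in> G"
  obtain p0 where "p0 \<noteq> 0" "poly_app T v p0 = 0"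
    using annihilating_poly[OF V lin inv fd v(1)] by blast
  then have "?P p0"
    using subspace_0[OF G(1)] by simp
  \<comment> \<open>Least degree with \<open>p(T) v\<close> in G. If c is a root and p = (X - c) q,
    then \<open>q(T) v\<close> is outside G by minimality, while T - c maps it into G.\<close>
  then obtain p where p: "p \<noteq> 0" "poly_app T v p \<in> G" and min: "\<And>q. ?P q \<Longrightarrow> degree p \<le> degree q"
    using arg_min_nat_lemma[of ?P p0 degree] that by blast
  have "degree p > 0"
  proof (rule ccontr)
    assume "\<not> ?thesis"
    then obtain c where c: "p = [:c:]" "c \<noteq> 0"
      using p(1) by (metis degree_eq_zeroE gr0I pCons_0_0)
    then have "scale c v \<in> G"
      using p(2) by (simp add: poly_app_pCons T0)
    then have "scale (inverse c) (scale c v) \<in> G"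
      using G(1) subspace_scale by blast
    then show False
      using c v(2) by simp
  qed
  then obtain c where "poly p c = 0"
    using alg_closed_imp_poly_has_root by blast
  then obtain q where q: "p = [:- c, 1:] * q"
    using poly_eq_0_iff_dvd by blast
  then have "q \<noteq> 0"
    using p(1) by auto
  then have "degree p = Suc (degree q)"
    unfolding q by (subst degree_mult_eq) auto
  then have "poly_app T v q \<notin> G"
    using min[of q] \<open>q \<noteq> 0\<close> by auto
  moreover have "poly_app T v p = T (poly_app T v q) - scale c (poly_app T v q)"
  proof -
    have "p = pCons 0 q - Polynomial.smult c q"
      by (simp add: q)
    then show ?thesis
      by (simp add: poly_app_diff[OF V lin inv v(1)] poly_app_smult[OF V lin inv v(1)] poly_app_pCons T0)
  qed
  ultimately show ?thesis
    using p(2) poly_app_closed[OF V lin inv v(1), of q] by auto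
qed

end

subsection \<open>Independent families of subspaces\<close>

definition indep_family :: "('i \<Rightarrow> 'v::ab_group_add set) \<Rightarrow> bool" where
  "indep_family E \<longleftrightarrow> (\<forall>M g. finite M \<longrightarrow> (\<forall>i\<in>M. g i \<in> E i) \<longrightarrow> sum g M = 0 \<longrightarrow> (\<forall>i\<in>M. g i = 0))"

lemma indep_familyD:
  assumes "indep_family E" "finite M" "sum g M = 0" "\<And>i. i \<in> M \<Longrightarrow> g i \<in> E i" "i \<in> M"
  shows "g i = 0"
  using assms by (simp add: indep_family_def)

text \<open>\<open>Sum_any\<close> is 0 on functions with infinite support, so finite support is
  demanded separately. Indices run over the whole type because the occurring eigenvalues or weights
  are not known in advance.\<close>

definition decomposes :: "('i \<Rightarrow> 'v::ab_group_add set) \<Rightarrow> 'v \<Rightarrow> ('i \<Rightarrow> 'v) \<Rightarrow> bool" where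
  "decomposes E v g \<longleftrightarrow> (\<forall>i. g i \<in> E i) \<and> finite {i. g i \<noteq> 0} \<and> v = Sum_any g"

lemma decomposesD:
  assumes "decomposes E v g"
  shows "g i \<in> E i" "finite {i. g i \<noteq> 0}" "v = (\<Sum>i | g i \<noteq> 0. g i)"
  using assms by (auto simp: decomposes_def Sum_any.expand_set)

context linear_space
begin

lemma lin_on_sum:
  assumes f: "lin_on scale t V f" "vector_space t" and V: "subspace V" and "\<And>i. i \<in> M \<Longrightarrow> g i \<in> V"
  shows "f (sum g M) = (\<Sum>i\<in>M. f (g i))"
  using assms(4)
  by (induction M rule: infinite_finite_induct)
     (simp_all add: lin_onD_zero[OF f V] lin_onD_add[OF f(1)] subspace_sum[OF V])

lemma lin_on_ext:
  assumes "lin_on scale scale UNIV f" "lin_on scale scale UNIV g" "\<And>v. v \<in> S \<Longrightarrow> f v = g v" "span S = UNIV"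
  shows "f = g"
proof
  fix x
  have "x \<in> span S" using assms(4) by simp
  then show "f x = g x"
  proof (induction rule: span_induct_alt)
    case base
    then show ?case using assms(1,2) by (simp add: lin_on_self_zero)
  next
    case (step c x y)
    then show ?case using assms(1-3) by (simp add: lin_on_def)
  qed
qed

lemma decomposes_unique:
  assumes ind: "indep_family E" and E: "\<And>i. subspace (E i)" and "decomposes E v g" "decomposes E v h"
  shows "g = h"
proof -
  let ?M = "{i. g i \<noteq> 0} \<union> {i. h i \<noteq> 0}"
  have fin: "finite ?M"
    using assms(3,4) by (auto simp: decomposes_def)
  have "sum g ?M = (\<Sum>i | g i \<noteq> 0. g i)"
    using fin by (intro sum.mono_neutral_right) auto
  then have "sum g ?M = v"
    using decomposesD(3)[OF assms(3)] by simp
  moreover have "sum h ?M = v"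
  proof -
    have "sum h ?M = (\<Sum>i | h i \<noteq> 0. h i)"
      using fin by (intro sum.mono_neutral_right) auto
    then show ?thesis
      using decomposesD(3)[OF assms(4)] by simp
  qed
  ultimately have sum0: "(\<Sum>i\<in>?M. g i - h i) = 0"
    by (simp add: sum_subtractf)
  have "g i - h i \<in> E i" for i
    using decomposesD(1)[OF assms(3)] decomposesD(1)[OF assms(4)] E subspace_diff by blast
  then have *: "g i - h i = 0" if "i \<in> ?M" for i
    by (rule indep_familyD[OF ind fin sum0 _ that])
  show ?thesis
  proof
    show "g i = h i" for i
      using *[of i] by (cases "i \<in> ?M") auto
  qed
qed

lemma decomposes_add:
  assumes "\<And>i. subspace (E i)" "decomposes E v g" "decomposes E w h"
  shows "decomposes E (v + w) (\<lambda>i. g i + h i)"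
proof -
  have fin: "finite {i. g i \<noteq> 0}" "finite {i. h i \<noteq> 0}"
    using assms(2,3) by (simp_all add: decomposes_def)
  moreover have "{i. g i + h i \<noteq> 0} \<subseteq> {i. g i \<noteq> 0} \<union> {i. h i \<noteq> 0}"
    by fastforce
  ultimately have "finite {i. g i + h i \<noteq> 0}"
    by (meson finite_Un finite_subset)
  then show ?thesis
    using assms fin by (simp add: decomposes_def subspace_add Sum_any.distrib)
qed

lemma decomposes_scale:
  assumes "\<And>i. subspace (E i)" "decomposes E v g"
  shows "decomposes E (scale c v) (\<lambda>i. scale c (g i))"
proof (cases "c = 0")
  case True
  then show ?thesis
    using assms by (simp add: decomposes_def subspace_0)
next
  case False
  then show ?thesis
    using assms by (simp add: decomposes_def subspace_scale Sum_any.expand_set scale_sum_right)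
qed

lemma decomposes_single:
  assumes "\<And>i. subspace (E i)" "v \<in> E i"
  shows "decomposes E v (\<lambda>j. if j = i then v else 0)"
proof -
  have "{j. (if j = i then v else 0) \<noteq> 0} \<subseteq> {i}" by auto
  then show ?thesis
    using assms by (auto simp: decomposes_def subspace_0 Sum_any.expand_superset finite_subset)
qed

lemma decomposes_span:
  assumes E: "\<And>i. subspace (E i)" and "v \<in> span (\<Union>i. E i)"
  shows "\<exists>g. decomposes E v g"
  using assms(2)
proof (induction rule: span_induct_alt)
  case base
  have "decomposes E 0 (\<lambda>_. 0)"
    using E by (simp add: decomposes_def subspace_0)
  then show ?case by blast
next
  case (step c x y)
  then obtain i g where "x \<in> E i" "decomposes E y g" by blast
  then show ?case
    using decomposes_add[where E = E, OF E decomposes_scale[where E = E, OF E decomposes_single[where E = E, OF E]]]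
    by blast
qed

subsection \<open>Simultaneous eigenspaces\<close>

text \<open>A weight is any function on the index type. That the occurring weights are linear when
  the operators depend linearly on the index is a later consequence
  (\<open>weight_add\<close>).\<close>

definition wt_space :: "('i \<Rightarrow> 'v \<Rightarrow> 'v) \<Rightarrow> ('i \<Rightarrow> 'k) \<Rightarrow> 'v set" where
  "wt_space \<Theta> \<mu> = {v. \<forall>i. \<Theta> i v = scale (\<mu> i) v}"

lemma subspace_wt_space:
  assumes "\<And>i. lin_on scale scale UNIV (\<Theta> i)"
  shows "subspace (wt_space \<Theta> \<mu>)"
  using assms lin_on_self_zero[OF assms]
  by (auto simp: wt_space_def subspace_def lin_on_def scale_right_distrib mult.commute)

text \<open>If two weights differ at i, then \<open>\<Theta> i - \<nu> i\<close> removes the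
  component of weight \<nu> from the sum and multiplies that of weight \<kappa> by the nonzero
  scalar \<open>\<kappa> i - \<nu> i\<close>; the shortened sum is still in W. For W = {0} this
  becomes the independence of the weight spaces.\<close>

lemma wt_components_closed:
  assumes lin: "\<And>i. lin_on scale scale UNIV (\<Theta> i)"
    and W: "subspace W" "\<And>i. \<Theta> i ` W \<subseteq> W"
    and "finite M" "\<And>\<mu>. \<mu> \<in> M \<Longrightarrow> g \<mu> \<in> wt_space \<Theta> \<mu>" "sum g M \<in> W" "\<mu> \<in> M"
  shows "g \<mu> \<in> W"
  using assms(4-)
proof (induction M arbitrary: g \<mu> rule: finite_induct)
  case (insert \<nu> M)
  have other: "g \<kappa> \<in> W" if "\<kappa> \<in> M" for \<kappa>
  proof -
    have "\<kappa> \<noteq> \<nu>" using that insert by blast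
    then obtain i where i: "\<kappa> i \<noteq> \<nu> i" by blast
    let ?h = "\<lambda>\<mu>. scale (\<mu> i - \<nu> i) (g \<mu>)"
    have "sum ?h (insert \<nu> M) \<in> W"
    proof -
      have "sum ?h (insert \<nu> M) = (\<Sum>\<mu>\<in>insert \<nu> M. \<Theta> i (g \<mu>) - scale (\<nu> i) (g \<mu>))"
        using insert.prems(1) by (intro sum.cong) (auto simp: wt_space_def scale_left_diff_distrib)
      also have "\<dots> = \<Theta> i (sum g (insert \<nu> M)) - scale (\<nu> i) (sum g (insert \<nu> M))"
        by (simp only: sum_subtractf scale_sum_right
            lin_on_sum[OF lin vector_space_axioms subspace_UNIV UNIV_I])
      also have "\<dots> \<in> W"
        using insert.prems(2) W by (intro subspace_diff subspace_scale) auto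
      finally show ?thesis .
    qed
    moreover have "sum ?h (insert \<nu> M) = sum ?h M"
      using insert.hyps by simp
    moreover have "?h \<mu> \<in> wt_space \<Theta> \<mu>" if "\<mu> \<in> M" for \<mu>
      by (intro subspace_scale[OF subspace_wt_space[OF lin]] insert.prems(1)) (simp add: that)
    ultimately have "?h \<kappa> \<in> W"
      by (intro insert.IH[of ?h, OF _ _ that]) simp_all
    then have "scale (inverse (\<kappa> i - \<nu> i)) (?h \<kappa>) \<in> W"
      using W subspace_scale by blast
    then show ?thesis
      using i by simp
  qed
  show ?case
  proof (cases "\<mu> = \<nu>")
    case True
    have "sum g (insert \<nu> M) - sum g M \<in> W"
      by (rule subspace_diff[OF W(1) insert.prems(2) subspace_sum[OF W(1) other]])
    then show ?thesis
      using True insert.hyps by simp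
  next
    case False
    then show ?thesis using other insert.prems by blast
  qed
qed simp

lemma indep_family_wt_space:
  assumes lin: "\<And>i. lin_on scale scale UNIV (\<Theta> i)"
  shows "indep_family (wt_space \<Theta>)"
  unfolding indep_family_def
proof (intro allI impI ballI)
  fix M g \<mu>
  assume "finite M" "\<forall>i\<in>M. g i \<in> wt_space \<Theta> i" "sum g M = 0" "\<mu> \<in> M"
  moreover have "subspace {0}" "\<Theta> i ` {0} \<subseteq> {0}" for i
    using lin_on_self_zero[OF lin subspace_UNIV] by (simp_all add: subspace_def)
  ultimately have "g \<mu> \<in> {0}"
    by (intro wt_components_closed[where \<Theta> = \<Theta>, OF lin, where W = "{0}" and M = M and g = g and \<mu> = \<mu>]) simp_all
  then show "g \<mu> = 0" by simp
qed


text \<open>The operators indexed by I have a common eigenspace W containing v, and T k preserves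
  it. The eigencomponents of v for T k therefore stay in W and are eigenvectors for all of
  \<open>insert k I\<close>.\<close>

lemma span_simultaneous_eigenvectors:
  assumes "finite I" "\<And>i. i \<in> I \<Longrightarrow> lin_on scale scale UNIV (T i)"
    "\<And>i. i \<in> I \<Longrightarrow> span {v. \<exists>c. T i v = scale c v} = UNIV"
    "\<And>i j x. i \<in> I \<Longrightarrow> j \<in> I \<Longrightarrow> T i (T j x) = T j (T i x)"
  shows "span {v. \<forall>i\<in>I. \<exists>c. T i v = scale c v} = UNIV"
  using assms
proof (induction I rule: finite_induct)
  case (insert k I)
  let ?E = "{v. \<forall>i\<in>I. \<exists>c. T i v = scale c v}" and ?E' = "{v. \<forall>i\<in>insert k I. \<exists>c. T i v = scale c v}"
  \<comment> \<open>A family with a one-element index type: its weight spaces are the eigenspaces of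
    T k.\<close>
  let ?\<Theta> = "\<lambda>_ :: unit. T k"
  have lin: "lin_on scale scale UNIV (?\<Theta> i)" for i
    using insert.prems(1) by simp
  have "{v. \<exists>c. T k v = scale c v} \<subseteq> (\<Union>\<mu>. wt_space ?\<Theta> \<mu>)"
  proof
    fix v assume "v \<in> {v. \<exists>c. T k v = scale c v}"
    then obtain c where "T k v = scale c v" by blast
    then have "v \<in> wt_space ?\<Theta> (\<lambda>_. c)" by (simp add: wt_space_def)
    then show "v \<in> (\<Union>\<mu>. wt_space ?\<Theta> \<mu>)" by blast
  qed
  then have spanT: "span (\<Union>\<mu>. wt_space ?\<Theta> \<mu>) = UNIV"
    using insert.prems(2)[of k] span_mono by blast
  have "?E \<subseteq> span ?E'"
  proof
    fix v assume "v \<in> ?E"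
    then obtain w where w: "\<And>i. i \<in> I \<Longrightarrow> T i v = scale (w i) v"
      by (auto dest!: bchoice)
    let ?W = "{u. \<forall>i\<in>I. T i u = scale (w i) u}"
    have W: "subspace ?W"
    proof (rule subspaceI)
      show "0 \<in> ?W"
        using lin_on_self_zero[OF insert.prems(1) subspace_UNIV] by simp
      show "x + y \<in> ?W" if "x \<in> ?W" "y \<in> ?W" for x y
        using that lin_onD_add[OF insert.prems(1)] by (simp add: scale_right_distrib)
      show "scale c x \<in> ?W" if "x \<in> ?W" for c x
        using that lin_onD_scale[OF insert.prems(1)] by (auto simp: mult.commute[of c])
    qed
    have "T k u \<in> ?W" if "u \<in> ?W" for u
    proof (intro CollectI ballI)
      fix i assume "i \<in> I"
      then show "T i (T k u) = scale (w i) (T k u)"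
        using that insert.prems(3)[of i k u] lin_onD_scale[OF insert.prems(1)[of k]] by simp
    qed
    then have TW: "?\<Theta> i ` ?W \<subseteq> ?W" for i
      by blast
    have "\<exists>g. decomposes (wt_space ?\<Theta>) v g"
      by (rule decomposes_span) (simp_all add: subspace_wt_space[OF lin] spanT)
    then obtain g where g: "decomposes (wt_space ?\<Theta>) v g" by blast
    note g' = decomposesD[OF g]
    have "g \<mu> \<in> span ?E'" if "g \<mu> \<noteq> 0" for \<mu>
    proof (rule span_base)
      have "g \<mu> \<in> ?W"
      proof (rule wt_components_closed[where \<Theta> = ?\<Theta>, OF lin W TW g'(2)])
        show "sum g {i. g i \<noteq> 0} \<in> ?W"
          using w g'(3) by simp
      qed (use g'(1) that in auto)
      moreover have "T k (g \<mu>) = scale (\<mu> ()) (g \<mu>)"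
        using g'(1)[of \<mu>] by (simp add: wt_space_def)
      ultimately show "g \<mu> \<in> ?E'" by auto
    qed
    then have "sum g {i. g i \<noteq> 0} \<in> span ?E'"
      by (intro span_sum) simp
    then show "v \<in> span ?E'"
      using g'(3) by simp
  qed
  then have "span ?E \<subseteq> span ?E'"
    by (rule span_minimal[OF _ subspace_span])
  moreover have "span ?E = UNIV"
    using insert by simp
  ultimately show ?case by blast
qed (simp add: span_UNIV)

subsection \<open>Generalized eigenspaces and the Jordan decomposition\<close>

definition shift :: "('v \<Rightarrow> 'v) \<Rightarrow> 'k \<Rightarrow> 'v \<Rightarrow> 'v" where
  "shift T c v = T v - scale c v"

definition gen_eigenspace :: "('v \<Rightarrow> 'v) \<Rightarrow> 'k \<Rightarrow> 'v set" where
  "gen_eigenspace T c = {v. \<exists>n. (shift T c ^^ n) v = 0}"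

lemma nilpotent_endo_apply: "nilpotent_endo scale M \<Longrightarrow> \<exists>n. (M ^^ n) v = 0"
  unfolding nilpotent_endo_def by (metis (full_types))

lemma lin_on_comp:
  "lin_on scale scale UNIV f \<Longrightarrow> lin_on scale scale UNIV g \<Longrightarrow> lin_on scale scale UNIV (f \<circ> g)"
  by (simp add: lin_on_def)

lemma lin_on_funpow: "lin_on scale scale UNIV F \<Longrightarrow> lin_on scale scale UNIV (F ^^ n)"
  by (induction n) (auto simp: lin_on_def)

lemma lin_on_shift:
  assumes T: "lin_on scale scale UNIV T"
  shows "lin_on scale scale UNIV (shift T c)"
proof -
  have "shift T c (x + y) = shift T c x + shift T c y" for x y
    using lin_onD_add[OF T, of x y] by (simp add: shift_def scale_right_distrib)
  moreover have "shift T c (scale a x) = scale a (shift T c x)" for a x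
    using lin_onD_scale[OF T, of x a] by (simp add: shift_def scale_right_diff_distrib mult.commute)
  ultimately show ?thesis
    unfolding lin_on_def by blast
qed

lemma funpow_zero_mono:
  assumes "lin_on scale scale UNIV F" "(F ^^ n) v = 0" "n \<le> m"
  shows "(F ^^ m) v = 0"
proof -
  have "F ^^ m = F ^^ (m - n) \<circ> F ^^ n"
    using assms(3) funpow_add[of "m - n" n F] by simp
  then show ?thesis
    using assms(2) lin_on_self_zero[OF lin_on_funpow[OF assms(1)] subspace_UNIV] by simp
qed

context
  fixes T
  assumes T: "lin_on scale scale UNIV T"
begin

lemma shift_funpow_commute: "(shift T c ^^ n) (shift T d v) = shift T d ((shift T c ^^ n) v)"
proof (induction n)
  case (Suc n)
  have "shift T c (shift T d w) = shift T d (shift T c w)" for w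
    using lin_on_self_diff[OF T subspace_UNIV] lin_onD_scale[OF T]
    by (simp add: shift_def scale_right_diff_distrib mult.commute)
  then show ?case using Suc by simp
qed simp

lemma subspace_gen_eigenspace: "subspace (gen_eigenspace T c)"
proof (rule subspaceI)
  show "0 \<in> gen_eigenspace T c"
    by (auto simp: gen_eigenspace_def intro!: exI[of _ 0])
next
  fix x y assume "x \<in> gen_eigenspace T c" "y \<in> gen_eigenspace T c"
  then obtain n m where *: "(shift T c ^^ n) x = 0" "(shift T c ^^ m) y = 0"
    by (auto simp: gen_eigenspace_def)
  have "(shift T c ^^ (n + m)) x = 0" "(shift T c ^^ (n + m)) y = 0"
    using funpow_zero_mono[OF lin_on_shift[OF T] *(1)] funpow_zero_mono[OF lin_on_shift[OF T] *(2)] by simp_all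
  then have "(shift T c ^^ (n + m)) (x + y) = 0"
    using lin_onD_add[OF lin_on_funpow[OF lin_on_shift[OF T]]] by simp
  then show "x + y \<in> gen_eigenspace T c"
    by (auto simp: gen_eigenspace_def)
next
  fix a x assume "x \<in> gen_eigenspace T c"
  then show "scale a x \<in> gen_eigenspace T c"
    using lin_onD_scale[OF lin_on_funpow[OF lin_on_shift[OF T]]]
    by (fastforce simp: gen_eigenspace_def)
qed

lemma shift_gen_eigenspace:
  assumes "v \<in> gen_eigenspace T c"
  shows "shift T d v \<in> gen_eigenspace T c"
proof -
  obtain n where "(shift T c ^^ n) v = 0"
    using assms by (auto simp: gen_eigenspace_def)
  then have "(shift T c ^^ n) (shift T d v) = 0"
    using lin_on_self_zero[OF lin_on_shift[OF T, of d] subspace_UNIV] shift_funpow_commute[of n c d v] by simp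
  then show ?thesis
    by (auto simp: gen_eigenspace_def)
qed

lemma gen_eigenspace_invariant: "v \<in> gen_eigenspace T c \<Longrightarrow> T v \<in> gen_eigenspace T c"
  using shift_gen_eigenspace[of v c 0] by (simp add: shift_def)

lemma gen_eigenspace_shiftD:
  assumes "shift T c v \<in> gen_eigenspace T c"
  shows "v \<in> gen_eigenspace T c"
proof -
  obtain n where "(shift T c ^^ n) (shift T c v) = 0"
    using assms by (auto simp: gen_eigenspace_def)
  then have "(shift T c ^^ Suc n) v = 0"
    by (simp add: funpow_swap1)
  then show ?thesis
    unfolding gen_eigenspace_def by blast
qed

lemma eigenvector_in_gen_eigenspace:
  assumes "v \<in> gen_eigenspace T c" "T v = scale d v" "v \<noteq> 0"
  shows "c = d"
proof -
  obtain n where n: "(shift T c ^^ n) v = 0"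
    using assms(1) by (auto simp: gen_eigenspace_def)
  have "(shift T c ^^ m) v = scale ((d - c) ^ m) v" for m
    using assms(2) lin_onD_scale[OF T]
    by (induction m) (simp_all add: shift_def algebra_simps mult.commute)
  then show ?thesis
    using n assms(3) by simp
qed

lemma gen_eigenspace_shift_inj:
  assumes "v \<in> gen_eigenspace T c" "c \<noteq> d" "(shift T d ^^ n) v = 0"
  shows "v = 0"
  using assms(3)
proof (induction n)
  case (Suc n)
  let ?w = "(shift T d ^^ n) v"
  have w: "?w \<in> gen_eigenspace T c"
    by (induction n) (use assms(1) shift_gen_eigenspace in auto)
  have "T ?w = scale d ?w"
    using Suc.prems shift_def[of T d ?w] by simp
  then have "?w = 0"
    using eigenvector_in_gen_eigenspace[OF w, of d] assms(2) by argo
  then show ?case using Suc.IH by blast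
qed simp

text \<open>T - c is the nonzero scalar d - c plus the locally nilpotent T - d, hence onto. Inside V
  the equation is solved by induction on the exponent n that kills v.\<close>

lemma gen_eigenspace_shift_surj:
  assumes V: "subspace V" "T ` V \<subseteq> V" and "v \<in> gen_eigenspace T d" "v \<in> V" "c \<noteq> d"
  shows "\<exists>y\<in>gen_eigenspace T d \<inter> V. shift T c y = v"
proof -
  have "\<exists>y\<in>gen_eigenspace T d \<inter> V. shift T c y = v" if "(shift T d ^^ n) v = 0" "v \<in> V" for n v
    using that
  proof (induction n arbitrary: v)
    case 0
    then show ?case
      using lin_on_self_zero[OF lin_on_shift[OF T] subspace_UNIV] subspace_0[OF V(1)]
        subspace_0[OF subspace_gen_eigenspace] by force
  next
    case (Suc n)
    have v: "v \<in> gen_eigenspace T d"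
      using Suc.prems(1) unfolding gen_eigenspace_def by blast
    have "shift T d v \<in> V"
      using V Suc.prems by (auto simp: shift_def intro!: subspace_diff subspace_scale)
    moreover have "(shift T d ^^ n) (shift T d v) = 0"
      using Suc.prems(1) by (simp add: funpow_swap1)
    ultimately obtain y where y: "y \<in> gen_eigenspace T d \<inter> V" "shift T c y = shift T d v"
      using Suc.IH by blast
    \<comment> \<open>Since (T - c) y = (T - d) v, one has (T - c) (v - y) = (d - c) v.\<close>
    let ?z = "scale (inverse (d - c)) (v - y)"
    have "?z \<in> gen_eigenspace T d \<inter> V"
      using v Suc.prems y(1) V(1) subspace_gen_eigenspace by (simp add: subspace_diff subspace_scale)
    moreover have "shift T c ?z = scale (inverse (d - c)) (shift T c v - shift T d v)"
      using y(2) lin_onD_scale[OF lin_on_shift[OF T]] lin_on_self_diff[OF lin_on_shift[OF T] subspace_UNIV]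
      by simp
    moreover have "shift T c v - shift T d v = scale (d - c) v"
      by (simp add: shift_def scale_left_diff_distrib)
    ultimately show ?case
      using assms(5) by auto
  qed
  then show ?thesis
    using assms(3,4) by (auto simp: gen_eigenspace_def)
qed

text \<open>A power of T - d kills the component for d and is injective on every other generalized
  eigenspace.\<close>

lemma indep_family_gen_eigenspace: "indep_family (gen_eigenspace T)"
  unfolding indep_family_def
proof (intro allI impI)
  fix M g
  assume "finite M" "\<forall>i\<in>M. g i \<in> gen_eigenspace T i" "sum g M = 0"
  then show "\<forall>i\<in>M. g i = 0"
  proof (induction M arbitrary: g rule: finite_induct)
    case (insert d M)
    then obtain n where n: "(shift T d ^^ n) (g d) = 0"
      by (auto simp: gen_eigenspace_def)
    let ?F = "shift T d ^^ n"
    have lin: "lin_on scale scale UNIV ?F"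
      using T lin_on_funpow lin_on_shift by blast
    have "(\<Sum>c\<in>insert d M. ?F (g c)) = ?F (sum g (insert d M))"
      by (rule lin_on_sum[OF lin vector_space_axioms subspace_UNIV UNIV_I, symmetric])
    also have "\<dots> = 0"
      using insert.prems(2) lin_on_self_zero[OF lin] by simp
    finally have "(\<Sum>c\<in>M. ?F (g c)) = 0"
      using n insert.hyps by simp
    moreover have F: "?F v \<in> gen_eigenspace T c" if "v \<in> gen_eigenspace T c" for c v
      by (induction n) (use that shift_gen_eigenspace in auto)
    ultimately have *: "\<forall>c\<in>M. ?F (g c) = 0"
      using insert.prems(1) by (intro insert.IH ballI) simp_all
    have "g c = 0" if "c \<in> M" for c
      using gen_eigenspace_shift_inj[of "g c" c d n] * that insert.prems(1) insert.hyps(2) by auto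
    then show ?case
      using insert.prems(2) insert.hyps by simp
  qed simp
qed

end

end

context alg_closed_linear_space
begin

text \<open>If the span G were proper, some v outside G would satisfy (T - c) v in G. Now G is
  contained in the sum of the generalized eigenspace for c and (T - c) G, since T - c is onto on all
  the others. Correcting v by an element b of G turns (T - c) (v - b), and hence v - b, into a
  generalized eigenvector for c.\<close>

lemma gen_eigenspaces_span:
  assumes T: "lin_on scale scale UNIV T" and fd: "fd_subspace scale V" and inv: "T ` V \<subseteq> V"
  shows "V \<subseteq> span (\<Union>c. gen_eigenspace T c \<inter> V)" (is "V \<subseteq> ?G")
proof (rule ccontr)
  assume neg: "\<not> ?thesis"
  note V = fd_subspace_subspace[OF fd]
  have GV: "?G \<subseteq> V"
    by (intro span_minimal V) auto
  have TG: "T ` ?G \<subseteq> ?G"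
  proof -
    have "subspace {x. T x \<in> ?G}"
      by (rule subspace_preimage_UNIV[OF T subspace_span])
    moreover have "(\<Union>c. gen_eigenspace T c \<inter> V) \<subseteq> {x. T x \<in> ?G}"
      using gen_eigenspace_invariant[OF T] inv by (auto intro!: span_base)
    ultimately have "?G \<subseteq> {x. T x \<in> ?G}"
      using span_minimal by blast
    then show ?thesis by blast
  qed
  have "?G \<subset> V"
    using GV neg by blast
  from eigenvector_modulo[OF fd lin_on_subset[OF T subset_UNIV] inv subspace_span this TG]
  obtain c v where v: "v \<in> V" "v \<notin> ?G" "shift T c v \<in> ?G"
    unfolding shift_def by blast
  let ?R = "{a + shift T c b | a b. a \<in> gen_eigenspace T c \<inter> V \<and> b \<in> ?G}"
  have zero: "shift T c 0 = 0"
    using lin_on_self_zero[OF lin_on_shift[OF T] subspace_UNIV] .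
  have "subspace ?R"
  proof (rule subspaceI)
    show "0 \<in> ?R"
      using zero subspace_0[OF subspace_gen_eigenspace[OF T]] subspace_0[OF V] span_zero by force
  next
    fix x y assume "x \<in> ?R" "y \<in> ?R"
    then obtain a b a' b' where "x = a + shift T c b" "y = a' + shift T c b'"
      "a \<in> gen_eigenspace T c \<inter> V" "b \<in> ?G" "a' \<in> gen_eigenspace T c \<inter> V" "b' \<in> ?G" by blast
    then show "x + y \<in> ?R"
      using subspace_gen_eigenspace[OF T] V lin_onD_add[OF lin_on_shift[OF T]]
      by (intro CollectI exI[of _ "a + a'"] exI[of _ "b + b'"]) (auto simp: subspace_add span_add)
  next
    fix r x assume "x \<in> ?R"
    then obtain a b where "x = a + shift T c b" "a \<in> gen_eigenspace T c \<inter> V" "b \<in> ?G" by blast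
    then show "scale r x \<in> ?R"
      using subspace_gen_eigenspace[OF T] V lin_onD_scale[OF lin_on_shift[OF T]]
      by (intro CollectI exI[of _ "scale r a"] exI[of _ "scale r b"])
         (auto simp: subspace_scale span_scale scale_right_distrib)
  qed
  moreover have "(\<Union>c. gen_eigenspace T c \<inter> V) \<subseteq> ?R"
  proof (clarify)
    fix d x assume x: "x \<in> gen_eigenspace T d" "x \<in> V"
    show "\<exists>a b. x = a + shift T c b \<and> a \<in> gen_eigenspace T c \<inter> V \<and> b \<in> ?G"
    proof (cases "d = c")
      case True
      then show ?thesis using x zero span_zero by force
    next
      case False
      then obtain y where "y \<in> gen_eigenspace T d \<inter> V" "shift T c y = x"
        using gen_eigenspace_shift_surj[OF T V inv x] by metis
      then show ?thesis
        using subspace_0[OF subspace_gen_eigenspace[OF T]] subspace_0[OF V]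
        by (intro exI[of _ 0] exI[of _ y]) (auto intro: span_base)
    qed
  qed
  ultimately have "?G \<subseteq> ?R"
    by (intro span_minimal)
  then obtain a b where ab: "shift T c v = a + shift T c b" "a \<in> gen_eigenspace T c" "b \<in> ?G"
    using v(3) by blast
  then have "shift T c (v - b) = a"
    using lin_on_self_diff[OF lin_on_shift[OF T] subspace_UNIV] by simp
  then have "v - b \<in> gen_eigenspace T c"
    using ab(2) gen_eigenspace_shiftD[OF T] by blast
  moreover have "v - b \<in> V"
    using v(1) ab(3) GV V subspace_diff by blast
  ultimately have "v - b \<in> ?G"
    by (intro span_base) blast
  then show False
    using v(2) ab(3) span_add[of "v - b" _ b] by simp
qed

lemma exists_semisimple_operator:
  assumes fd: "fd_subspace scale UNIV" and T: "lin_on scale scale UNIV T"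
  shows "\<exists>S. lin_on scale scale UNIV S \<and> (\<forall>c. \<forall>v\<in>gen_eigenspace T c. S v = scale c v)"
proof -
  let ?E = "gen_eigenspace T"
  note E = subspace_gen_eigenspace[OF T] and uniq = decomposes_unique[OF indep_family_gen_eigenspace[OF T] subspace_gen_eigenspace[OF T]]
  have "\<exists>g. decomposes ?E v g" for v
    using gen_eigenspaces_span[OF T fd] by (intro decomposes_span[OF E]) auto
  then obtain C where C: "\<And>v. decomposes ?E v (C v)" by metis
  define S where "S v = Sum_any (\<lambda>c. scale c (C v c))" for v
  have fin: "finite {c. scale c (C v c) \<noteq> 0}" for v
    using C[of v] by (auto simp: decomposes_def intro: finite_subset[of _ "{c. C v c \<noteq> 0}"])
  have "lin_on scale scale UNIV S"
    unfolding lin_on_def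
  proof (intro conjI ballI allI)
    fix x y
    have "C (x + y) = (\<lambda>c. C x c + C y c)"
      by (rule uniq[OF C decomposes_add[OF E C C]])
    then show "S (x + y) = S x + S y"
      using fin by (simp add: S_def scale_right_distrib Sum_any.distrib)
  next
    fix a x
    have *: "C (scale a x) = (\<lambda>c. scale a (C x c))"
      by (rule uniq[OF C decomposes_scale[OF E C]])
    show "S (scale a x) = scale a (S x)"
    proof (cases "a = 0")
      case False
      then have "S (scale a x) = (\<Sum>c | scale c (C x c) \<noteq> 0. scale a (scale c (C x c)))"
        by (simp add: S_def * Sum_any.expand_set mult.commute)
      then show ?thesis
        by (simp add: S_def Sum_any.expand_set scale_sum_right)
    next
      case True
      have "S 0 = Sum_any (\<lambda>c. scale c (scale 0 (C x c)))"
        using * True by (simp add: S_def)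
      then show ?thesis
        using True by simp
    qed
  qed
  moreover have "S v = scale c v" if "v \<in> ?E c" for c v
  proof -
    have "C v = (\<lambda>d. if d = c then v else 0)"
      by (rule uniq[OF C decomposes_single[where E = ?E and i = c, OF E that]])
    moreover have "{d. scale d (if d = c then v else 0) \<noteq> 0} \<subseteq> {c}" by auto
    ultimately show ?thesis
      by (simp add: S_def Sum_any.expand_superset[of "{c}"])
  qed
  ultimately show ?thesis by blast
qed

text \<open>Every subspace has a complement spanned by eigenvectors.\<close>

lemma semisimple_endoI:
  assumes S: "lin_on scale scale UNIV S" and eig: "span {v. \<exists>c. S v = scale c v} = UNIV"
  shows "semisimple_endo scale S"
  unfolding semisimple_endo_def
proof (intro conjI allI impI)
  show "Vector_Spaces.linear scale scale S"
    using S lin_on_UNIV_linear by blast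
  fix W assume W: "subspace W \<and> S ` W \<subseteq> W"
  let ?Eig = "{v. \<exists>c. S v = scale c v}"
  obtain B where B: "B \<subseteq> W" "independent B" "W \<subseteq> span B"
    by (meson basis_exists)
  then have WB: "W = span B"
    using W span_minimal by blast
  obtain C where C: "B \<subseteq> C" "C \<subseteq> B \<union> ?Eig" "independent C" "B \<union> ?Eig \<subseteq> span C"
    using maximal_independent_subset_extend[of B "B \<union> ?Eig"] B(2) by blast
  have spanC: "span C = UNIV"
    using C(4) eig span_minimal[OF _ subspace_span, of ?Eig C] by blast
  let ?U = "span (C - B)"
  have "x = 0" if "x \<in> span B" "x \<in> ?U" for x
  proof -
    have *: "representation C x = representation B x" "representation C x = representation (C - B) x"
      using that C(1,3) by (auto intro!: representation_extend)
    have "representation C x b = 0" for b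
      using representation_ne_zero[of B x b] representation_ne_zero[of "C - B" x b] *
      by (metis DiffD2)
    then show ?thesis
      using sum_nonzero_representation_eq[OF C(3), of x] spanC by simp
  qed
  then have "W \<inter> ?U = {0}"
    using WB span_zero by blast
  moreover have "UNIV = {u + w |u w. u \<in> W \<and> w \<in> ?U}"
    using span_Un[of B "C - B"] spanC C(1) WB by (simp add: Un_absorb1)
  moreover have "S ` ?U \<subseteq> ?U"
  proof -
    have "subspace {x. S x \<in> ?U}"
      by (rule subspace_preimage_UNIV[OF S subspace_span])
    moreover have "C - B \<subseteq> {x. S x \<in> ?U}"
    proof
      fix x assume x: "x \<in> C - B"
      then obtain c where "S x = scale c x"
        using C(2) by blast
      then show "x \<in> {x. S x \<in> ?U}"
        using x by (simp add: span_scale span_base)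
    qed
    ultimately have "?U \<subseteq> {x. S x \<in> ?U}"
      by (intro span_minimal)
    then show ?thesis by blast
  qed
  ultimately show "\<exists>U. direct_decomposition scale UNIV W U \<and> S ` U \<subseteq> U"
    using W by (intro exI[of _ ?U]) (simp add: direct_decomposition_def)
qed

text \<open>The span of the eigenvectors has an invariant complement U, which would contain a
  further eigenvector of S if it were nonzero.\<close>

lemma semisimple_endo_eigenvectors:
  assumes fd: "fd_subspace scale UNIV" and S: "semisimple_endo scale S"
  shows "span {v. \<exists>c. S v = scale c v} = UNIV"
proof -
  let ?Eig = "{v. \<exists>c. S v = scale c v}"
  have lin: "lin_on scale scale UNIV S"
    using S lin_on_UNIV_linear by (auto simp: semisimple_endo_def)
  have "S ` span ?Eig \<subseteq> span ?Eig"
  proof -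
    have "subspace {x. S x \<in> span ?Eig}"
      by (rule subspace_preimage_UNIV[OF lin subspace_span])
    moreover have "?Eig \<subseteq> {x. S x \<in> span ?Eig}"
    proof
      fix x assume x: "x \<in> ?Eig"
      then obtain c where "S x = scale c x" by blast
      then show "x \<in> {x. S x \<in> span ?Eig}"
        using span_scale[OF span_base[OF x], of c] by simp
    qed
    ultimately have "span ?Eig \<subseteq> {x. S x \<in> span ?Eig}"
      by (intro span_minimal)
    then show ?thesis by blast
  qed
  then obtain U where U: "direct_decomposition scale UNIV (span ?Eig) U" "S ` U \<subseteq> U"
    using S subspace_span unfolding semisimple_endo_def by blast
  have "U = {0}"
  proof (rule ccontr)
    assume "U \<noteq> {0}"
    then have "{0} \<subset> U"
      using U(1) subspace_0 by (auto simp: direct_decomposition_def)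
    then obtain c v where "v \<in> U" "v \<noteq> 0" "S v - scale c v = 0"
      using eigenvector_modulo[OF subspace_of_fd[OF fd] lin_on_subset[OF lin] U(2), of "{0}"] U(1)
        lin_on_self_zero[OF lin] by (auto simp: direct_decomposition_def)
    moreover from this have "v \<in> span ?Eig"
      by (auto intro: span_base)
    ultimately show False
      using U(1) by (auto simp: direct_decomposition_def)
  qed
  then show ?thesis
    using U(1) by (auto simp: direct_decomposition_def)
qed

lemma locally_nilpotent_funpow:
  assumes fd: "fd_subspace scale UNIV" and F: "lin_on scale scale UNIV F" and nil: "\<And>v. \<exists>n. (F ^^ n) v = 0"
  shows "\<exists>n. F ^^ n = (\<lambda>_. 0)"
proof -
  obtain B where B: "finite B" "span B = UNIV"
    using fd by (auto simp: fd_subspace_def)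
  obtain m where m: "\<And>v. (F ^^ m v) v = 0"
    using nil by metis
  let ?n = "Max (m ` B)"
  have "F ^^ ?n = (\<lambda>_. 0)"
  proof (rule lin_on_ext[OF lin_on_funpow[OF F] _ _ B(2)])
    show "(F ^^ ?n) v = 0" if "v \<in> B" for v
      using B(1) that by (intro funpow_zero_mono[OF F m]) simp
  qed (simp add: lin_on_def)
  then show ?thesis by blast
qed

context
  fixes T
  assumes fd: "fd_subspace scale UNIV" and T: "lin_on scale scale UNIV T"
begin

lemma span_gen_eigenspaces: "span (\<Union>c. gen_eigenspace T c) = UNIV"
  using gen_eigenspaces_span[OF T fd] by auto

private lemma jordan_decompositionI:
  assumes S: "lin_on scale scale UNIV S" and eig: "\<And>c v. v \<in> gen_eigenspace T c \<Longrightarrow> S v = scale c v"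
  shows "jordan_decomposition scale T S (\<lambda>x. T x - S x)"
proof -
  let ?M = "\<lambda>x. T x - S x"
  have "span {v. \<exists>c. S v = scale c v} = UNIV"
    using span_gen_eigenspaces span_mono[of "\<Union>c. gen_eigenspace T c" "{v. \<exists>c. S v = scale c v}"] eig by blast
  then have "semisimple_endo scale S"
    using semisimple_endoI S by blast
  moreover have M: "lin_on scale scale UNIV ?M"
    by (rule lin_on_diff[OF T S])
  moreover have "\<exists>n. ?M ^^ n = (\<lambda>_. 0)"
  proof (rule locally_nilpotent_funpow[OF fd M])
    fix v
    have "v \<in> span (\<Union>c. gen_eigenspace T c)"
      using span_gen_eigenspaces by simp
    then show "\<exists>n. (?M ^^ n) v = 0"
    proof (induction rule: span_induct_alt)
      case base
      then show ?case by (intro exI[of _ 0]) simp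
    next
      case (step a x y)
      then obtain c n m where x: "x \<in> gen_eigenspace T c" "(shift T c ^^ n) x = 0" and y: "(?M ^^ m) y = 0"
        by (auto simp: gen_eigenspace_def)
      \<comment> \<open>S is the scalar c on this generalized eigenspace, so T - S and T - c agree
        there.\<close>
      have "(?M ^^ k) x = (shift T c ^^ k) x \<and> (?M ^^ k) x \<in> gen_eigenspace T c" for k
      proof (induction k)
        case (Suc k)
        let ?w = "(?M ^^ k) x"
        have "S ?w = scale c ?w"
          using Suc eig by blast
        then have "?M ?w = shift T c ?w"
          by (simp add: shift_def[of T c ?w])
        then show ?case
          using conjunct1[OF Suc] shift_gen_eigenspace[OF T conjunct2[OF Suc], of c] by simp
      qed (use x in simp)
      then have "(?M ^^ n) x = 0"
        using x(2) by simp
      then have "(?M ^^ (n + m)) x = 0" "(?M ^^ (n + m)) y = 0"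
        using y by (auto intro: funpow_zero_mono[OF M])
      then have "(?M ^^ (n + m)) (scale a x + y) = 0"
        using lin_on_funpow[OF M, of "n + m"] by (simp add: lin_on_def)
      then show ?case by blast
    qed
  qed
  moreover have "S \<circ> ?M = ?M \<circ> S"
  proof (rule lin_on_ext[OF _ _ _ span_gen_eigenspaces])
    show "lin_on scale scale UNIV (S \<circ> ?M)" "lin_on scale scale UNIV (?M \<circ> S)"
      by (rule lin_on_comp[OF S M] lin_on_comp[OF M S])+
    fix v assume "v \<in> (\<Union>c. gen_eigenspace T c)"
    then obtain c where v: "v \<in> gen_eigenspace T c" by blast
    then show "(S \<circ> ?M) v = (?M \<circ> S) v"
      using eig gen_eigenspace_invariant[OF T v] lin_on_self_diff[OF S subspace_UNIV]
        lin_onD_scale[OF T] lin_onD_scale[OF S] by (simp add: scale_right_diff_distrib)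
  qed
  ultimately show ?thesis
    using lin_on_UNIV_linear by (simp add: jordan_decomposition_def nilpotent_endo_def)
qed

text \<open>T preserves the eigenspace of S for c, and there T - S coincides with T - c.\<close>

lemma eigenspace_subset_gen_eigenspace:
  assumes S: "lin_on scale scale UNIV S" and comm: "\<And>x. S (T x) = T (S x)"
    and nil: "\<And>v. \<exists>n. ((\<lambda>x. T x - S x) ^^ n) v = 0" and v: "S v = scale c v"
  shows "v \<in> gen_eigenspace T c"
proof -
  let ?M = "\<lambda>x. T x - S x"
  obtain n where n: "(?M ^^ n) v = 0"
    using nil by blast
  have "(?M ^^ k) v = (shift T c ^^ k) v \<and> S ((?M ^^ k) v) = scale c ((?M ^^ k) v)" for k
  proof (induction k)
    case (Suc k)
    let ?w = "(?M ^^ k) v"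
    note w = conjunct2[OF Suc]
    have "?M ?w = shift T c ?w"
      by (simp add: w shift_def[of T c ?w])
    moreover have "S (?M ?w) = scale c (?M ?w)"
      by (simp add: w comm lin_on_self_diff[OF S subspace_UNIV] lin_onD_scale[OF T] lin_onD_scale[OF S]
          scale_right_diff_distrib)
    ultimately show ?case
      using conjunct1[OF Suc] by simp
  qed (use v in simp)
  then show ?thesis
    using n by (auto simp: gen_eigenspace_def)
qed

text \<open>The eigenvectors of any such S lie in the matching generalized eigenspaces of T and span
  everything, which determines S. Nilpotency is asked for pointwise because it will be verified
  along a flag (\<open>ss_add\<close>).\<close>

lemma semisimple_part_eqI:
  assumes S: "lin_on scale scale UNIV S" and eig: "span {v. \<exists>c. S v = scale c v} = UNIV"
    and comm: "\<And>x. S (T x) = T (S x)" and nil: "\<And>v. \<exists>n. ((\<lambda>x. T x - S x) ^^ n) v = 0"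
  shows "semisimple_part scale T = S"
proof -
  obtain S0 where S0: "lin_on scale scale UNIV S0" "\<And>c v. v \<in> gen_eigenspace T c \<Longrightarrow> S0 v = scale c v"
    using exists_semisimple_operator[OF fd T] by blast
  have uniq: "S' = S0" if S': "lin_on scale scale UNIV S'" "span {v. \<exists>c. S' v = scale c v} = UNIV"
    "\<And>x. S' (T x) = T (S' x)" "\<And>v. \<exists>n. ((\<lambda>x. T x - S' x) ^^ n) v = 0" for S'
  proof (rule lin_on_ext[OF S'(1) S0(1) _ S'(2)])
    fix v assume "v \<in> {v. \<exists>c. S' v = scale c v}"
    then obtain c where c: "S' v = scale c v" by blast
    then show "S' v = S0 v"
      using S0(2)[OF eigenspace_subset_gen_eigenspace[OF S'(1,3,4) c]] by simp
  qed
  have "semisimple_part scale T = S0"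
    unfolding semisimple_part_def
  proof (rule the_equality)
    show "\<exists>M. jordan_decomposition scale T S0 M"
      using jordan_decompositionI[OF S0] by blast
    fix S' assume "\<exists>M. jordan_decomposition scale T S' M"
    then obtain M where ss: "semisimple_endo scale S'" and nM: "nilpotent_endo scale M"
      and cM: "S' \<circ> M = M \<circ> S'" and TM: "T = (\<lambda>x. S' x + M x)"
      by (auto simp: jordan_decomposition_def)
    have linS: "lin_on scale scale UNIV S'"
      using ss lin_on_UNIV_linear by (auto simp: semisimple_endo_def)
    have "S' (M x) = M (S' x)" for x
      using fun_cong[OF cM, of x] by simp
    then have "S' (T x) = T (S' x)" for x
      by (simp only: TM lin_onD_add[OF linS UNIV_I UNIV_I])
    moreover have "(\<lambda>x. T x - S' x) = M"
      by (simp add: TM)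
    then have "\<exists>n. ((\<lambda>x. T x - S' x) ^^ n) v = 0" for v
      using nilpotent_endo_apply[OF nM, of v] by simp
    ultimately show "S' = S0"
      by (intro uniq linS semisimple_endo_eigenvectors[OF fd ss])
  qed
  then show ?thesis
    using uniq[OF assms] by simp
qed

text \<open>From here on \<open>semisimple_part\<close> is used only through these facts and
  \<open>semisimple_part_eqI\<close>; its definition as a unique description is not opened
  again.\<close>

lemma lin_on_semisimple_part: "lin_on scale scale UNIV (semisimple_part scale T)"
  and semisimple_part_gen_eigenspace:
    "v \<in> gen_eigenspace T c \<Longrightarrow> semisimple_part scale T v = scale c v"
  and span_eigenvectors_semisimple_part: "span {v. \<exists>c. semisimple_part scale T v = scale c v} = UNIV"
  and semisimple_part_commute: "semisimple_part scale T (T x) = T (semisimple_part scale T x)"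
  and nilpotent_part_nilpotent: "\<exists>n. ((\<lambda>x. T x - semisimple_part scale T x) ^^ n) v = 0"
proof -
  obtain S where S: "lin_on scale scale UNIV S" "\<And>c v. v \<in> gen_eigenspace T c \<Longrightarrow> S v = scale c v"
    using exists_semisimple_operator[OF fd T] by blast
  have j: "jordan_decomposition scale T S (\<lambda>x. T x - S x)"
    by (rule jordan_decompositionI[OF S])
  then have eig: "span {v. \<exists>c. S v = scale c v} = UNIV"
    using semisimple_endo_eigenvectors[OF fd] by (simp add: jordan_decomposition_def)
  have comm: "S (T x) = T (S x)" for x
  proof -
    have "S (T x - S x) = T (S x) - S (S x)"
      using j by (auto simp: jordan_decomposition_def fun_eq_iff)
    then show ?thesis
      using lin_on_self_diff[OF S(1) subspace_UNIV] by simp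
  qed
  have nil: "\<exists>n. ((\<lambda>x. T x - S x) ^^ n) v = 0" for v
    using j by (intro nilpotent_endo_apply) (simp add: jordan_decomposition_def)
  have "semisimple_part scale T = S"
    by (rule semisimple_part_eqI[OF S(1) eig comm nil])
  then show "lin_on scale scale UNIV (semisimple_part scale T)"
    "v \<in> gen_eigenspace T c \<Longrightarrow> semisimple_part scale T v = scale c v"
    "span {v. \<exists>c. semisimple_part scale T v = scale c v} = UNIV"
    "semisimple_part scale T (T x) = T (semisimple_part scale T x)"
    "\<exists>n. ((\<lambda>x. T x - semisimple_part scale T x) ^^ n) v = 0"
    using S eig comm nil by auto
qed

end

end

section \<open>Lie's theorem\<close>

locale solvable_module = lie_module scale UNIV br sV V act
  for scale :: "'k::{field_char_0,alg_closed_field} \<Rightarrow> 'l::ab_group_add \<Rightarrow> 'l" and br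
    and sV :: "'k \<Rightarrow> 'v::ab_group_add \<Rightarrow> 'v" and V act +
  assumes solvable: "solvable_lie scale UNIV br"
begin

interpretation L: linear_space scale ..
interpretation M: alg_closed_linear_space sV ..

lemma V_subspace: "V.subspace V"
  using fin_dim_V by (rule M.fd_subspace_subspace)

lemma act_add_right: "v \<in> V \<Longrightarrow> w \<in> V \<Longrightarrow> act x (v + w) = act x v + act x w"
  and act_scale_right: "v \<in> V \<Longrightarrow> act x (sV c v) = sV c (act x v)"
  using act_linear_right[of x] by (simp_all add: lin_on_def)

lemma act_add_left: "v \<in> V \<Longrightarrow> act (x + y) v = act x v + act y v"
  and act_scale_left: "v \<in> V \<Longrightarrow> act (scale c x) v = sV c (act x v)"
  using act_linear_left[of v] by (simp_all add: lin_on_def)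

lemma act_diff_right: "v \<in> V \<Longrightarrow> w \<in> V \<Longrightarrow> act x (v - w) = act x v - act x w"
  using M.lin_on_self_diff[OF act_linear_right V_subspace] by simp

lemma act_zero_right: "act x 0 = 0"
  using M.lin_on_self_zero[OF act_linear_right V_subspace] by simp

lemma act_shift_lin: "lin_on sV sV V (\<lambda>v. act x v - sV c v)"
  by (simp add: lin_on_def act_add_right act_scale_right V.scale_right_distrib
      V.scale_right_diff_distrib mult.commute)

lemma act_funpow_closed: "v \<in> V \<Longrightarrow> (act x ^^ n) v \<in> V"
  by (induction n) (simp_all add: act_closed)

context
  fixes G
  assumes G: "V.subspace G" "G \<subseteq> V" "\<And>x v. v \<in> G \<Longrightarrow> act x v \<in> G"
begin

text \<open>On the span of the powers of \<open>z\<close> applied to \<open>w\<close>, an element \<open>u\<close> acts modulo \<open>G\<close> by an upper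
  triangular matrix with superdiagonal \<open>k * \<mu> [u, z]\<close>; comparing this with a minimal linear relation
  between the powers replaces the usual trace argument.\<close>

lemma weight_bracket_zero:
  assumes br: "\<And>u. u \<in> U \<Longrightarrow> br u z \<in> U"
    and w: "w \<in> V" "w \<notin> G" "\<And>u. u \<in> U \<Longrightarrow> act u w - sV (\<mu> u) w \<in> G"
    and u: "u \<in> U"
  shows "\<mu> (br u z) = 0"
proof (rule ccontr)
  assume nz: "\<mu> (br u z) \<noteq> 0"
  define w' where "w' k = (act z ^^ k) w" for k
  define S where "S k = V.span (G \<union> w' ` {..<k})" for k
  have w'V: "w' k \<in> V" for k
    unfolding w'_def using w(1) by (rule act_funpow_closed)
  have w'Suc: "w' (Suc k) = act z (w' k)" for k
    by (simp add: w'_def)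
  have S_sub: "V.subspace (S k)" for k
    by (simp add: S_def)
  have S0: "S 0 = G"
    using G(1) by (simp add: S_def V.span_eq_iff)
  have S_mono: "S j \<subseteq> S k" if "j \<le> k" for j k
    unfolding S_def by (rule V.span_mono) (use that in auto)
  have S_V: "S k \<subseteq> V" for k
    unfolding S_def by (rule V.span_minimal[OF _ V_subspace]) (use w'V G(2) in auto)
  have w'S: "w' j \<in> S k" if "j < k" for j k
    unfolding S_def by (rule V.span_base) (use that in auto)
  have S_ind: "P v" if "v \<in> S k" "V.subspace {v \<in> V. P v}" "\<And>g. g \<in> G \<Longrightarrow> P g" "\<And>j. j < k \<Longrightarrow> P (w' j)" for P v k
  proof -
    have "S k \<subseteq> {v \<in> V. P v}"
      unfolding S_def by (rule V.span_minimal[OF _ that(2)]) (use that(3,4) w'V G(2) in auto)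
    then show ?thesis using that(1) by blast
  qed
  have zS: "act z v \<in> S (Suc k)" if "v \<in> S k" for v k
  proof (rule S_ind[OF that])
    show "V.subspace {v \<in> V. act z v \<in> S (Suc k)}"
      by (rule M.subspace_preimage[OF act_linear_right V.vector_space_axioms V_subspace S_sub]) simp
    show "act z g \<in> S (Suc k)" if "g \<in> G" for g
      using G(3)[OF that] S0 S_mono[of 0 "Suc k"] by blast
    show "act z (w' j) \<in> S (Suc k)" if "j < k" for j
      using w'S[of "Suc j" "Suc k"] that by (simp add: w'Suc)
  qed
  \<comment> \<open>The factor k counts the commutators picked up when u passes k copies of z. For k
    = 0 it is 0 and k - 1 = 0, so the claim reduces to the assumption on w.\<close>
  have key: "act u (w' k) - sV (\<mu> u) (w' k) - sV (of_nat k * \<mu> (br u z)) (w' (k - 1)) \<in> S (k - 1)"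
    if "u \<in> U" for u k
    using that
  proof (induction k arbitrary: u)
    case 0
    then show ?case
      using w(3) S0 by (simp add: w'_def)
  next
    case (Suc k)
    let ?l = "\<mu> (br u z)"
    let ?s = "act u (w' k) - sV (\<mu> u) (w' k) - sV (of_nat k * ?l) (w' (k - 1))"
    have s: "?s \<in> S (k - 1)"
      using Suc by blast
    then have sV: "?s \<in> V" using S_V by blast
    have zs: "act z ?s \<in> S k"
    proof (cases k)
      case 0
      then show ?thesis using s G(3) S0 by simp
    next
      case (Suc j)
      then show ?thesis using zS[OF s] by simp
    qed
    let ?t = "act (br u z) (w' k) - sV ?l (w' k) - sV (of_nat k * \<mu> (br (br u z) z)) (w' (k - 1))"
    have "?t \<in> S k"
      using Suc.IH[OF br[OF Suc.prems]] S_mono[of "k - 1" k] by auto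
    moreover have "sV (of_nat k * c) (w' (k - 1)) \<in> S k" for c
      using w'S[of "k - 1" k] S_sub V.subspace_scale V.subspace_0[OF S_sub] by (cases k) auto
    ultimately have "?t + sV (of_nat k * \<mu> (br (br u z) z)) (w' (k - 1)) \<in> S k"
      using S_sub V.subspace_add by blast
    then have t: "act (br u z) (w' k) - sV ?l (w' k) \<in> S k"
      by simp
    have "act u (w' k) = sV (\<mu> u) (w' k) + sV (of_nat k * ?l) (w' (k - 1)) + ?s"
      by simp
    then have "act z (act u (w' k)) = act z (sV (\<mu> u) (w' k) + sV (of_nat k * ?l) (w' (k - 1)) + ?s)"
      by (rule arg_cong)
    also have "\<dots> = sV (\<mu> u) (w' (Suc k)) + sV (of_nat k * ?l) (act z (w' (k - 1))) + act z ?s"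
      using w'V sV V_subspace by (simp only: act_add_right act_scale_right w'Suc V.subspace_add V.subspace_scale)
    also have "sV (of_nat k * ?l) (act z (w' (k - 1))) = sV (of_nat k * ?l) (w' k)"
      by (cases k) (simp_all add: w'Suc)
    finally have "act z (act u (w' k)) = sV (\<mu> u) (w' (Suc k)) + sV (of_nat k * ?l) (w' k) + act z ?s" .
    moreover have "act u (w' (Suc k)) = act z (act u (w' k)) + act (br u z) (w' k)"
      using act_br[of u z "w' k"] w'V by (simp add: w'Suc)
    ultimately have "act u (w' (Suc k)) - sV (\<mu> u) (w' (Suc k)) - sV (of_nat (Suc k) * ?l) (w' k)
        = act z ?s + (act (br u z) (w' k) - sV ?l (w' k))"
      by (simp add: V.scale_left_distrib algebra_simps)
    then show ?case
      using zs t S_sub V.subspace_add by simp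
  qed
  have "\<exists>k. w' k \<in> S k"
  proof -
    have "act z ` V \<subseteq> V"
      using act_closed by blast
    from M.funpow_in_span[OF V_subspace act_linear_right this fin_dim_V w(1)]
    obtain k where "(act z ^^ k) w \<in> V.span ((\<lambda>i. (act z ^^ i) w) ` {..<k})"
      by blast
    moreover have "(\<lambda>i. (act z ^^ i) w) = w'"
      by (simp add: w'_def fun_eq_iff)
    ultimately have "w' k \<in> V.span (w' ` {..<k})"
      by (simp add: w'_def)
    moreover have "V.span (w' ` {..<k}) \<subseteq> S k"
      unfolding S_def by (rule V.span_mono) blast
    ultimately show ?thesis by blast
  qed
  \<comment> \<open>The first power of z whose value at w depends, modulo G, on the earlier
    ones.\<close>
  then obtain n where n: "w' n \<in> S n" and min: "\<And>k. k < n \<Longrightarrow> w' k \<notin> S k"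
    using exists_least_iff[of "\<lambda>k. w' k \<in> S k"] by blast
  have "n \<noteq> 0"
    using n w(2) S0 by (auto simp: w'_def intro!: gr0I)
  then obtain m where m: "n = Suc m"
    using not0_implies_Suc by blast
  \<comment> \<open>As \<open>w' n\<close> lies in \<open>S n\<close>, this applies to
    \<open>w' n\<close> itself. Compared with \<open>key\<close> for n, it puts n times
    \<open>\<mu> (br u z)\<close> times \<open>w' m\<close> into \<open>S m\<close>; in
    characteristic 0 this contradicts the choice of n.\<close>
  have lower: "act u v - sV (\<mu> u) v \<in> S m" if "v \<in> S n" for v
  proof (rule S_ind[OF that])
    show "V.subspace {v \<in> V. act u v - sV (\<mu> u) v \<in> S m}"
      by (rule M.subspace_preimage[OF act_shift_lin V.vector_space_axioms V_subspace S_sub])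
    show "act u g - sV (\<mu> u) g \<in> S m" if "g \<in> G" for g
      using V.subspace_diff[OF G(1) G(3)[OF that] V.subspace_scale[OF G(1) that]] S0 S_mono[of 0 m] by auto
    show "act u (w' j) - sV (\<mu> u) (w' j) \<in> S m" if "j < n" for j
    proof -
      have "sV (of_nat j * \<mu> (br u z)) (w' (j - 1)) \<in> S m"
        using that m w'S[of "j - 1" m] S_sub V.subspace_scale V.subspace_0[OF S_sub] by (cases j) auto
      moreover have "S (j - 1) \<subseteq> S m"
        using that m by (intro S_mono) simp
      ultimately have "act u (w' j) - sV (\<mu> u) (w' j) - sV (of_nat j * \<mu> (br u z)) (w' (j - 1))
          + sV (of_nat j * \<mu> (br u z)) (w' (j - 1)) \<in> S m"
        using key[OF u, of j] by (intro V.subspace_add[OF S_sub]) auto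
      then show ?thesis by simp
    qed
  qed
  have n1: "n - 1 = m"
    using m by simp
  from V.subspace_diff[OF S_sub lower[OF n] key[OF u, of n, unfolded n1]]
  have "sV (of_nat n * \<mu> (br u z)) (w' m) \<in> S m"
    by simp
  then have "sV (inverse (of_nat n * \<mu> (br u z))) (sV (of_nat n * \<mu> (br u z)) (w' m)) \<in> S m"
    by (rule V.subspace_scale[OF S_sub])
  moreover have "of_nat n * \<mu> (br u z) \<noteq> 0"
    using nz \<open>n \<noteq> 0\<close> by simp
  ultimately have "w' m \<in> S m"
    by (simp del: inverse_mult_distrib)
  then show False
    using min[of m] m by simp
qed

text \<open>The vectors of weight \<mu> modulo G form a space W that z preserves, because \<mu>
  vanishes on the brackets [u, z]. An eigenvector of z on W modulo G is then one for U and z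
  together.\<close>

lemma lie_theorem_step:
  assumes U: "subspace U" and br: "\<And>u. u \<in> U \<Longrightarrow> br u z \<in> U"
    and ex: "v \<in> V" "v \<notin> G" "\<And>u. u \<in> U \<Longrightarrow> \<exists>c. act u v - sV c v \<in> G"
  shows "\<exists>v\<in>V - G. \<forall>x\<in>span (insert z U). \<exists>c. act x v - sV c v \<in> G"
proof -
  obtain \<mu> where l: "\<And>u. u \<in> U \<Longrightarrow> act u v - sV (\<mu> u) v \<in> G"
    using ex(3) by metis
  define W where "W = {w \<in> V. \<forall>u\<in>U. act u w - sV (\<mu> u) w \<in> G}"
  have W: "V.subspace W"
    using V_subspace G(1) unfolding V.subspace_def W_def
    by (auto simp: act_zero_right lin_onD_add[OF act_shift_lin] lin_onD_scale[OF act_shift_lin]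
        simp del: V.scale_scale)
  have WV: "W \<subseteq> V"
    by (auto simp: W_def)
  have GW: "G \<subseteq> W"
    using G by (auto simp: W_def intro!: V.subspace_diff V.subspace_scale)
  have "G \<subset> W"
    using GW ex(1,2) l by (auto simp: W_def)
  have zW: "act z ` W \<subseteq> W"
  proof clarify
    fix w assume w: "w \<in> W"
    show "act z w \<in> W"
    proof (cases "w \<in> G")
      case True
      then show ?thesis using GW G(3) by blast
    next
      case False
      have wV: "w \<in> V" and wW: "\<And>u. u \<in> U \<Longrightarrow> act u w - sV (\<mu> u) w \<in> G"
        using w by (auto simp: W_def)
      have "act u (act z w) - sV (\<mu> u) (act z w) \<in> G" if u: "u \<in> U" for u
      proof -
        have "\<mu> (br u z) = 0"
          using weight_bracket_zero[OF br wV False wW u] .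
        then have "act (br u z) w \<in> G"
          using wW[OF br[OF u]] by simp
        moreover have "act z (act u w - sV (\<mu> u) w) \<in> G"
          by (rule G(3)[OF wW[OF u]])
        ultimately have "act z (act u w - sV (\<mu> u) w) + act (br u z) w \<in> G"
          by (intro V.subspace_add[OF G(1)])
        moreover have "act z (act u w - sV (\<mu> u) w) + act (br u z) w = act u (act z w) - sV (\<mu> u) (act z w)"
          using act_br[of u z w] wV V_subspace
          by (simp add: act_diff_right act_closed act_scale_right V.subspace_scale)
        ultimately show ?thesis by simp
      qed
      then show ?thesis
        using wV by (simp add: W_def act_closed)
    qed
  qed
  have "lin_on sV sV W (act z)"
    using act_linear_right WV lin_on_subset by blast
  moreover have "act z ` G \<subseteq> G"
    using G(3) by blast
  ultimately obtain c v' where v': "v' \<in> W" "v' \<notin> G" "act z v' - sV c v' \<in> G"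
    using M.eigenvector_modulo[OF M.subspace_of_fd[OF fin_dim_V W WV] _ zW G(1) \<open>G \<subset> W\<close>] by blast
  have v'V: "v' \<in> V" using v' WV by blast
  have "\<exists>c. act x v' - sV c v' \<in> G" if x: "x \<in> span (insert z U)" for x
  proof -
    obtain a where a: "x - scale a z \<in> U"
      using x U by (auto simp: span_insert span_eq_iff[THEN iffD2])
    let ?u = "x - scale a z"
    have "act ?u v' - sV (\<mu> ?u) v' + sV a (act z v' - sV c v') \<in> G"
      using v' a G(1) by (intro V.subspace_add V.subspace_scale) (auto simp: W_def)
    moreover have "act x v' = act ?u v' + sV a (act z v')"
      using act_add_left[OF v'V, of ?u "scale a z"] act_scale_left[OF v'V] by simp
    ultimately have "act x v' - sV (\<mu> ?u + a * c) v' \<in> G"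
      by (simp add: V.scale_left_distrib V.scale_right_diff_distrib algebra_simps)
    then show ?thesis by blast
  qed
  then show ?thesis
    using v' v'V by blast
qed

text \<open>Climbs the derived series from 0 to the whole algebra. Between \<open>D (Suc j)\<close>
  and \<open>D j\<close>, generators z of \<open>D j\<close> are added one by one; the step applies
  because brackets of elements of \<open>D j\<close> lie in \<open>D (Suc j)\<close>, which every
  intermediate space contains.\<close>

theorem lie_theorem_modulo:
  assumes "G \<noteq> V"
  shows "\<exists>v\<in>V - G. \<forall>x. \<exists>c. act x v - sV c v \<in> G"
proof -
  define D where "D i = ((\<lambda>U. bracket_space scale br U U) ^^ i) UNIV" for i
  obtain n where n: "D n = {0}"
    using solvable by (auto simp: solvable_lie_def D_def)
  have D_Suc: "D (Suc i) = bracket_space scale br (D i) (D i)" for i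
    by (simp add: D_def)
  have D_sub: "subspace (D i)" for i
    by (cases i) (simp_all add: D_def bracket_space_def)
  have D_dec: "D (Suc i) \<subseteq> D i" for i
  proof (induction i)
    case 0
    then show ?case by (simp add: D_def)
  next
    case (Suc i)
    then show ?case
      unfolding D_Suc[of "Suc i"] D_Suc[of i] bracket_space_def by (intro span_mono) blast
  qed
  let ?P = "\<lambda>U. \<exists>v\<in>V - G. \<forall>x\<in>U. \<exists>c. act x v - sV c v \<in> G"
  \<comment> \<open>The index descends; once n - i is 0, truncated subtraction makes the induction
    step trivial.\<close>
  have "?P (D (n - i))" for i
  proof (induction i)
    case 0
    obtain v where "v \<in> V - G"
      using assms G(2) by blast
    moreover have "act 0 v = 0" if "v \<in> V" for v
      using act_scale_left[OF that, of 0 0] by simp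
    ultimately show ?case
      using n V.subspace_0[OF G(1)] by (intro bexI[of _ v]) (auto intro!: exI[of _ 0])
  next
    case (Suc i)
    show ?case
    proof (cases "n - i")
      case 0
      then show ?thesis using Suc by simp
    next
      case (Suc j)
      have "fd_subspace scale (D j)"
        using L.subspace_of_fd[OF fin_dim_L D_sub] by simp
      then obtain B where B: "finite B" "D j = span B"
        by (auto simp: fd_subspace_def)
      have "?P (span (D (Suc j) \<union> B'))" if "finite B'" "B' \<subseteq> B" for B'
        using that
      proof (induction B' rule: finite_induct)
        case empty
        then show ?case
          using Suc.IH Suc D_sub by (simp add: span_eq_iff[THEN iffD2])
      next
        case (insert z B')
        let ?U = "span (D (Suc j) \<union> B')"
        have zD: "z \<in> D j"
          using insert.prems B span_base by blast
        have U: "?U \<subseteq> D j"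
          by (rule span_minimal[OF _ D_sub]) (use insert.prems B span_base D_dec in blast)
        have brU: "br u z \<in> ?U" if "u \<in> ?U" for u
        proof -
          have "br u z \<in> D (Suc j)"
            unfolding D_Suc bracket_space_def by (rule span_base) (use that U zD in blast)
          then show ?thesis
            by (intro span_base) blast
        qed
        obtain v where v: "v \<in> V" "v \<notin> G" "\<And>u. u \<in> ?U \<Longrightarrow> \<exists>c. act u v - sV c v \<in> G"
          using insert by blast
        have "?P (span (insert z ?U))"
          by (rule lie_theorem_step[OF subspace_span brU v])
        moreover have "span (D (Suc j) \<union> insert z B') \<subseteq> span (insert z ?U)"
          by (intro span_minimal subspace_span) (auto intro: span_base)
        ultimately show ?case by blast
      qed
      from this[OF B(1) subset_refl] have "?P (span (D (Suc j) \<union> B))" .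
      moreover have "D j \<subseteq> span (D (Suc j) \<union> B)"
        unfolding B(2) by (intro span_mono) blast
      moreover have "n - Suc i = j"
        using Suc by simp
      ultimately show ?thesis by auto
    qed
  qed
  from this[of n] show ?thesis
    by (simp add: D_def)
qed

end

end

section \<open>Semisimple parts, commuting operators and invariant subspaces\<close>

context alg_closed_linear_space
begin

context
  fixes T
  assumes fd: "fd_subspace scale UNIV" and T: "lin_on scale scale UNIV T"
begin

text \<open>An operator commuting with T maps each generalized eigenspace of T to itself, and the
  semisimple part is a scalar there.\<close>

lemma commute_semisimple_part:
  assumes F: "lin_on scale scale UNIV F" and comm: "\<And>v. F (T v) = T (F v)"
  shows "F (semisimple_part scale T v) = semisimple_part scale T (F v)"
proof -
  let ?S = "semisimple_part scale T"
  have S: "lin_on scale scale UNIV ?S"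
    by (rule lin_on_semisimple_part[OF fd T])
  have "F \<circ> ?S = ?S \<circ> F"
  proof (rule lin_on_ext[OF lin_on_comp[OF F S] lin_on_comp[OF S F] _ span_gen_eigenspaces[OF fd T]])
    fix v assume "v \<in> (\<Union>c. gen_eigenspace T c)"
    then obtain c n where v: "v \<in> gen_eigenspace T c" "(shift T c ^^ n) v = 0"
      by (auto simp: gen_eigenspace_def)
    have "F (shift T c w) = shift T c (F w)" for w
      using comm[of w] lin_on_self_diff[OF F subspace_UNIV] lin_onD_scale[OF F]
      by (simp add: shift_def[of T c w] shift_def[of T c "F w"])
    then have "(shift T c ^^ k) (F v) = F ((shift T c ^^ k) v)" for k
      by (induction k) simp_all
    then have "F v \<in> gen_eigenspace T c"
      using v(2) lin_on_self_zero[OF F subspace_UNIV] by (auto simp: gen_eigenspace_def intro!: exI[of _ n])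
    then show "(F \<circ> ?S) v = (?S \<circ> F) v"
      using v(1) lin_onD_scale[OF F] by (simp add: semisimple_part_gen_eigenspace[OF fd T])
  qed
  then show ?thesis
    by (metis comp_apply)
qed

context
  fixes G
  assumes G: "subspace G" "T ` G \<subseteq> G"
begin

text \<open>T is the scalar c modulo G on \<open>span (insert v G)\<close>. A generalized
  eigenvector w in this space for some d other than c must lie in G, since (T - d)^n w is congruent
  to (c - d)^n w. So the semisimple part also induces c modulo G, and the nilpotent part lowers this
  step of a flag.\<close>

lemma nilpotent_part_triangular:
  assumes v: "T v - scale c v \<in> G" and w: "w \<in> span (insert v G)"
  shows "T w - semisimple_part scale T w \<in> G"
proof -
  let ?S = "semisimple_part scale T" and ?G = "span (insert v G)"
  have S: "lin_on scale scale UNIV ?S"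
    by (rule lin_on_semisimple_part[OF fd T])
  have mod: "T w - scale c w \<in> G" if w: "w \<in> ?G" for w
  proof -
    obtain a where a: "w - scale a v \<in> G"
      using w G(1) by (auto simp: span_insert span_eq_iff[THEN iffD2])
    have "T (w - scale a v) \<in> G"
      using a G(2) by blast
    then have "T (w - scale a v) - scale c (w - scale a v) + scale a (T v - scale c v) \<in> G"
      by (rule subspace_add[OF G(1) subspace_diff[OF G(1) _ subspace_scale[OF G(1) a]] subspace_scale[OF G(1) v]])
    moreover have "T (w - scale a v) - scale c (w - scale a v) + scale a (T v - scale c v) = T w - scale c w"
      using lin_on_self_diff[OF T subspace_UNIV] lin_onD_scale[OF T]
      by (simp add: scale_right_diff_distrib mult.commute)
    ultimately show ?thesis by simp
  qed
  have G_sub: "G \<subseteq> ?G"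
    by (auto intro: span_base)
  have TG: "T ` ?G \<subseteq> ?G"
  proof clarify
    fix w assume w: "w \<in> ?G"
    have "T w - scale c w + scale c w \<in> ?G"
      using mod[OF w] G_sub w by (intro span_add span_scale) auto
    then show "T w \<in> ?G" by simp
  qed
  have "T w - scale d w \<in> G" if w: "w \<in> ?G" "w \<in> gen_eigenspace T d" for w d
  proof (cases "w \<in> G \<or> c = d")
    case True
    then show ?thesis
      using mod[OF w(1)] G by (auto intro!: subspace_diff subspace_scale)
  next
    case False
    obtain n where n: "(shift T d ^^ n) w = 0"
      using w(2) by (auto simp: gen_eigenspace_def)
    have "(shift T d ^^ k) w - scale ((c - d) ^ k) w \<in> G" for k
    proof (induction k)
      case 0
      then show ?case using subspace_0[OF G(1)] by simp
    next
      case (Suc k)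
      let ?u = "(shift T d ^^ k) w - scale ((c - d) ^ k) w"
      have "T ?u \<in> G"
        using Suc G(2) by blast
      then have "T ?u - scale d ?u + scale ((c - d) ^ k) (T w - scale c w) \<in> G"
        by (rule subspace_add[OF G(1) subspace_diff[OF G(1) _ subspace_scale[OF G(1) Suc]]
              subspace_scale[OF G(1) mod[OF w(1)]]])
      moreover have "T ?u - scale d ?u + scale ((c - d) ^ k) (T w - scale c w)
          = (shift T d ^^ Suc k) w - scale ((c - d) ^ Suc k) w"
      proof -
        have "scale ((c - d) ^ Suc k) w = scale ((c - d) ^ k * c) w - scale ((c - d) ^ k * d) w"
          by (simp add: left_diff_distrib mult.commute flip: scale_left_diff_distrib)
        moreover have "(shift T d ^^ Suc k) w = T ((shift T d ^^ k) w) - scale d ((shift T d ^^ k) w)"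
          by (simp add: shift_def[of T d "(shift T d ^^ k) w"])
        ultimately show ?thesis
          by (simp add: lin_on_self_diff[OF T subspace_UNIV] lin_onD_scale[OF T] scale_right_diff_distrib
              mult.commute del: funpow.simps power_Suc)
      qed
      ultimately show ?case by simp
    qed
    from this[of n] have "- scale ((c - d) ^ n) w \<in> G"
      using n by simp
    then have "scale (- inverse ((c - d) ^ n)) (- scale ((c - d) ^ n) w) \<in> G"
      by (rule subspace_scale[OF G(1)])
    then show ?thesis
      using False by simp
  qed
  then have "(\<Union>d. gen_eigenspace T d \<inter> ?G) \<subseteq> {w. T w - ?S w \<in> G}"
    using semisimple_part_gen_eigenspace[OF fd T] by auto
  moreover have "subspace {w. T w - ?S w \<in> G}"
    by (rule subspace_preimage_UNIV[OF lin_on_diff[OF T S] G(1)])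
  ultimately have "span (\<Union>d. gen_eigenspace T d \<inter> ?G) \<subseteq> {w. T w - ?S w \<in> G}"
    by (intro span_minimal)
  moreover have "w \<in> span (\<Union>d. gen_eigenspace T d \<inter> ?G)"
    using gen_eigenspaces_span[OF T subspace_of_fd[OF fd subspace_span subset_UNIV] TG] w by (rule subsetD)
  ultimately show ?thesis by auto
qed

end

end

end

section \<open>Solvable Lie algebras\<close>

locale solvable_lie_algebra = lie_algebra scale UNIV br
  for scale :: "'k::{field_char_0,alg_closed_field} \<Rightarrow> 's::ab_group_add \<Rightarrow> 's" and br +
  assumes solvable: "solvable_lie scale UNIV br"
begin

sublocale alg_closed_linear_space scale ..

lemma br_add_left: "br (x + y) z = br x z + br y z"
  and br_scale_left: "br (scale c x) z = scale c (br x z)"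
  using br_linear_left[of z] by (simp_all add: lin_on_def)

lemma br_add_right: "br z (x + y) = br z x + br z y"
  and br_scale_right: "br z (scale c x) = scale c (br z x)"
  using br_linear_right[of z] by (simp_all add: lin_on_def)

lemma br_anti: "br x y = - br y x"
proof -
  have "br (x + y) (x + y) = 0" "br x x = 0" "br y y = 0"
    using br_alternating by simp_all
  then show ?thesis
    by (simp add: br_add_left br_add_right eq_neg_iff_add_eq_0 add.commute)
qed

lemma lin_on_br: "lin_on scale scale UNIV (br x)"
  using br_linear_right by simp

lemma br_zero_left [simp]: "br 0 x = 0"
  using br_scale_left[of 0 0 x] by simp

lemma br_zero_right [simp]: "br x 0 = 0"
  using br_scale_right[of x 0 0] by simp

lemma br_minus_left: "br (- x) y = - br x y"
  using br_scale_left[of "-1" x y] by simp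

lemma br_minus_right: "br x (- y) = - br x y"
  using br_scale_right[of x "-1" y] by simp

lemma br_diff_left: "br (x - y) z = br x z - br y z"
  using br_add_left[of x "- y" z] by (simp add: br_minus_left)

lemma br_diff_right: "br z (x - y) = br z x - br z y"
  using br_add_right[of z x "- y"] by (simp add: br_minus_right)

lemma br_leibniz: "br x (br y z) = br (br x y) z + br y (br x z)"
proof -
  have "br z (br x y) = - br (br x y) z"
    by (rule br_anti)
  moreover have "br y (br z x) = - br y (br x z)"
    by (simp add: br_anti[of z x] br_minus_right)
  ultimately have "br x (br y z) - br y (br x z) - br (br x y) z = 0"
    using jacobi[of x y z] by simp
  then show ?thesis
    by (simp add: algebra_simps)
qed

sublocale adj: solvable_module scale br scale UNIV br
proof
  show "lin_on scale scale UNIV (\<lambda>x. br x v)" for v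
    using br_linear_left by simp
  show "br (br x y) v = br x (br y v) - br y (br x v)" for x y v
    using br_leibniz[of x y v] by (simp add: algebra_simps)
qed (use fin_dim_L br_linear_right solvable in auto)

definition ideal :: "'s set \<Rightarrow> bool" where
  "ideal G \<longleftrightarrow> subspace G \<and> (\<forall>x. \<forall>g\<in>G. br x g \<in> G)"

lemma ideal_insert:
  assumes G: "ideal G" and v: "\<And>x. \<exists>c. br x v - scale c v \<in> G"
  shows "ideal (span (insert v G))"
  unfolding ideal_def
proof (intro conjI allI ballI subspace_span)
  fix x w assume w: "w \<in> span (insert v G)"
  obtain c where c: "br x v - scale c v \<in> G"
    using v by blast
  obtain a where a: "w - scale a v \<in> G"
    using w G by (auto simp: ideal_def span_insert span_eq_iff[THEN iffD2])
  have "br x (w - scale a v) + scale a (br x v - scale c v) + scale (a * c) v \<in> span (insert v G)"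
    using a c G by (intro span_add span_scale) (auto simp: ideal_def intro: span_base)
  moreover have "br x (w - scale a v) + scale a (br x v - scale c v) + scale (a * c) v = br x w"
    by (simp add: br_diff_right br_scale_right scale_right_diff_distrib)
  ultimately show "br x w \<in> span (insert v G)" by simp
qed

text \<open>The induction goes up a full flag of ideals, which exists by Lie's theorem for the adjoint
  module.\<close>

lemma ideal_flag_induct:
  assumes zero: "Q {0}"
    and step: "\<And>G v. ideal G \<Longrightarrow> Q G \<Longrightarrow> (\<And>x. \<exists>c. br x v - scale c v \<in> G) \<Longrightarrow> Q (span (insert v G))"
  shows "Q UNIV"
proof -
  let ?P = "\<lambda>C. finite C \<and> independent C \<and> ideal (span C) \<and> Q (span C)"
  obtain B where B: "finite B" "UNIV = span B"
    using fin_dim_L by (auto simp: fd_subspace_def)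
  have "ideal {0}"
    by (simp add: ideal_def subspace_def)
  then have P0: "?P {}"
    using zero by (simp add: independent_empty)
  have bound: "\<forall>C. ?P C \<longrightarrow> card C < Suc (card B)"
    using independent_span_bound[OF B(1)] B(2) by (auto simp: less_Suc_eq_le)
  \<comment> \<open>The flag is not built as a sequence: a largest independent C whose span is an
    ideal satisfying Q must already span everything.\<close>
  from ex_has_greatest_nat[of ?P "{}" card "Suc (card B)", OF P0 bound]
  obtain C where C': "?P C \<and> (\<forall>C'. ?P C' \<longrightarrow> card C' \<le> card C)"
    by (rule exE)
  note C = conjunct1[OF C'] conjunct2[OF C']
  have "span C = UNIV"
  proof (rule ccontr)
    assume "span C \<noteq> UNIV"
    moreover have "\<And>x v. v \<in> span C \<Longrightarrow> br x v \<in> span C"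
      using C(1) by (simp add: ideal_def)
    ultimately obtain v where v: "v \<notin> span C" "\<And>x. \<exists>c. br x v - scale c v \<in> span C"
      using adj.lie_theorem_modulo[of "span C"] by auto
    have *: "span (insert v (span C)) = span (insert v C)"
      by (simp add: span_insert span_span)
    have "ideal (span (insert v (span C)))"
      using C(1) v(2) by (intro ideal_insert) auto
    moreover have "Q (span (insert v (span C)))"
      using C(1) v(2) by (intro step) auto
    moreover have "independent (insert v C)"
      using C(1) v(1) by (simp add: independent_insertI)
    ultimately have "?P (insert v C)"
      using C(1) * by simp
    from mp[OF spec[OF C(2)] this] have "card (insert v C) \<le> card C" .
    then have "v \<in> C"
      using C(1) by (cases "v \<in> C") simp_all
    then show False
      using v(1) span_base[of v C] by simp
  qed
  then show ?thesis
    using C(1) by simp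
qed

section \<open>The derived algebra and operators that lower a flag\<close>

definition derived :: "'s set" where
  "derived = bracket_space scale br UNIV UNIV"

lemma subspace_derived: "subspace derived"
  by (simp add: derived_def bracket_space_def)

lemma br_in_derived: "br x y \<in> derived"
  unfolding derived_def bracket_space_def by (rule span_base) blast

lemma bracket_space_mono:
  assumes "U \<subseteq> U'" "W \<subseteq> W'"
  shows "bracket_space scale br U W \<subseteq> bracket_space scale br U' W'"
  unfolding bracket_space_def by (rule span_mono) (use assms in blast)

lemma bracket_space_funpow_mono:
  assumes "W \<subseteq> W'"
  shows "(bracket_space scale br U ^^ n) W \<subseteq> (bracket_space scale br U ^^ n) W'"
  by (induction n) (use assms bracket_space_mono[OF subset_refl] in auto)

text \<open>The algebra acts by scalars on the at most one-dimensional quotient of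
  \<open>span (insert v G)\<close> by G, so commutators act by 0 there.\<close>

lemma derived_lowers_flag:
  assumes G: "ideal G" and v: "\<And>x. \<exists>c. br x v - scale c v \<in> G"
    and k: "k \<in> derived" and w: "w \<in> span (insert v G)"
  shows "br k w \<in> G"
proof -
  have sub: "subspace G" and idl: "\<And>x g. g \<in> G \<Longrightarrow> br x g \<in> G"
    using G by (auto simp: ideal_def)
  have "br (br x y) w \<in> G" for x y
  proof -
    obtain c where c: "br x v - scale c v \<in> G" using v by blast
    obtain d where d: "br y v - scale d v \<in> G" using v by blast
    obtain a where a: "w - scale a v \<in> G"
      using w sub by (auto simp: span_insert span_eq_iff[THEN iffD2])
    have "br x (br y v - scale d v) + scale d (br x v - scale c v)
        - (br y (br x v - scale c v) + scale c (br y v - scale d v)) \<in> G"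
      by (rule subspace_diff[OF sub subspace_add[OF sub idl[OF d] subspace_scale[OF sub c]]
            subspace_add[OF sub idl[OF c] subspace_scale[OF sub d]]])
    moreover have "br x (br y v - scale d v) + scale d (br x v - scale c v)
        - (br y (br x v - scale c v) + scale c (br y v - scale d v)) = br (br x y) v"
      using br_leibniz[of x y v]
      by (simp add: br_diff_right br_scale_right scale_right_diff_distrib mult.commute)
    ultimately have "br (br x y) v \<in> G" by simp
    then have "br (br x y) (w - scale a v) + scale a (br (br x y) v) \<in> G"
      by (rule subspace_add[OF sub idl[OF a] subspace_scale[OF sub]])
    then show ?thesis
      by (simp add: br_diff_right br_scale_right)
  qed
  moreover have "subspace {k. br k w \<in> G}"
    using sub by (auto simp: subspace_def br_add_left br_scale_left)
  ultimately have "derived \<subseteq> {k. br k w \<in> G}"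
    unfolding derived_def bracket_space_def by (intro span_minimal) auto
  then show ?thesis using k by blast
qed

text \<open>Each bracket with the derived algebra moves down one step of the flag. The purpose is to
  place the derived algebra inside the nilradical.\<close>

lemma derived_nilpotent: "nilpotent_lie scale derived br"
proof -
  let ?b = "bracket_space scale br derived"
  have "\<exists>n. (?b ^^ n) UNIV \<subseteq> {0}"
  proof (rule ideal_flag_induct)
    show "\<exists>n. (?b ^^ n) {0} \<subseteq> {0}"
      by (rule exI[of _ 0]) simp
    fix G v assume G: "ideal G" and "\<exists>n. (?b ^^ n) G \<subseteq> {0}" and v: "\<And>x. \<exists>c. br x v - scale c v \<in> G"
    then obtain n where n: "(?b ^^ n) G \<subseteq> {0}" by blast
    have "?b (span (insert v G)) \<subseteq> G"
      unfolding bracket_space_def using derived_lowers_flag[OF G v] G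
      by (intro span_minimal) (auto simp: ideal_def)
    then have "(?b ^^ n) (?b (span (insert v G))) \<subseteq> {0}"
      using bracket_space_funpow_mono[where U = derived and n = n and W = "?b (span (insert v G))" and W' = G] n by blast
    then have "(?b ^^ Suc n) (span (insert v G)) \<subseteq> {0}"
      by (simp add: funpow_swap1)
    then show "\<exists>n. (?b ^^ n) (span (insert v G)) \<subseteq> {0}" by blast
  qed
  then obtain n where n: "(?b ^^ n) UNIV \<subseteq> {0}" by blast
  then have "(?b ^^ n) derived \<subseteq> {0}"
    using bracket_space_funpow_mono[where U = derived and n = n and W = derived and W' = UNIV] by auto
  moreover have "subspace ((?b ^^ n) derived)"
    by (cases n) (simp_all add: subspace_derived bracket_space_def)
  then have "0 \<in> (?b ^^ n) derived"
    by (rule subspace_0)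
  ultimately show ?thesis
    unfolding nilpotent_lie_def by blast
qed

lemma nilpotent_lie_ad:
  assumes "nilpotent_lie scale U br" "x \<in> U" "y \<in> U"
  shows "\<exists>n. (br x ^^ n) y = 0"
proof -
  obtain n where n: "(bracket_space scale br U ^^ n) U = {0}"
    using assms(1) by (auto simp: nilpotent_lie_def)
  have "(br x ^^ k) y \<in> (bracket_space scale br U ^^ k) U" for k
  proof (induction k)
    case (Suc k)
    then show ?case
      using assms(2) by (auto simp: bracket_space_def intro!: span_base)
  qed (use assms in simp)
  then show ?thesis
    using n by blast
qed

text \<open>The lowering condition is imposed on every possible step of a flag because
  \<open>ideal_flag_induct\<close> does not reveal which flag it climbs.\<close>

lemma flag_nilpotent:
  assumes F: "lin_on scale scale UNIV F"
    and low: "\<And>G v w. ideal G \<Longrightarrow> (\<And>x. \<exists>c. br x v - scale c v \<in> G) \<Longrightarrow> w \<in> span (insert v G) \<Longrightarrow> F w \<in> G"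
  shows "\<exists>n. (F ^^ n) w = 0"
proof -
  have "\<forall>w\<in>UNIV. \<exists>n. (F ^^ n) w = 0"
  proof (rule ideal_flag_induct)
    show "\<forall>w\<in>{0}. \<exists>n. (F ^^ n) w = 0"
      by (auto intro: exI[of _ 0])
    fix G v assume G: "ideal G" and IH: "\<forall>w\<in>G. \<exists>n. (F ^^ n) w = 0"
      and v: "\<And>x. \<exists>c. br x v - scale c v \<in> G"
    show "\<forall>w\<in>span (insert v G). \<exists>n. (F ^^ n) w = 0"
    proof
      fix w assume "w \<in> span (insert v G)"
      then have "F w \<in> G" by (rule low[OF G v])
      then obtain n where "(F ^^ n) (F w) = 0" using IH by blast
      then have "(F ^^ Suc n) w = 0" by (simp add: funpow_swap1)
      then show "\<exists>n. (F ^^ n) w = 0" by blast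
    qed
  qed
  then show ?thesis by blast
qed

subsection \<open>Semisimple parts of inner derivations\<close>

abbreviation ss :: "'s \<Rightarrow> 's \<Rightarrow> 's" where
  "ss x \<equiv> semisimple_part scale (br x)"

lemmas ss_lin = lin_on_semisimple_part[OF fin_dim_L lin_on_br]
  and ss_eig = semisimple_part_gen_eigenspace[OF fin_dim_L lin_on_br]
  and span_gen_br = span_gen_eigenspaces[OF fin_dim_L lin_on_br]

text \<open>The operator ad x - (c + d) obeys a Leibniz rule on [u, v] with ad x - c on u and ad x -
  d on v. Induction on n + m, where each application lowers n or m by one, replaces the binomial
  formula.\<close>

lemma gen_eigenspace_br:
  assumes "u \<in> gen_eigenspace (br x) c" "v \<in> gen_eigenspace (br x) d"
  shows "br u v \<in> gen_eigenspace (br x) (c + d)"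
proof -
  let ?t = "shift (br x)"
  have "(?t (c + d) ^^ (n + m)) (br u v) = 0" if "(?t c ^^ n) u = 0" "(?t d ^^ m) v = 0" for n m
    using that
  proof (induction "n + m" arbitrary: n m u v)
    case 0
    then show ?case by simp
  next
    case (Suc N)
    have zero: "(?t (c + d) ^^ k) 0 = 0" for k
      using lin_on_self_zero[OF lin_on_funpow[OF lin_on_shift[OF lin_on_br]] subspace_UNIV] .
    show ?case
    proof (cases "n = 0 \<or> m = 0")
      case True
      then have "br u v = 0"
        using Suc.prems by auto
      then show ?thesis using zero by simp
    next
      case False
      then obtain n' m' where nm: "n = Suc n'" "m = Suc m'"
        using not0_implies_Suc by blast
      have "?t (c + d) (br u v) = br (?t c u) v + br u (?t d v)"
        unfolding shift_def
        by (simp add: br_leibniz[of x u v] br_diff_left br_diff_right br_scale_left br_scale_right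
            scale_left_distrib)
      then have "(?t (c + d) ^^ Suc N) (br u v)
          = (?t (c + d) ^^ N) (br (?t c u) v) + (?t (c + d) ^^ N) (br u (?t d v))"
        using lin_onD_add[OF lin_on_funpow[OF lin_on_shift[OF lin_on_br]]]
        by (simp del: funpow.simps add: funpow_Suc_right)
      moreover have N: "N = n' + m" "N = n + m'" "n + m = Suc N"
        using Suc.hyps(2) nm by simp_all
      moreover have "(?t (c + d) ^^ N) (br (?t c u) v) = 0"
        unfolding N(1) by (rule Suc.hyps(1)[OF N(1)]) (use Suc.prems nm in \<open>simp_all add: funpow_swap1\<close>)
      moreover have "(?t (c + d) ^^ N) (br u (?t d v)) = 0"
        unfolding N(2) by (rule Suc.hyps(1)[OF N(2)]) (use Suc.prems nm in \<open>simp_all add: funpow_swap1\<close>)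
      ultimately show ?thesis
        unfolding N(3) by (simp only: add_0_right)
    qed
  qed
  then show ?thesis
    using assms by (auto simp: gen_eigenspace_def)
qed

lemma ss_derivation: "ss x (br u v) = br (ss x u) v + br u (ss x v)"
proof -
  have 1: "ss x (br u v) = br (ss x u) v + br u (ss x v)" if u: "u \<in> gen_eigenspace (br x) c" for u c v
  proof -
    have "(\<lambda>v. ss x (br u v)) = (\<lambda>v. br (ss x u) v + br u (ss x v))"
    proof (rule lin_on_ext[OF _ _ _ span_gen_br[of x]])
      show "lin_on scale scale UNIV (\<lambda>v. ss x (br u v))"
        using lin_on_comp[OF ss_lin lin_on_br] by (simp add: comp_def)
      show "lin_on scale scale UNIV (\<lambda>v. br (ss x u) v + br u (ss x v))"
        by (simp add: lin_on_def br_add_right br_scale_right scale_right_distrib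
            lin_onD_add[OF ss_lin] lin_onD_scale[OF ss_lin])
      fix v assume "v \<in> (\<Union>c. gen_eigenspace (br x) c)"
      then obtain d where v: "v \<in> gen_eigenspace (br x) d" by blast
      show "ss x (br u v) = br (ss x u) v + br u (ss x v)"
        using ss_eig[OF gen_eigenspace_br[OF u v]] ss_eig[OF u] ss_eig[OF v]
        by (simp add: br_scale_left br_scale_right scale_left_distrib)
    qed
    then show ?thesis by (rule fun_cong)
  qed
  have "(\<lambda>u. ss x (br u v)) = (\<lambda>u. br (ss x u) v + br u (ss x v))"
  proof (rule lin_on_ext[OF _ _ _ span_gen_br[of x]])
    show "lin_on scale scale UNIV (\<lambda>u. ss x (br u v))"
      by (simp add: lin_on_def br_add_left br_scale_left lin_onD_add[OF ss_lin] lin_onD_scale[OF ss_lin])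
    show "lin_on scale scale UNIV (\<lambda>u. br (ss x u) v + br u (ss x v))"
      by (simp add: lin_on_def br_add_left br_scale_left scale_right_distrib
            lin_onD_add[OF ss_lin] lin_onD_scale[OF ss_lin])
  qed (use 1 in blast)
  then show ?thesis by (rule fun_cong)
qed

text \<open>For nonzero c, v is 1/c times the difference of [x, v] and (ad x - c) v, and the second
  vector is killed by a smaller power. For c = 0 the semisimple part vanishes.\<close>

lemma ss_in_derived: "ss x v \<in> derived"
proof -
  have "v \<in> derived" if "(shift (br x) c ^^ n) v = 0" "c \<noteq> 0" for n c v
    using that(1)
  proof (induction n arbitrary: v)
    case 0
    then show ?case using subspace_0[OF subspace_derived] by simp
  next
    case (Suc n)
    have "scale (inverse c) (br x v - shift (br x) c v) \<in> derived"
      by (rule subspace_scale[OF subspace_derived subspace_diff[OF subspace_derived br_in_derived Suc.IH]])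
         (use Suc.prems in \<open>simp add: funpow_swap1\<close>)
    then show ?case
      using that(2) by (simp add: shift_def[of "br x" c v])
  qed
  then have "ss x v \<in> derived" if "v \<in> gen_eigenspace (br x) c" for c v
    using that ss_eig[OF that] subspace_scale[OF subspace_derived] subspace_0[OF subspace_derived]
    by (cases "c = 0") (auto simp: gen_eigenspace_def)
  then have "(\<Union>c. gen_eigenspace (br x) c) \<subseteq> {v. ss x v \<in> derived}"
    by blast
  moreover have "subspace {v. ss x v \<in> derived}"
    by (rule subspace_preimage_UNIV[OF ss_lin subspace_derived])
  ultimately have "span (\<Union>c. gen_eigenspace (br x) c) \<subseteq> {v. ss x v \<in> derived}"
    by (intro span_minimal)
  then show ?thesis
    using span_gen_br by blast
qed

lemma ss_eq_zero: "(br x ^^ n) v = 0 \<Longrightarrow> ss x v = 0"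
  using ss_eig[of v x 0] by (auto simp: gen_eigenspace_def shift_def[abs_def])

lemma ss_br_commute:
  assumes "ss x y = 0"
  shows "ss x (br y v) = br y (ss x v)"
  using assms by (simp add: ss_derivation)

text \<open>The derivation \<open>ss x\<close> kills y, hence commutes with ad y and therefore with
  its semisimple part.\<close>

lemma ss_ss_commute:
  assumes "ss x y = 0"
  shows "ss x (ss y v) = ss y (ss x v)"
  using commute_semisimple_part[OF fin_dim_L lin_on_br ss_lin ss_br_commute[OF assms]] .

text \<open>Neither x and y nor the nilpotent parts of ad x and ad y need commute; the sum of these
  parts is nilpotent because both lower every step of a flag of ideals. The two assumptions make the
  semisimple parts commute with each other and with both ad x and ad y.\<close>

lemma ss_add:
  assumes "ss x y = 0" "ss y x = 0"
  shows "ss (x + y) = (\<lambda>v. ss x v + ss y v)"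
proof (rule semisimple_part_eqI[OF fin_dim_L lin_on_br])
  let ?S = "\<lambda>v. ss x v + ss y v"
  show lin: "lin_on scale scale UNIV ?S"
    by (simp add: lin_on_def lin_onD_add[OF ss_lin] lin_onD_scale[OF ss_lin] scale_right_distrib)
  have sp: "span {v. \<forall>i\<in>{x, y}. \<exists>c. ss i v = scale c v} = UNIV"
  proof (rule span_simultaneous_eigenvectors[OF _ ss_lin])
    show "span {v. \<exists>c. ss i v = scale c v} = UNIV" for i
      by (rule span_eigenvectors_semisimple_part[OF fin_dim_L lin_on_br])
    show "ss i (ss j v) = ss j (ss i v)" if "i \<in> {x, y}" "j \<in> {x, y}" for i j v
      using that ss_ss_commute[OF assms(1), of v] by auto
  qed simp
  have inc: "{v. \<forall>i\<in>{x, y}. \<exists>c. ss i v = scale c v} \<subseteq> {v. \<exists>c. ?S v = scale c v}"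
  proof clarify
    fix v assume "\<forall>i\<in>{x, y}. \<exists>c. ss i v = scale c v"
    then obtain c d where "ss x v = scale c v" "ss y v = scale d v" by auto
    then show "\<exists>c. ?S v = scale c v"
      by (intro exI[of _ "c + d"]) (simp add: scale_left_distrib)
  qed
  have "UNIV \<subseteq> span {v. \<exists>c. ?S v = scale c v}"
    by (rule subset_trans[OF eq_refl[OF sp[symmetric]] span_mono[OF inc]])
  then show "span {v. \<exists>c. ?S v = scale c v} = UNIV"
    by (rule antisym[OF subset_UNIV])
  have "ss x (br x v) = br x (ss x v)" "ss y (br y v) = br y (ss y v)" for v
    by (rule semisimple_part_commute[OF fin_dim_L lin_on_br])+
  then show "?S (br (x + y) v) = br (x + y) (?S v)" for v
    using ss_br_commute[OF assms(1)] ss_br_commute[OF assms(2)]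
    by (simp add: br_add_left br_add_right lin_onD_add[OF ss_lin] algebra_simps)
  show "\<exists>n. ((\<lambda>v. br (x + y) v - ?S v) ^^ n) v = 0" for v
  proof (rule flag_nilpotent)
    show "lin_on scale scale UNIV (\<lambda>v. br (x + y) v - ?S v)"
      by (simp add: lin_on_def br_add_right br_scale_right lin_onD_add[OF lin] lin_onD_scale[OF lin]
          scale_right_diff_distrib lin_onD_add[OF ss_lin] lin_onD_scale[OF ss_lin] scale_right_distrib)
    fix G v w assume G: "ideal G" and v: "\<And>x. \<exists>c. br x v - scale c v \<in> G" and w: "w \<in> span (insert v G)"
    have *: "br z w - ss z w \<in> G" for z
    proof -
      obtain c where "br z v - scale c v \<in> G" using v by blast
      then show ?thesis
        using G w by (intro nilpotent_part_triangular[OF fin_dim_L lin_on_br]) (auto simp: ideal_def)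
    qed
    have "(br x w - ss x w) + (br y w - ss y w) \<in> G"
      using * G by (intro subspace_add) (auto simp: ideal_def)
    then show "br (x + y) w - ?S w \<in> G"
      by (simp add: br_add_left add_diff_add)
  qed
qed

lemma ss_scale: "ss (scale a x) = (\<lambda>v. scale a (ss x v))"
proof (rule lin_on_ext[OF ss_lin _ _ span_gen_br[of x]])
  show "lin_on scale scale UNIV (\<lambda>v. scale a (ss x v))"
    by (simp add: lin_on_def lin_onD_add[OF ss_lin] lin_onD_scale[OF ss_lin] scale_right_distrib mult.commute)
  fix v assume "v \<in> (\<Union>c. gen_eigenspace (br x) c)"
  then obtain c n where v: "v \<in> gen_eigenspace (br x) c" "(shift (br x) c ^^ n) v = 0"
    by (auto simp: gen_eigenspace_def)
  have "shift (br (scale a x)) (a * c) w = scale a (shift (br x) c w)" for w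
    by (simp add: shift_def br_scale_left scale_right_diff_distrib)
  then have "(shift (br (scale a x)) (a * c) ^^ k) v = scale (a ^ k) ((shift (br x) c ^^ k) v)" for k
    by (induction k) (simp_all add: lin_onD_scale[OF lin_on_shift[OF lin_on_br]] mult.commute)
  then have "v \<in> gen_eigenspace (br (scale a x)) (a * c)"
    using v(2) by (auto simp: gen_eigenspace_def intro!: exI[of _ n])
  then show "ss (scale a x) v = scale a (ss x v)"
    using ss_eig[OF v(1)] ss_eig by simp
qed

end

section \<open>The nilshadow\<close>

text \<open>Gives \<open>A \<times> N\<close> its Lie algebra structures by pulling back along the
  sum map, in place of a proof of the Jacobi identity from the extension data.\<close>

lemma lie_algebra_transport:
  assumes M: "lie_algebra t M br'" and s: "vector_space s" and fd: "fd_subspace s L"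
    and lin: "lin_on s t L f" and bij: "bij_betw f L M"
    and closed: "\<And>x y. x \<in> L \<Longrightarrow> y \<in> L \<Longrightarrow> br x y \<in> L"
    and hom: "\<And>x y. x \<in> L \<Longrightarrow> y \<in> L \<Longrightarrow> f (br x y) = br' (f x) (f y)"
  shows "lie_algebra s L br"
proof -
  interpret M: lie_algebra t M br' by fact
  interpret s: linear_space s
    using s by (simp add: linear_space_def)
  have L: "s.subspace L"
    by (rule s.fd_subspace_subspace[OF fd])
  have fM: "f x \<in> M" if "x \<in> L" for x
    using bij that by (auto simp: bij_betw_def)
  have eqI: "x = y" if "f x = f y" "x \<in> L" "y \<in> L" for x y
    using bij that by (auto simp: bij_betw_def inj_on_def)
  note add = lin_onD_add[OF lin] and sc = lin_onD_scale[OF lin]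
  have f0: "f 0 = 0"
    using s.lin_onD_zero[OF lin _ L] M.vector_space_axioms by blast
  show ?thesis
  proof
    show "fd_subspace s L" by (rule fd)
    show "br x y \<in> L" if "x \<in> L" "y \<in> L" for x y by (rule closed[OF that])
    show "lin_on s s L (\<lambda>x. br x y)" if y: "y \<in> L" for y
      unfolding lin_on_def
    proof (intro conjI ballI allI)
      fix x z assume xz: "x \<in> L" "z \<in> L"
      show "br (x + z) y = br x y + br z y"
        by (rule eqI) (use xz y lin_onD_add[OF M.br_linear_left] in
            \<open>simp_all add: hom add closed s.subspace_add[OF L] fM\<close>)
    next
      fix c x assume x: "x \<in> L"
      show "br (s c x) y = s c (br x y)"
        by (rule eqI) (use x y lin_onD_scale[OF M.br_linear_left] in
            \<open>simp_all add: hom sc closed s.subspace_scale[OF L] fM\<close>)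
    qed
    show "lin_on s s L (br x)" if x: "x \<in> L" for x
      unfolding lin_on_def
    proof (intro conjI ballI allI)
      fix y z assume yz: "y \<in> L" "z \<in> L"
      show "br x (y + z) = br x y + br x z"
        by (rule eqI) (use yz x lin_onD_add[OF M.br_linear_right] in
            \<open>simp_all add: hom add closed s.subspace_add[OF L] fM\<close>)
    next
      fix c y assume y: "y \<in> L"
      show "br x (s c y) = s c (br x y)"
        by (rule eqI) (use x y lin_onD_scale[OF M.br_linear_right] in
            \<open>simp_all add: hom sc closed s.subspace_scale[OF L] fM\<close>)
    qed
    show "br x x = 0" if "x \<in> L" for x
      by (rule eqI) (use that in \<open>simp_all add: hom fM M.br_alternating f0 closed s.subspace_0[OF L]\<close>)
    show "br x (br y z) + br y (br z x) + br z (br x y) = 0" if "x \<in> L" "y \<in> L" "z \<in> L" for x y z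
      by (rule eqI) (use that in \<open>simp_all add: hom fM add M.jacobi f0 closed s.subspace_0[OF L] s.subspace_add[OF L]\<close>)
  qed
qed

lemma vector_space_prod_scale:
  assumes "vector_space s" "vector_space t"
  shows "vector_space (prod_scale s t)"
proof -
  interpret s: vector_space s by fact
  interpret t: vector_space t by fact
  show ?thesis
    by unfold_locales
       (auto simp: prod_scale_def s.scale_right_distrib s.scale_left_distrib t.scale_right_distrib t.scale_left_distrib)
qed

lemma fd_subspace_Times:
  assumes "vector_space s" "vector_space t" and "fd_subspace s A" "fd_subspace t B"
  shows "fd_subspace (prod_scale s t) (A \<times> B)"
proof -
  interpret s: linear_space s using assms(1) by (simp add: linear_space_def)
  interpret t: linear_space t using assms(2) by (simp add: linear_space_def)
  interpret p: linear_space "prod_scale s t"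
    using vector_space_prod_scale[OF assms(1,2)] by (simp add: linear_space_def)
  have A: "s.subspace A" and B: "t.subspace B"
    using assms(3,4) s.fd_subspace_subspace t.fd_subspace_subspace by auto
  obtain C D where C: "finite C" "A = s.span C" and D: "finite D" "B = t.span D"
    using assms(3,4) by (auto simp: fd_subspace_def)
  let ?E = "(\<lambda>x. (x, 0)) ` C \<union> (\<lambda>y. (0, y)) ` D"
  have "p.subspace (A \<times> B)"
    using A B by (auto simp: p.subspace_def s.subspace_def t.subspace_def prod_scale_def zero_prod_def)
  moreover have "?E \<subseteq> A \<times> B"
    using A B C D by (auto simp: s.span_base t.span_base s.subspace_0 t.subspace_0)
  ultimately have 1: "p.span ?E \<subseteq> A \<times> B"
    by (intro p.span_minimal)
  have "s.subspace {x. (x, 0) \<in> p.span ?E}"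
  proof (rule s.subspaceI)
    show "0 \<in> {x. (x, 0) \<in> p.span ?E}"
      using p.span_zero[of ?E] by (simp add: zero_prod_def)
    show "x + y \<in> {x. (x, 0) \<in> p.span ?E}" if "x \<in> {x. (x, 0) \<in> p.span ?E}" "y \<in> {x. (x, 0) \<in> p.span ?E}" for x y
      using that p.span_add[of "(x, 0)" ?E "(y, 0)"] by simp
    show "s c x \<in> {x. (x, 0) \<in> p.span ?E}" if "x \<in> {x. (x, 0) \<in> p.span ?E}" for c x
      using that p.span_scale[of "(x, 0)" ?E c] by (simp add: prod_scale_def)
  qed
  moreover have "C \<subseteq> {x. (x, 0) \<in> p.span ?E}"
    by (auto intro: p.span_base)
  ultimately have 2: "A \<subseteq> {x. (x, 0) \<in> p.span ?E}"
    unfolding C(2) by (intro s.span_minimal)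
  have "t.subspace {y. (0, y) \<in> p.span ?E}"
  proof (rule t.subspaceI)
    show "0 \<in> {y. (0, y) \<in> p.span ?E}"
      using p.span_zero[of ?E] by (simp add: zero_prod_def)
    show "x + y \<in> {y. (0, y) \<in> p.span ?E}" if "x \<in> {y. (0, y) \<in> p.span ?E}" "y \<in> {y. (0, y) \<in> p.span ?E}" for x y
      using that p.span_add[of "(0, x)" ?E "(0, y)"] by simp
    show "t c x \<in> {y. (0, y) \<in> p.span ?E}" if "x \<in> {y. (0, y) \<in> p.span ?E}" for c x
      using that p.span_scale[of "(0, x)" ?E c] by (simp add: prod_scale_def)
  qed
  moreover have "D \<subseteq> {y. (0, y) \<in> p.span ?E}"
    by (auto intro: p.span_base)
  ultimately have 3: "B \<subseteq> {y. (0, y) \<in> p.span ?E}"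
    unfolding D(2) by (intro t.span_minimal)
  have "A \<times> B \<subseteq> p.span ?E"
  proof clarify
    fix x y assume "x \<in> A" "y \<in> B"
    then have "(x, 0) + (0, y) \<in> p.span ?E"
      using 2 3 by (intro p.span_add) auto
    then show "(x, y) \<in> p.span ?E" by simp
  qed
  then have "A \<times> B = p.span ?E"
    using 1 by blast
  moreover have "finite ?E"
    using C(1) D(1) by simp
  ultimately show ?thesis
    unfolding fd_subspace_def by blast
qed

section \<open>The operators \<open>\<sigma> x\<close> and the nilshadow bracket\<close>

locale nilshadow = solvable_lie_algebra scale br
  for scale :: "'k::{field_char_0,alg_closed_field} \<Rightarrow> 's::ab_group_add \<Rightarrow> 's" and br +
  fixes N H A :: "'s set"
  assumes nilradical: "is_nilradical scale UNIV br N"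
    and cartan: "cartan_subalgebra scale UNIV br H"
    and A_H: "A \<subseteq> H"
    and decomposition: "direct_decomposition scale UNIV A N"
begin

lemma subspace_A: "subspace A" and subspace_N: "subspace N" and A_Int_N: "A \<inter> N = {0}"
  using decomposition by (simp_all add: direct_decomposition_def)

lemma derived_subset_N: "derived \<subseteq> N"
proof -
  have "lie_ideal scale UNIV br derived"
    using subspace_derived br_in_derived by (simp add: lie_ideal_def)
  then show ?thesis
    using nilradical derived_nilpotent by (simp add: is_nilradical_def)
qed

lemma br_in_N: "br x y \<in> N"
  using br_in_derived derived_subset_N by blast

definition pr :: "'s \<Rightarrow> 's" where
  "pr = component A N"

lemma pr_unique:
  assumes "u \<in> A" "x - u \<in> N"
  shows "pr x = u"
  unfolding pr_def component_def
proof (rule the_equality)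
  show "u \<in> A \<and> x - u \<in> N" using assms by blast
  fix u' assume u': "u' \<in> A \<and> x - u' \<in> N"
  have "u' - u \<in> A"
    using u' assms(1) subspace_diff[OF subspace_A] by blast
  moreover have "(x - u) - (x - u') \<in> N"
    using u' assms(2) subspace_diff[OF subspace_N] by blast
  ultimately have "u' - u \<in> A \<inter> N" by simp
  then show "u' = u"
    using A_Int_N by simp
qed

lemma pr_in_A: "pr x \<in> A" and diff_pr_in_N: "x - pr x \<in> N"
proof -
  have "x \<in> {u + w |u w. u \<in> A \<and> w \<in> N}"
    using decomposition by (simp add: direct_decomposition_def)
  then obtain u w where "x = u + w" "u \<in> A" "w \<in> N" by blast
  then have "u \<in> A" "x - u \<in> N" by simp_all
  then show "pr x \<in> A" "x - pr x \<in> N"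
    using pr_unique by simp_all
qed

lemma pr_A: "x \<in> A \<Longrightarrow> pr x = x"
  using pr_unique subspace_0[OF subspace_N] by simp

lemma pr_N: "x \<in> N \<Longrightarrow> pr x = 0"
  using pr_unique subspace_0[OF subspace_A] by simp

lemma pr_add: "pr (x + y) = pr x + pr y"
proof (rule pr_unique)
  show "pr x + pr y \<in> A"
    using pr_in_A subspace_add[OF subspace_A] by blast
  have "(x - pr x) + (y - pr y) \<in> N"
    using diff_pr_in_N subspace_add[OF subspace_N] by blast
  then show "x + y - (pr x + pr y) \<in> N"
    by (simp add: add_diff_add)
qed

lemma pr_scale: "pr (scale c x) = scale c (pr x)"
proof (rule pr_unique)
  show "scale c (pr x) \<in> A"
    using pr_in_A subspace_scale[OF subspace_A] by blast
  have "scale c (x - pr x) \<in> N"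
    using diff_pr_in_N subspace_scale[OF subspace_N] by blast
  then show "scale c x - scale c (pr x) \<in> N"
    by (simp add: scale_right_diff_distrib)
qed

definition \<sigma> :: "'s \<Rightarrow> 's \<Rightarrow> 's" where
  "\<sigma> x = ss (pr x)"

lemma ss_H: "x \<in> H \<Longrightarrow> y \<in> H \<Longrightarrow> ss x y = 0"
  using nilpotent_lie_ad[of H x y] cartan ss_eq_zero by (auto simp: cartan_subalgebra_def)

lemma ss_A: "x \<in> A \<Longrightarrow> y \<in> A \<Longrightarrow> ss x y = 0"
  using ss_H A_H by blast

lemma \<sigma>_A: "x \<in> A \<Longrightarrow> \<sigma> x = ss x"
  by (simp add: \<sigma>_def pr_A)

lemma \<sigma>_A_right: "y \<in> A \<Longrightarrow> \<sigma> x y = 0"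
  by (simp add: \<sigma>_def ss_A pr_in_A)

lemma \<sigma>_lin: "lin_on scale scale UNIV (\<sigma> x)"
  unfolding \<sigma>_def by (rule ss_lin)

lemma \<sigma>_add_right: "\<sigma> x (y + z) = \<sigma> x y + \<sigma> x z"
  and \<sigma>_scale_right: "\<sigma> x (scale c y) = scale c (\<sigma> x y)"
  and \<sigma>_zero_right: "\<sigma> x 0 = 0"
  and \<sigma>_diff_right: "\<sigma> x (y - z) = \<sigma> x y - \<sigma> x z"
  using \<sigma>_lin[of x] lin_on_self_zero[OF \<sigma>_lin subspace_UNIV] lin_on_self_diff[OF \<sigma>_lin subspace_UNIV]
  by (simp_all add: lin_on_def)

lemma \<sigma>_add_left: "\<sigma> (x + y) z = \<sigma> x z + \<sigma> y z"
  using ss_add[of "pr x" "pr y"] by (simp add: \<sigma>_def pr_add ss_A pr_in_A)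

lemma \<sigma>_scale_left: "\<sigma> (scale c x) z = scale c (\<sigma> x z)"
  by (simp add: \<sigma>_def pr_scale ss_scale)

lemma \<sigma>_N: "x \<in> N \<Longrightarrow> \<sigma> x y = 0"
  using \<sigma>_scale_left[of 0 0 y] by (simp add: \<sigma>_def pr_N pr_N[OF subspace_0[OF subspace_N]])

lemma \<sigma>_derivation: "\<sigma> x (br u v) = br (\<sigma> x u) v + br u (\<sigma> x v)"
  unfolding \<sigma>_def by (rule ss_derivation)

lemma \<sigma>_commute: "\<sigma> x (\<sigma> y v) = \<sigma> y (\<sigma> x v)"
  unfolding \<sigma>_def by (rule ss_ss_commute) (simp add: ss_A pr_in_A)

lemma \<sigma>_in_N: "\<sigma> x v \<in> N"
  unfolding \<sigma>_def using ss_in_derived derived_subset_N by blast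

lemma \<sigma>_br_A: "y \<in> A \<Longrightarrow> \<sigma> x (br y v) = br y (\<sigma> x v)"
  by (simp add: \<sigma>_derivation \<sigma>_A_right)

text \<open>One bracket with x lands in N, and there ad x is nilpotent because N is a nilpotent
  algebra.\<close>

lemma nilpotent_N: "x \<in> N \<Longrightarrow> \<exists>n. (br x ^^ n) v = 0"
proof -
  assume x: "x \<in> N"
  then obtain n where "(br x ^^ n) (br x v) = 0"
    using nilpotent_lie_ad[of N x "br x v"] nilradical br_in_N by (auto simp: is_nilradical_def)
  then have "(br x ^^ Suc n) v = 0"
    by (simp add: funpow_swap1)
  then show ?thesis by blast
qed

lemma nilpotent_A: "x \<in> A \<Longrightarrow> \<exists>n. ((\<lambda>v. br x v - \<sigma> x v) ^^ n) v = 0"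
  using nilpotent_part_nilpotent[OF fin_dim_L lin_on_br, of x] by (simp add: \<sigma>_A)

text \<open>Simultaneous diagonalization is available for finitely many operators, hence the finite
  generating set B of A. It extends to all x because for fixed v the x for which v is an eigenvector
  of \<open>\<sigma> x\<close> form a subspace, and \<open>\<sigma> x\<close> depends only on
  \<open>pr x\<close>.\<close>

lemma span_\<sigma>_eigenvectors: "span {v. \<forall>x. \<exists>c. \<sigma> x v = scale c v} = UNIV"
proof -
  obtain B where B: "finite B" "A = span B"
    using subspace_of_fd[OF fin_dim_L subspace_A] by (auto simp: fd_subspace_def)
  have BA: "B \<subseteq> A"
    using B(2) span_base by blast
  have sp: "span {v. \<forall>i\<in>B. \<exists>c. \<sigma> i v = scale c v} = UNIV"
  proof (rule span_simultaneous_eigenvectors[OF B(1) \<sigma>_lin])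
    show "span {v. \<exists>c. \<sigma> i v = scale c v} = UNIV" for i
      unfolding \<sigma>_def by (rule span_eigenvectors_semisimple_part[OF fin_dim_L lin_on_br])
  qed (rule \<sigma>_commute)
  have "\<exists>c. \<sigma> x v = scale c v" if v: "\<forall>i\<in>B. \<exists>c. \<sigma> i v = scale c v" for x v
  proof -
    have sub: "subspace {x. \<exists>c. \<sigma> x v = scale c v}"
    proof (rule subspaceI)
      show "0 \<in> {x. \<exists>c. \<sigma> x v = scale c v}"
        using \<sigma>_N[OF subspace_0[OF subspace_N]] by (auto intro: exI[of _ 0])
      show "x + y \<in> {x. \<exists>c. \<sigma> x v = scale c v}"
        if "x \<in> {x. \<exists>c. \<sigma> x v = scale c v}" "y \<in> {x. \<exists>c. \<sigma> x v = scale c v}" for x y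
        using that by (auto simp: \<sigma>_add_left simp flip: scale_left_distrib)
      show "scale a x \<in> {x. \<exists>c. \<sigma> x v = scale c v}" if "x \<in> {x. \<exists>c. \<sigma> x v = scale c v}" for a x
        using that by (auto simp: \<sigma>_scale_left)
    qed
    have "B \<subseteq> {x. \<exists>c. \<sigma> x v = scale c v}"
      using v by blast
    from span_minimal[OF this sub] have "A \<subseteq> {x. \<exists>c. \<sigma> x v = scale c v}"
      using B(2) by simp
    moreover have "\<sigma> x v = \<sigma> (pr x) v"
      by (simp add: \<sigma>_def pr_A pr_in_A)
    ultimately show ?thesis
      using pr_in_A by auto
  qed
  then have inc: "{v. \<forall>i\<in>B. \<exists>c. \<sigma> i v = scale c v} \<subseteq> {v. \<forall>x. \<exists>c. \<sigma> x v = scale c v}"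
    by blast
  have "UNIV \<subseteq> span {v. \<forall>x. \<exists>c. \<sigma> x v = scale c v}"
    by (rule subset_trans[OF eq_refl[OF sp[symmetric]] span_mono[OF inc]])
  then show ?thesis
    by (rule antisym[OF subset_UNIV])
qed

definition nbr :: "'s \<Rightarrow> 's \<Rightarrow> 's" where
  "nbr x y = br x y - \<sigma> x y + \<sigma> y x"

lemma nilshadow_bracket_eq: "nilshadow_bracket scale br A N = nbr"
  by (simp add: nilshadow_bracket_def nbr_def \<sigma>_def pr_def fun_eq_iff)

lemma nbr_in_N: "nbr x y \<in> N"
  unfolding nbr_def using br_in_N \<sigma>_in_N subspace_N by (intro subspace_add subspace_diff)

text \<open>The inner bracket lies in N, so its own twist vanishes. In the cyclic sum the terms with
  two factors \<sigma> cancel by commutativity, and the mixed ones by antisymmetry of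
  \<open>br\<close>.\<close>

lemma nbr_jacobi_term:
  "nbr x (nbr y z) = br x (br y z) - br x (\<sigma> y z) + br x (\<sigma> z y)
    - (br (\<sigma> x y) z + br y (\<sigma> x z)) + \<sigma> x (\<sigma> y z) - \<sigma> x (\<sigma> z y)"
  using \<sigma>_N[OF nbr_in_N, of y z x]
  by (simp add: nbr_def[of x] nbr_def[of y z] br_add_right br_diff_right \<sigma>_add_right \<sigma>_diff_right
      \<sigma>_derivation algebra_simps)

lemma lie_algebra_nbr: "lie_algebra scale UNIV nbr"
proof
  show "fd_subspace scale UNIV" by (rule fin_dim_L)
  show "lin_on scale scale UNIV (\<lambda>x. nbr x y)" for y
    by (simp add: lin_on_def nbr_def br_add_left br_scale_left \<sigma>_add_left \<sigma>_add_right
        \<sigma>_scale_left \<sigma>_scale_right scale_right_distrib scale_right_diff_distrib)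
  show "lin_on scale scale UNIV (nbr x)" for x
    by (simp add: lin_on_def nbr_def br_add_right br_scale_right \<sigma>_add_left \<sigma>_add_right
        \<sigma>_scale_left \<sigma>_scale_right scale_right_distrib scale_right_diff_distrib)
  show "nbr x x = 0" for x
    using br_alternating[of x] by (simp add: nbr_def)
  show "nbr x (nbr y z) + nbr y (nbr z x) + nbr z (nbr x y) = 0" for x y z
  proof -
    have "br x (br y z) + br y (br z x) + br z (br x y) = 0"
      using jacobi by simp
    moreover have "br (\<sigma> a b) c = - br c (\<sigma> a b)" for a b c
      by (rule br_anti)
    ultimately show ?thesis
      using \<sigma>_commute[of y x z] \<sigma>_commute[of z x y] \<sigma>_commute[of z y x]
      by (simp add: nbr_jacobi_term algebra_simps)
  qed
qed simp

section \<open>The extension of A by N and its deformation\<close>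

lemma lie_algebra_subset:
  assumes "subspace U" "\<And>x y. x \<in> U \<Longrightarrow> y \<in> U \<Longrightarrow> br x y \<in> U"
  shows "lie_algebra scale U br"
proof
  show "fd_subspace scale U"
    using subspace_of_fd[OF fin_dim_L assms(1)] by simp
  show "lin_on scale scale U (\<lambda>x. br x y)" for y
    using lin_on_subset[OF br_linear_left subset_UNIV] by simp
  show "lin_on scale scale U (br x)" for x
    using lin_on_subset[OF br_linear_right subset_UNIV] by simp
qed (use assms br_alternating jacobi in simp_all)

lemma lie_algebra_N: "lie_algebra scale N br"
  by (rule lie_algebra_subset[OF subspace_N br_in_N])

lemma lie_algebra_A: "lie_algebra scale A (\<lambda>_ _. 0)"
proof
  show "fd_subspace scale A"
    using subspace_of_fd[OF fin_dim_L subspace_A] by simp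
qed (simp_all add: lin_on_def subspace_0[OF subspace_A])

lemma derivation_on_N_br: "derivation_on scale N br (br x)"
  unfolding derivation_on_def
proof (intro conjI ballI)
  show "lin_on scale scale N (br x)"
    by (rule lin_on_subset[OF lin_on_br subset_UNIV])
qed (use br_in_N br_leibniz in blast)+

lemma lie_extension_br: "lie_extension scale A (\<lambda>_ _. 0) scale N br br br"
proof -
  interpret A: lie_algebra scale A "\<lambda>_ _. 0" by (rule lie_algebra_A)
  interpret N: lie_algebra scale N br by (rule lie_algebra_N)
  show ?thesis
  proof
    show "derivation_on scale N br (br x)" for x
      by (rule derivation_on_N_br)
    show "lin_on scale scale A (\<lambda>x. br x k)" if "k \<in> N" for k
      using lin_on_subset[OF br_linear_left subset_UNIV] by simp
    show "lin_on scale scale A (\<lambda>x. br x k)" if "k \<in> A" for k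
      using lin_on_subset[OF br_linear_left subset_UNIV] by simp
    show "lin_on scale scale A (br k)" for k
      using lin_on_subset[OF br_linear_right subset_UNIV] by simp
    show "br x y \<in> N" for x y by (rule br_in_N)
    show "br x x = 0" for x by (simp add: br_alternating)
    show "br x (br y k) - br y (br x k) = br 0 k + br (br x y) k" for x y k
      using br_leibniz[of x y k] by simp
    show "br x (br y z) + br y (br z x) + br z (br x y) = br 0 z + br 0 x + br 0 y" for x y z
      using jacobi by simp
  qed
qed

abbreviation \<beta> :: "'s \<Rightarrow> 's \<Rightarrow> 's" where
  "\<beta> x k \<equiv> - \<sigma> x k"

lemma elementary_deformation:
  "elementary_linear_deformation scale A (\<lambda>_ _. 0) scale N br br br \<beta>"
  unfolding elementary_linear_deformation_def
proof (intro conjI ballI lie_extension_br)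
  have neg: "\<sigma> x (- k) = - \<sigma> x k" for x k
    using \<sigma>_scale_right[of x "-1" k] by simp
  show "derivation_on scale N br (\<beta> x)" for x
    unfolding derivation_on_def
  proof (intro conjI ballI)
    show "lin_on scale scale N (\<beta> x)"
      by (simp add: lin_on_def \<sigma>_add_right \<sigma>_scale_right)
    show "\<beta> x ` N \<subseteq> N"
      using \<sigma>_in_N subspace_neg[OF subspace_N] by blast
    show "\<beta> x (br k l) = br (\<beta> x k) l + br k (\<beta> x l)" for k l
      by (simp add: \<sigma>_derivation br_minus_left br_minus_right)
  qed
  show "lin_on scale scale A (\<lambda>x. \<beta> x k)" for k
    by (simp add: lin_on_def \<sigma>_add_left \<sigma>_scale_left)
  show "\<beta> x (\<beta> y k) - \<beta> y (\<beta> x k) = 0" for x y k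
    by (simp add: neg \<sigma>_commute[of x y])
  show "br x (\<beta> y k) - \<beta> y (br x k) = 0" if "x \<in> A" for x y k
    by (simp add: br_minus_right \<sigma>_br_A[OF that])
  \<comment> \<open>The bracket [y, z] may leave A, but it stays in the subalgebra H, on which
    \<open>ss x\<close> vanishes.\<close>
  show "\<beta> x (br y z) = 0" if x: "x \<in> A" and y: "y \<in> A" and z: "z \<in> A" for x y z
  proof -
    have "br y z \<in> H"
      using cartan y z A_H by (auto simp: cartan_subalgebra_def lie_subalgebra_def)
    then show ?thesis
      using x A_H ss_H[of x "br y z"] by (auto simp: \<sigma>_A)
  qed
qed simp_all

lemma bij_sum: "bij_betw (\<lambda>(x, k). x + k) (A \<times> N) UNIV"
  unfolding bij_betw_def
proof
  show "inj_on (\<lambda>(x, k). x + k) (A \<times> N)"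
  proof (rule inj_onI, clarify)
    fix x k y l assume *: "x \<in> A" "k \<in> N" "y \<in> A" "l \<in> N" "x + k = y + l"
    have "pr (x + k) = x" "pr (y + l) = y"
      using *(1-4) pr_unique[of x "x + k"] pr_unique[of y "y + l"] by simp_all
    then show "x = y \<and> k = l"
      using *(5) by auto
  qed
  show "(\<lambda>(x, k). x + k) ` (A \<times> N) = UNIV"
  proof (rule antisym[OF subset_UNIV], rule subsetI)
    fix x
    have "(\<lambda>(x, k). x + k) (pr x, x - pr x) \<in> (\<lambda>(x, k). x + k) ` (A \<times> N)"
      using pr_in_A diff_pr_in_N by (intro imageI) simp
    then show "x \<in> (\<lambda>(x, k). x + k) ` (A \<times> N)" by simp
  qed
qed

lemma lie_isomorphism_sum:
  assumes "lie_algebra scale UNIV b"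
    and "\<And>x y k l. x \<in> A \<Longrightarrow> y \<in> A \<Longrightarrow> k \<in> N \<Longrightarrow> l \<in> N \<Longrightarrow> \<rho> x y + \<alpha> x l - \<alpha> y k + br k l \<in> N"
    and "\<And>x y k l. x \<in> A \<Longrightarrow> y \<in> A \<Longrightarrow> k \<in> N \<Longrightarrow> l \<in> N \<Longrightarrow>
      \<rho> x y + \<alpha> x l - \<alpha> y k + br k l = b (x + k) (y + l)"
  shows "lie_isomorphism (prod_scale scale scale) (A \<times> N) (extension_bracket (\<lambda>_ _. 0) br \<alpha> \<rho>)
    scale UNIV b (\<lambda>(x, k). x + k)"
proof -
  let ?b = "extension_bracket (\<lambda>_ _. 0) br \<alpha> \<rho>"
  have lin: "lin_on (prod_scale scale scale) scale (A \<times> N) (\<lambda>(x, k). x + k)"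
    by (auto simp: lin_on_def prod_scale_def scale_right_distrib)
  have hom: "(\<lambda>(x, k). x + k) (?b p q) = b ((\<lambda>(x, k). x + k) p) ((\<lambda>(x, k). x + k) q)"
    if "p \<in> A \<times> N" "q \<in> A \<times> N" for p q
    using that assms(3) by (auto simp: extension_bracket_def)
  have "lie_algebra (prod_scale scale scale) (A \<times> N) ?b"
  proof (rule lie_algebra_transport[where f = "\<lambda>(x, k). x + k" and t = scale and M = UNIV and br' = b])
    show "lie_algebra scale UNIV b" by (rule assms(1))
    show "lin_on (prod_scale scale scale) scale (A \<times> N) (\<lambda>(x, k). x + k)" by (rule lin)
    show "bij_betw (\<lambda>(x, k). x + k) (A \<times> N) UNIV" by (rule bij_sum)
    show "(\<lambda>(x, k). x + k) (?b p q) = b ((\<lambda>(x, k). x + k) p) ((\<lambda>(x, k). x + k) q)"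
      if "p \<in> A \<times> N" "q \<in> A \<times> N" for p q
      by (rule hom[OF that])
    show "vector_space (prod_scale scale scale)"
      by (intro vector_space_prod_scale vector_space_axioms)
    show "fd_subspace (prod_scale scale scale) (A \<times> N)"
      using subspace_of_fd[OF fin_dim_L] subspace_A subspace_N
      by (intro fd_subspace_Times vector_space_axioms) auto
    show "?b p q \<in> A \<times> N" if "p \<in> A \<times> N" "q \<in> A \<times> N" for p q
      using that assms(2) by (auto simp: extension_bracket_def subspace_0[OF subspace_A])
  qed
  then show ?thesis
    unfolding lie_isomorphism_def using assms(1) lin bij_sum hom by (intro conjI ballI)
qed

lemma lie_isomorphism_br:
  "lie_isomorphism (prod_scale scale scale) (A \<times> N) (extension_bracket (\<lambda>_ _. 0) br br br)
    scale UNIV br (\<lambda>(x, k). x + k)"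
proof (rule lie_isomorphism_sum[OF lie_algebra_axioms])
  fix x y k l
  show *: "br x y + br x l - br y k + br k l = br (x + k) (y + l)"
    using br_anti[of y k] by (simp add: br_add_left br_add_right algebra_simps)
  show "br x y + br x l - br y k + br k l \<in> N"
    unfolding * by (rule br_in_N)
qed

lemma lie_isomorphism_nbr:
  "lie_isomorphism (prod_scale scale scale) (A \<times> N)
    (extension_bracket (\<lambda>_ _. 0) br (\<lambda>x k. br x k + \<beta> x k) br) scale UNIV nbr (\<lambda>(x, k). x + k)"
proof (rule lie_isomorphism_sum[OF lie_algebra_nbr])
  fix x y k l assume xy: "x \<in> A" "y \<in> A" and kl: "k \<in> N" "l \<in> N"
  show *: "br x y + (br x l + \<beta> x l) - (br y k + \<beta> y k) + br k l = nbr (x + k) (y + l)"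
    using br_anti[of y k] xy kl
    by (simp add: nbr_def br_add_left br_add_right \<sigma>_add_left \<sigma>_add_right \<sigma>_N \<sigma>_A_right algebra_simps)
  show "br x y + (br x l + \<beta> x l) - (br y k + \<beta> y k) + br k l \<in> N"
    unfolding * by (rule nbr_in_N)
qed

end

section \<open>Cochains\<close>

text \<open>\<open>slot_sum D f\<close> is the action of \<open>- D\<close> on a cochain \<open>f\<close>, and \<open>cob b l f\<close> is the coboundary for the
  bracket \<open>b\<close> with coefficients in the character \<open>l\<close>. The recursion for \<open>cob\<close> is Cartan's formula for
  the contraction with the first argument.\<close>

fun slot_sum :: "('l \<Rightarrow> 'l) \<Rightarrow> ('l list \<Rightarrow> 'k::comm_ring_1) \<Rightarrow> 'l list \<Rightarrow> 'k" where
  "slot_sum D f [] = 0"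
| "slot_sum D f (x # xs) = f (D x # xs) + slot_sum D (\<lambda>ys. f (x # ys)) xs"

fun cob :: "('l \<Rightarrow> 'l \<Rightarrow> 'l) \<Rightarrow> ('l \<Rightarrow> 'k::comm_ring_1) \<Rightarrow> ('l list \<Rightarrow> 'k) \<Rightarrow> 'l list \<Rightarrow> 'k" where
  "cob b l f [] = 0"
| "cob b l f (x # xs) = l x * f xs - slot_sum (b x) f xs - cob b l (\<lambda>ys. f (x # ys)) xs"

text \<open>The sum over i of (-1)^i times the value of G at the i-th entry and the list of the
  other entries. The coefficient term of the coboundary has this shape.\<close>

fun alt_sum :: "('l \<Rightarrow> 'l list \<Rightarrow> 'k::comm_ring_1) \<Rightarrow> 'l list \<Rightarrow> 'k" where
  "alt_sum G [] = 0"
| "alt_sum G (x # xs) = G x xs - alt_sum (\<lambda>y ys. G y (x # ys)) xs"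

lemma slot_sum_add: "slot_sum D (\<lambda>ys. f ys + g ys) xs = slot_sum D f xs + slot_sum D g xs"
  by (induction xs arbitrary: f g) (simp_all add: algebra_simps)

lemma slot_sum_scale: "slot_sum D (\<lambda>ys. c * f ys) xs = c * slot_sum D f xs"
  by (induction xs arbitrary: f) (simp_all add: algebra_simps)

lemma slot_sum_zero [simp]: "slot_sum D (\<lambda>_. 0) = (\<lambda>_. 0)"
proof
  show "slot_sum D (\<lambda>_. 0) xs = 0" for xs
    by (induction xs) simp_all
qed

lemma slot_sum_minus: "slot_sum D (\<lambda>ys. - f ys) xs = - slot_sum D f xs"
  using slot_sum_scale[of D "-1" f xs] by simp

lemma slot_sum_diff: "slot_sum D (\<lambda>ys. f ys - g ys) xs = slot_sum D f xs - slot_sum D g xs"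
  using slot_sum_add[of D f "\<lambda>ys. - g ys" xs] by (simp add: slot_sum_minus)

lemma cob_add: "cob b l (\<lambda>ys. f ys + g ys) xs = cob b l f xs + cob b l g xs"
  by (induction xs arbitrary: f g) (simp_all add: algebra_simps slot_sum_add)

lemma cob_scale: "cob b l (\<lambda>ys. c * f ys) xs = c * cob b l f xs"
  by (induction xs arbitrary: f) (simp_all add: algebra_simps slot_sum_scale)

lemma cob_zero [simp]: "cob b l (\<lambda>_. 0) xs = 0"
  by (induction xs) simp_all

lemma alt_sum_add: "alt_sum (\<lambda>y ys. F y ys + G y ys) xs = alt_sum F xs + alt_sum G xs"
  by (induction xs arbitrary: F G) simp_all

lemma alt_sum_minus: "alt_sum (\<lambda>y ys. - F y ys) xs = - alt_sum F xs"
  by (induction xs arbitrary: F) simp_all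

lemma alt_sum_zero [simp]: "alt_sum (\<lambda>_ _. 0) xs = 0"
  by (induction xs) simp_all

lemma cob_split: "cob b l f xs = alt_sum (\<lambda>y ys. l y * f ys) xs + cob b (\<lambda>_. 0) f xs"
  by (induction xs arbitrary: f) simp_all

lemma slot_sum_vanish: "(\<And>ys. length ys = length xs \<Longrightarrow> f ys = 0) \<Longrightarrow> slot_sum D f xs = 0"
  by (induction xs arbitrary: f) simp_all

lemma cob_vanish: "(\<And>ys. Suc (length ys) = length xs \<Longrightarrow> f ys = 0) \<Longrightarrow> cob b l f xs = 0"
  by (induction xs arbitrary: f) (simp_all add: slot_sum_vanish)

lemma slot_sum_conv_sum: "slot_sum D f xs = (\<Sum>j<length xs. f (xs[j := D (xs ! j)]))"
  by (induction xs arbitrary: f) (simp_all add: sum.lessThan_Suc_shift del: sum.lessThan_Suc)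

text \<open>In contrast to \<open>linear_space\<close>, the characteristic is 0, so that alternating and antisymmetric maps
  are the same.\<close>

locale cochain_space = linear_space scale
  for scale :: "'k::field_char_0 \<Rightarrow> 'v::ab_group_add \<Rightarrow> 'v"
begin

abbreviation C :: "nat \<Rightarrow> ('v list \<Rightarrow> 'k) set" where
  "C \<equiv> cochains scale UNIV (*) UNIV"

lemma C_length: "f \<in> C p \<Longrightarrow> length xs \<noteq> p \<Longrightarrow> f xs = 0"
  by (simp add: cochains_def)

lemma C_zero: "(\<lambda>_. 0) \<in> C p"
  by (simp add: cochains_def lin_on_def)

lemma C_add: "f \<in> C p \<Longrightarrow> g \<in> C p \<Longrightarrow> (\<lambda>xs. f xs + g xs) \<in> C p"
  unfolding cochains_def lin_on_def by (simp add: algebra_simps)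

lemma C_scale: "f \<in> C p \<Longrightarrow> (\<lambda>xs. c * f xs) \<in> C p"
  unfolding cochains_def lin_on_def by (simp add: algebra_simps)

lemma C_alternating: "f \<in> C p \<Longrightarrow> i < length xs \<Longrightarrow> j < length xs \<Longrightarrow> i \<noteq> j \<Longrightarrow> xs ! i = xs ! j \<Longrightarrow> f xs = 0"
  by (cases "length xs = p") (auto simp: cochains_def)

lemma C_lin_on: "f \<in> C p \<Longrightarrow> i < length xs \<Longrightarrow> lin_on scale (*) UNIV (\<lambda>x. f (xs[i := x]))"
  by (cases "length xs = p") (simp_all add: cochains_def lin_on_def)

lemma C_tail:
  assumes "f \<in> C (Suc p)"
  shows "(\<lambda>ys. f (x # ys)) \<in> C p"
proof -
  have "lin_on scale (*) UNIV (\<lambda>z. f (x # ys[i := z]))" if "i < length ys" for i ys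
    using C_lin_on[OF assms, of "Suc i" "x # ys"] that by simp
  moreover have "f (x # ys) = 0" if "i < length ys" "j < length ys" "i \<noteq> j" "ys ! i = ys ! j" for i j ys
    using C_alternating[OF assms, of "Suc i" "x # ys" "Suc j"] that by simp
  ultimately show ?thesis
    using C_length[OF assms] by (auto simp: cochains_def)
qed

lemma C_add_head: "f \<in> C p \<Longrightarrow> f ((x + y) # ys) = f (x # ys) + f (y # ys)"
  and C_scale_head: "f \<in> C p \<Longrightarrow> f (scale c x # ys) = c * f (x # ys)"
  using C_lin_on[of f p 0 "undefined # ys"] by (simp_all add: lin_on_def)

lemma C_minus_head: "f \<in> C p \<Longrightarrow> f ((- x) # ys) = - f (x # ys)"
  using C_scale_head[of f p "-1" x ys] by simp

lemma C_diff_head: "f \<in> C p \<Longrightarrow> f ((x - y) # ys) = f (x # ys) - f (y # ys)"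
  using C_add_head[of f p x "- y" ys] by (simp add: C_minus_head)

lemma C_swap:
  assumes "f \<in> C p"
  shows "f (x # y # zs) = - f (y # x # zs)"
proof (cases p)
  case 0
  then show ?thesis
    using C_length[OF assms] by simp
next
  case (Suc q)
  note t = C_tail[OF assms[unfolded Suc]]
  have z: "f (x # x # zs) = 0" for x
    using C_alternating[OF assms, of 0 "x # x # zs" 1] by simp
  have "f ((x + y) # (x + y) # zs) = f (x # x # zs) + f (x # y # zs) + (f (y # x # zs) + f (y # y # zs))"
    using C_add_head[OF assms] C_add_head[OF t] by simp
  then show ?thesis
    by (simp add: z eq_neg_iff_add_eq_0)
qed

text \<open>Exchanging the first two arguments brings a repetition of the head into the tail, where
  the function alternates already. If the first two arguments themselves coincide, antisymmetry
  gives 2 f = 0.\<close>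

lemma C_SucI:
  assumes nil: "f [] = 0" and tail: "\<And>x. (\<lambda>ys. f (x # ys)) \<in> C p"
    and lin: "\<And>ys. lin_on scale (*) UNIV (\<lambda>x. f (x # ys))"
    and swap: "\<And>x y zs. f (x # y # zs) = - f (y # x # zs)"
  shows "f \<in> C (Suc p)"
proof -
  have rep: "f (x # ys) = 0" if x: "x \<in> set ys" for x ys
  proof (cases ys)
    case (Cons y zs)
    show ?thesis
    proof (cases "x = y")
      case True
      have "2 * f (x # x # zs) = 0"
        using swap[of x x zs] by (simp only: eq_neg_iff_add_eq_0 mult_2)
      then show ?thesis
        using True Cons by simp
    next
      case False
      then obtain j where "j < length zs" "zs ! j = x"
        using x Cons by (auto simp: in_set_conv_nth)
      then have "f (y # x # zs) = 0"
        using C_alternating[OF tail[of y], of 0 "x # zs" "Suc j"] by simp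
      then show ?thesis
        using swap[of x y zs] Cons by simp
    qed
  qed (use that in simp)
  have "lin_on scale (*) UNIV (\<lambda>x. f (xs[i := x]))" if "i < length xs" for i xs
  proof (cases xs)
    case (Cons y ys)
    then show ?thesis
      using that lin C_lin_on[OF tail[of y], of _ ys] by (cases i) simp_all
  qed (use that in simp)
  moreover have "f xs = 0" if ij: "i < length xs" "j < length xs" "i \<noteq> j" "xs ! i = xs ! j" for i j xs
  proof (cases xs)
    case (Cons y ys)
    show ?thesis
    proof (cases i)
      case 0
      then have "y \<in> set ys"
        using ij Cons by (cases j) auto
      then show ?thesis using rep Cons by simp
    next
      case (Suc i')
      show ?thesis
      proof (cases j)
        case 0
        then have "y \<in> set ys"
          using ij Cons Suc nth_mem[of i' ys] by simp
        then show ?thesis using rep Cons by simp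
      next
        case (Suc j')
        then show ?thesis
          using ij Cons \<open>i = Suc i'\<close> C_alternating[OF tail[of y], of i' ys j'] by simp
      qed
    qed
  qed (use ij in simp)
  moreover have "f xs = 0" if "length xs \<noteq> Suc p" for xs
    using that nil C_length[OF tail] by (cases xs) simp_all
  ultimately show ?thesis
    by (auto simp: cochains_def)
qed

lemma slot_sum_C:
  assumes D: "lin_on scale scale UNIV D"
  shows "f \<in> C p \<Longrightarrow> slot_sum D f \<in> C p"
proof (induction p arbitrary: f)
  case 0
  then have "slot_sum D f xs = 0" for xs
    using C_length[OF 0] by (cases xs) simp_all
  then have "slot_sum D f = (\<lambda>_. 0)" by blast
  then show ?case using C_zero by simp
next
  case (Suc p)
  note f = Suc.prems
  have tail: "(\<lambda>ys. slot_sum D f (x # ys)) \<in> C p" for x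
    using C_add[OF C_tail[OF f] Suc.IH[OF C_tail[OF f]]] by simp
  show ?case
  proof (rule C_SucI[OF _ tail])
    show "lin_on scale (*) UNIV (\<lambda>x. slot_sum D f (x # ys))" for ys
      by (simp add: lin_on_def C_add_head[OF f] C_scale_head[OF f] slot_sum_add slot_sum_scale
          lin_onD_add[OF D] lin_onD_scale[OF D] distrib_left)
    show "slot_sum D f (x # y # zs) = - slot_sum D f (y # x # zs)" for x y zs
    proof -
      have "(\<lambda>ys. f (x # y # ys)) = (\<lambda>ys. - f (y # x # ys))"
        using C_swap[OF f] by blast
      then show ?thesis
        using C_swap[OF f, of "D x"] C_swap[OF f, of x "D y"] by (simp add: slot_sum_minus)
    qed
  qed simp
qed

lemma slot_sum_add_op:
  "f \<in> C p \<Longrightarrow> slot_sum (\<lambda>x. D x + D' x) f xs = slot_sum D f xs + slot_sum D' f xs"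
proof (induction xs arbitrary: f p)
  case (Cons x xs)
  then show ?case
    using C_length[OF Cons.prems] Cons.IH[OF C_tail]
    by (cases p) (simp_all add: C_add_head[OF Cons.prems])
qed simp

lemma slot_sum_minus_op: "f \<in> C p \<Longrightarrow> slot_sum (\<lambda>x. - D x) f xs = - slot_sum D f xs"
proof (induction xs arbitrary: f p)
  case (Cons x xs)
  then show ?case
    using C_length[OF Cons.prems] Cons.IH[OF C_tail]
    by (cases p) (simp_all add: C_minus_head[OF Cons.prems])
qed simp

lemma slot_sum_diff_op:
  "f \<in> C p \<Longrightarrow> slot_sum (\<lambda>x. D x - D' x) f xs = slot_sum D f xs - slot_sum D' f xs"
  using slot_sum_add_op[of f p D "\<lambda>x. - D' x" xs] by (simp add: slot_sum_minus_op)

text \<open>The commutator appears in the reversed order because operators inserted into arguments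
  act contravariantly.\<close>

lemma slot_sum_commutator:
  "f \<in> C p \<Longrightarrow> slot_sum D (slot_sum D' f) xs - slot_sum D' (slot_sum D f) xs
    = slot_sum (\<lambda>x. D' (D x) - D (D' x)) f xs"
proof (induction xs arbitrary: f p)
  case (Cons x xs)
  show ?case
  proof (cases p)
    case 0
    then have "f (y # ys) = 0" for y ys
      using C_length[OF Cons.prems] by simp
    then show ?thesis by simp
  next
    case (Suc q)
    then have "(\<lambda>ys. f (x # ys)) \<in> C q"
      using Cons.prems C_tail by simp
    from Cons.IH[OF this] show ?thesis
      by (simp add: slot_sum_add C_diff_head[OF Cons.prems] algebra_simps)
  qed
qed simp

lemma slot_sum_commute:
  assumes "f \<in> C p" "\<And>x. D (D' x) = D' (D x)"
  shows "slot_sum D (slot_sum D' f) = slot_sum D' (slot_sum D f)"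
proof
  fix xs
  have "slot_sum (\<lambda>x. D' (D x) - D (D' x)) f xs = slot_sum (\<lambda>x. 0 - 0) f xs"
    using assms(2) by simp
  also have "\<dots> = 0"
    by (subst slot_sum_diff_op[OF assms(1)]) simp
  finally show "slot_sum D (slot_sum D' f) xs = slot_sum D' (slot_sum D f) xs"
    using slot_sum_commutator[OF assms(1), of D D' xs] by simp
qed

text \<open>Contraction with y commutes with the action of D up to contraction with
  \<open>D y\<close>, and the action of \<open>b y\<close> up to that of \<open>b (D y)\<close>. In
  the recursion for \<open>cob\<close> these corrections match; only the term with
  \<open>l (D y)\<close> has no partner, whence the assumption on l.\<close>

lemma cob_slot_sum:
  assumes der: "\<And>x y. D (b x y) = b (D x) y + b x (D y)" and l: "\<And>x. l (D x) = 0"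
    and b_lin: "\<And>x. lin_on scale scale UNIV (b x)" and b_add: "\<And>x y z. b (x + y) z = b x z + b y z"
  shows "f \<in> C p \<Longrightarrow> cob b l (slot_sum D f) xs = slot_sum D (cob b l f) xs"
proof (induction xs arbitrary: f p)
  case (Cons y xs)
  show ?case
  proof (cases p)
    \<comment> \<open>Contractions of a 0-cochain vanish, and no lower degree is available for the
      induction hypothesis.\<close>
    case 0
    have z: "f (x # ys) = 0" for x ys
      using C_length[OF Cons.prems] 0 by simp
    then have "slot_sum D f zs = 0" for zs
      by (cases zs) simp_all
    then have 1: "slot_sum D f = (\<lambda>_. 0)" by blast
    have "slot_sum D' f ys = 0" for D' ys
      using z by (cases ys) simp_all
    then have c: "cob b l f (x # ys) = l x * f ys" for x ys
      using z by simp
    have "slot_sum D (cob b l f) (y # xs) = l (D y) * f xs + slot_sum D (\<lambda>ys. l y * f ys) xs"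
      by (simp only: slot_sum.simps c)
    also have "\<dots> = 0"
      using 1 l by (simp add: slot_sum_scale)
    finally show ?thesis
      by (simp only: 1 cob_zero)
  next
    case (Suc q)
    note f = Cons.prems
    have t: "(\<lambda>ys. f (x # ys)) \<in> C q" for x
      using f Suc C_tail by simp
    have IH: "cob b l (slot_sum D (\<lambda>ys. f (y # ys))) xs = slot_sum D (cob b l (\<lambda>ys. f (y # ys))) xs"
      by (rule Cons.IH[OF t])
    have comm: "slot_sum D (slot_sum (b y) f) xs
        = slot_sum (b y) (slot_sum D f) xs - slot_sum (b (D y)) f xs"
    proof -
      have "(\<lambda>x. b y (D x) - D (b y x)) = (\<lambda>x. - b (D y) x)"
        by (simp add: der fun_eq_iff)
      then show ?thesis
        using slot_sum_commutator[OF f, of D "b y" xs] slot_sum_minus_op[OF f] by (simp add: algebra_simps)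
    qed
    have A: "slot_sum D (cob b l f) (y # xs) =
        (l (D y) * f xs - slot_sum (b (D y)) f xs - cob b l (\<lambda>ys. f (D y # ys)) xs) +
        (l y * slot_sum D f xs - slot_sum D (slot_sum (b y) f) xs - slot_sum D (cob b l (\<lambda>ys. f (y # ys))) xs)"
      by (simp add: slot_sum_diff slot_sum_scale)
    have B: "cob b l (slot_sum D f) (y # xs) =
        l y * slot_sum D f xs - slot_sum (b y) (slot_sum D f) xs
        - (cob b l (\<lambda>ys. f (D y # ys)) xs + cob b l (slot_sum D (\<lambda>ys. f (y # ys))) xs)"
      by (simp add: cob_add)
    show ?thesis
      unfolding A B by (simp add: IH comm l)
  qed
qed simp

text \<open>Moving the altered argument from place i to the front costs the sign (-1)^i.\<close>

lemma slot_sum_eq_alt_sum: "f \<in> C p \<Longrightarrow> slot_sum h f xs = alt_sum (\<lambda>y ys. f (h y # ys)) xs"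
proof (induction xs arbitrary: f p)
  case (Cons x xs)
  show ?case
  proof (cases p)
    case 0
    then have "f (y # ys) = 0" for y ys
      using C_length[OF Cons.prems] by simp
    then show ?thesis by simp
  next
    case (Suc q)
    then have "(\<lambda>ys. f (x # ys)) \<in> C q"
      using Cons.prems C_tail by simp
    from Cons.IH[OF this] have "slot_sum h (\<lambda>ys. f (x # ys)) xs = alt_sum (\<lambda>y ys. f (x # h y # ys)) xs" .
    also have "(\<lambda>y ys. f (x # h y # ys)) = (\<lambda>y ys. - f (h y # x # ys))"
      using C_swap[OF Cons.prems] by blast
    finally show ?thesis
      by (simp add: alt_sum_minus)
  qed
qed simp

text \<open>With x the first argument, the summand \<open>- s x y\<close> contributes the action of
  \<open>s x\<close> directly. The summand \<open>s y x\<close>, with y running through the other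
  arguments, gives by \<open>slot_sum_eq_alt_sum\<close> the terms of the alternating sum in which
  \<open>s y\<close> hits x.\<close>

lemma cob_deformation:
  assumes "f \<in> C p"
  shows "cob (\<lambda>x y. b x y - s x y + s y x) (\<lambda>_. 0) f xs = cob b (\<lambda>_. 0) f xs + alt_sum (\<lambda>y. slot_sum (s y) f) xs"
  using assms
proof (induction xs arbitrary: f p)
  case (Cons x xs)
  note f = Cons.prems
  let ?b = "\<lambda>x y. b x y - s x y + s y x"
  have IH: "cob ?b (\<lambda>_. 0) (\<lambda>ys. f (x # ys)) xs
      = cob b (\<lambda>_. 0) (\<lambda>ys. f (x # ys)) xs + alt_sum (\<lambda>y. slot_sum (s y) (\<lambda>ys. f (x # ys))) xs"
  proof (cases p)
    case 0
    then have "(\<lambda>ys. f (x # ys)) = (\<lambda>_. 0)"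
      using C_length[OF f] by auto
    then show ?thesis
      using Cons.IH[OF C_zero] by simp
  next
    case (Suc q)
    then show ?thesis
      using Cons.IH[OF C_tail] f by simp
  qed
  have "slot_sum (?b x) f xs = slot_sum (b x) f xs - slot_sum (s x) f xs + slot_sum (\<lambda>y. s y x) f xs"
    using slot_sum_add_op[OF f, of "\<lambda>y. b x y - s x y" "\<lambda>y. s y x"] slot_sum_diff_op[OF f] by simp
  then show ?case
    by (simp add: IH slot_sum_eq_alt_sum[OF f, of "\<lambda>y. s y x"] alt_sum_add)
qed simp

subsection \<open>Comparison with the coboundary defined by omitting arguments\<close>

lemma C_move:
  "f \<in> C p \<Longrightarrow> j < length xs \<Longrightarrow> f (y # nths xs (- {j})) = (- 1) ^ j * f (xs[j := y])"
proof (induction j arbitrary: xs f p)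
  case 0
  then obtain x ys where "xs = x # ys" by (cases xs) auto
  moreover have "nths (x # ys) (- {0}) = ys"
    by (simp add: nths_Cons nths_all)
  ultimately show ?case by simp
next
  case (Suc j)
  then obtain x ys where xs: "xs = x # ys" by (cases xs) auto
  have n: "nths (x # ys) (- {Suc j}) = x # nths ys (- {j})"
    by (simp add: nths_Cons Compl_eq)
  show ?case
  proof (cases p)
    case 0
    then show ?thesis
      using C_length[OF Suc.prems(1)] by (simp add: xs n)
  next
    case (Suc q)
    have "f (y # x # nths ys (- {j})) = - f (x # y # nths ys (- {j}))"
      by (rule C_swap[OF Suc.prems(1)])
    also have "f (x # y # nths ys (- {j})) = (- 1) ^ j * f (x # ys[j := y])"
      using Suc.IH[OF C_tail[of f q]] Suc.prems Suc xs by simp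
    finally show ?thesis by (simp add: xs n)
  qed
qed

lemma sum_pairs:
  fixes g :: "nat \<Rightarrow> nat \<Rightarrow> 'a::comm_monoid_add"
  shows "(\<Sum>(i, j) \<in> {(i, j). i < j \<and> j \<le> p}. g i j) = (\<Sum>j\<le>p. \<Sum>i<j. g i j)"
proof -
  have "(\<Sum>j\<le>p. \<Sum>i<j. g i j) = (\<Sum>(j, i) \<in> Sigma {..p} (\<lambda>j. {..<j}). g i j)"
    by (rule sum.Sigma) simp_all
  also have "\<dots> = (\<Sum>(i, j) \<in> {(i, j). i < j \<and> j \<le> p}. g i j)"
    by (rule sum.reindex_bij_witness[of _ "\<lambda>(i, j). (j, i)" "\<lambda>(j, i). (i, j)"]) auto
  finally show ?thesis by simp
qed

lemma nths_omit2:
  "nths (x # xs) (- {0, Suc j}) = nths xs (- {j})" "nths (x # xs) (- {Suc i, Suc j}) = x # nths xs (- {i, j})"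
  by (simp_all add: nths_Cons Compl_eq)

text \<open>Split off the first argument x. Index 0 alone gives the term with l x; the pairs (0, j +
  1) give the action of \<open>b x\<close> once the bracket is moved into its place
  (\<open>C_move\<close>); all other terms form the coboundary of the contraction with x, with
  opposite sign.\<close>

lemma coboundary_eq_cob:
  assumes "f \<in> C p"
  shows "coboundary UNIV b (*) (\<lambda>x v. l x * v) p f = cob b l f"
proof
  fix xs
  have "(\<Sum>i\<le>p. (- 1) ^ i * (l (xs ! i) * f (nths xs (- {i}))))
      + (\<Sum>j\<le>p. \<Sum>i<j. (- 1) ^ (i + j) * f (b (xs ! i) (xs ! j) # nths xs (- {i, j}))) = cob b l f xs"
    if "length xs = Suc p"
    using assms that
  proof (induction p arbitrary: f xs)
    case 0
    then obtain x where "xs = [x]"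
      by (metis length_0_conv length_Suc_conv)
    moreover have "nths [x] (- {0}) = []"
      by (simp add: nths_Cons)
    ultimately show ?case by simp
  next
    case (Suc p)
    note f = Suc.prems(1)
    obtain x ys where xs: "xs = x # ys" and ys: "length ys = Suc p"
      using Suc.prems(2) by (cases xs) auto
    let ?g = "\<lambda>ys. f (x # ys)"
    let ?t = "\<lambda>i j. (- 1) ^ (i + j) * f (b (xs ! i) (xs ! j) # nths xs (- {i, j}))"
    let ?t' = "\<lambda>i j. (- 1) ^ (i + j) * ?g (b (ys ! i) (ys ! j) # nths ys (- {i, j}))"
    have IH: "(\<Sum>i\<le>p. (- 1) ^ i * (l (ys ! i) * ?g (nths ys (- {i})))) + (\<Sum>j\<le>p. \<Sum>i<j. ?t' i j) = cob b l ?g ys"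
      by (rule Suc.IH[OF C_tail[OF f] ys])
    have n: "nths xs (- {0}) = ys" "nths xs (- {Suc i}) = x # nths ys (- {i})" for i
      by (simp_all add: xs nths_Cons Compl_eq nths_all)
    have 1: "(\<Sum>i\<le>Suc p. (- 1) ^ i * (l (xs ! i) * f (nths xs (- {i}))))
        = l x * f ys - (\<Sum>i\<le>p. (- 1) ^ i * (l (ys ! i) * ?g (nths ys (- {i}))))"
      by (subst sum.atMost_Suc_shift) (simp add: n, simp add: xs sum_negf)
    have t0: "?t 0 (Suc j) = - f (ys[j := b x (ys ! j)])" if "j \<le> p" for j
      using C_move[OF f, of j ys "b x (ys ! j)"] that ys
      by (simp add: xs nths_omit2 flip: power_mult_distrib power_add mult.assoc)
    have tS: "?t (Suc i) (Suc j) = - ?t' i j" for i j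
      using C_swap[OF f, of "b (ys ! i) (ys ! j)" x] by (simp add: xs nths_omit2)
    have "(\<Sum>j\<le>Suc p. \<Sum>i<j. ?t i j) = (\<Sum>j\<le>p. \<Sum>i<Suc j. ?t i (Suc j))"
      by (subst sum.atMost_Suc_shift) simp
    also have "\<dots> = (\<Sum>j\<le>p. ?t 0 (Suc j) + (\<Sum>i<j. ?t (Suc i) (Suc j)))"
      by (rule sum.cong[OF refl]) (rule sum.lessThan_Suc_shift)
    also have "\<dots> = (\<Sum>j\<le>p. - f (ys[j := b x (ys ! j)]) + (\<Sum>i<j. - ?t' i j))"
      by (intro sum.cong refl arg_cong2[where f = "(+)"] t0 tS) simp
    also have "\<dots> = - slot_sum (b x) f ys - (\<Sum>j\<le>p. \<Sum>i<j. ?t' i j)"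
      by (simp add: sum_subtractf sum_negf slot_sum_conv_sum ys lessThan_Suc_atMost)
    finally have 2: "(\<Sum>j\<le>Suc p. \<Sum>i<j. ?t i j) = - slot_sum (b x) f ys - (\<Sum>j\<le>p. \<Sum>i<j. ?t' i j)" .
    show ?case
      unfolding 1 2 using IH by (simp add: xs algebra_simps)
  qed
  moreover have "cob b l f xs = 0" if "length xs \<noteq> Suc p"
    by (rule cob_vanish) (use that C_length[OF assms] in auto)
  ultimately show "coboundary UNIV b (*) (\<lambda>x v. l x * v) p f xs = cob b l f xs"
    unfolding coboundary_def sum_pairs by simp
qed

subsection \<open>Nilpotent operators on cochains\<close>

lemma slot_sum_funpow_C: "lin_on scale scale UNIV D \<Longrightarrow> f \<in> C p \<Longrightarrow> (slot_sum D ^^ n) f \<in> C p"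
  by (induction n) (simp_all add: slot_sum_C)

text \<open>The number \<open>ks ! i\<close> bounds how many further applications of D the i-th
  argument survives. Each nonzero summand of \<open>slot_sum D\<close> lowers one of these numbers,
  so more applications than their initial sum p k leave nothing.\<close>

lemma slot_sum_nilpotent:
  assumes D: "lin_on scale scale UNIV D" and k: "D ^^ k = (\<lambda>_. 0)" and f: "f \<in> C p"
  shows "(slot_sum D ^^ Suc (p * k)) f = (\<lambda>_. 0)"
proof
  fix xs
  have *: "(slot_sum D ^^ m) f xs = 0"
    if "length xs = p" "length ks = p" "\<And>i. i < p \<Longrightarrow> (D ^^ (ks ! i)) (xs ! i) = 0" "sum_list ks < m" for m xs ks
    using that
  proof (induction m arbitrary: xs ks)
    case (Suc m)
    let ?g = "(slot_sum D ^^ m) f"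
    have g: "?g \<in> C p"
      by (rule slot_sum_funpow_C[OF D f])
    have "?g (xs[j := D (xs ! j)]) = 0" if j: "j < p" for j
    proof (cases "ks ! j")
      case 0
      then have "D (xs ! j) = 0"
        using Suc.prems(3)[OF j] lin_on_self_zero[OF D subspace_UNIV] by simp
      then show ?thesis
        using C_lin_on[OF g, of j xs] j Suc.prems(1) lin_onD_scale[of scale "(*)" UNIV "\<lambda>x. ?g (xs[j := x])" 0 0]
        by simp
    next
      case (Suc k')
      have "sum_list (ks[j := k']) < m"
        using Suc.prems(2,4) j Suc elem_le_sum_list[of j ks] by (simp add: sum_list_update)
      moreover have "(D ^^ (ks[j := k'] ! i)) (xs[j := D (xs ! j)] ! i) = 0" if "i < p" for i
        using Suc.prems(1,2) Suc.prems(3)[OF that] that Suc by (cases "i = j") (simp_all add: funpow_swap1)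
      ultimately show ?thesis
        using Suc.prems(1,2) by (intro Suc.IH[of _ "ks[j := k']"]) simp_all
    qed
    then show ?case
      using Suc.prems(1) slot_sum_conv_sum[of D ?g xs] by simp
  qed simp
  show "(slot_sum D ^^ Suc (p * k)) f xs = 0"
  proof (cases "length xs = p")
    case True
    show ?thesis
      by (rule *[OF True, of "replicate p k"]) (simp_all add: k sum_list_replicate del: funpow.simps)
  next
    case False
    then show ?thesis
      using C_length[OF slot_sum_funpow_C[OF D f]] by blast
  qed
qed

end

section \<open>Weights of cochains\<close>

context nilshadow
begin

sublocale cochain_space scale ..

sublocale F: linear_space "\<lambda>(c :: 'k) (f :: 's list \<Rightarrow> 'k) xs. c * f xs"
  by unfold_locales (auto simp: fun_eq_iff algebra_simps)

abbreviation \<Theta> :: "'s \<Rightarrow> ('s list \<Rightarrow> 'k) \<Rightarrow> 's list \<Rightarrow> 'k" where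
  "\<Theta> x \<equiv> slot_sum (\<sigma> x)"

abbreviation W :: "('s \<Rightarrow> 'k) \<Rightarrow> ('s list \<Rightarrow> 'k) set" where
  "W \<equiv> F.wt_space \<Theta>"

lemma W_iff: "f \<in> W \<mu> \<longleftrightarrow> (\<forall>x xs. \<Theta> x f xs = \<mu> x * f xs)"
  by (auto simp: F.wt_space_def fun_eq_iff)

lemma \<Theta>_lin: "lin_on (\<lambda>c f xs. c * f xs) (\<lambda>c f xs. c * f xs) UNIV (\<Theta> x)"
  by (auto simp: lin_on_def plus_fun_def slot_sum_add slot_sum_scale fun_eq_iff)

lemma cob_lin: "lin_on (\<lambda>c f xs. c * f xs) (\<lambda>c f xs. c * f xs) UNIV (cob b l :: ('s list \<Rightarrow> 'k) \<Rightarrow> _)"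
  by (auto simp: lin_on_def plus_fun_def cob_add cob_scale fun_eq_iff)

lemma subspace_W: "F.subspace (W \<mu>)"
  by (rule F.subspace_wt_space[OF \<Theta>_lin])

lemma subspace_C: "F.subspace (C p)"
  using C_zero C_add C_scale by (auto simp: F.subspace_def plus_fun_def zero_fun_def)

lemma \<Theta>_C: "\<Theta> x ` C p \<subseteq> C p"
  using slot_sum_C[OF \<sigma>_lin] by blast

text \<open>In a basis of common eigenvectors b, f is the sum over b of the b-th coordinate function
  times the contraction of f with b, and such a product adds the weight of b to that of its second
  factor. The products are not alternating, so weight spaces are taken among all functions on lists;
  \<open>wcomp_C\<close> returns to cochains.\<close>

lemma C_span_W: "f \<in> C p \<Longrightarrow> f \<in> F.span (\<Union>\<mu>. W \<mu>)"
proof -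
  let ?Eig = "{v. \<forall>x. \<exists>c. \<sigma> x v = scale c v}"
  obtain B where B: "B \<subseteq> ?Eig" "independent B" "?Eig \<subseteq> span B"
    using maximal_independent_subset[of ?Eig] by blast
  have spanB: "span B = UNIV"
    using span_minimal[OF B(3) subspace_span] span_\<sigma>_eigenvectors by blast
  obtain B' where "finite B'" "UNIV = span B'"
    using fin_dim_L by (auto simp: fd_subspace_def)
  then have finB: "finite B"
    using independent_span_bound[of B' B] B(2) by auto
  define w where "w b x = (SOME c. \<sigma> x b = scale c b)" for b x
  have w: "\<sigma> x b = scale (w b x) b" if "b \<in> B" for b x
    unfolding w_def by (rule someI_ex) (use B(1) that in blast)
  let ?r = "representation B"
  have r_add: "?r (x + y) b = ?r x b + ?r y b" for x y b
    using representation_add[OF B(2)] spanB by simp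
  have r_scale: "?r (scale c x) b = c * ?r x b" for c x b
    using representation_scale[OF B(2)] spanB by simp
  have r_sum: "?r (sum g M) b = (\<Sum>i\<in>M. ?r (g i) b)" for g :: "'s \<Rightarrow> 's" and M b
    using representation_sum[OF B(2), of M g] spanB by simp
  have r_eq: "(\<Sum>b\<in>B. scale (?r x b) b) = x" for x
    using sum_representation_eq[OF B(2) _ finB] spanB by simp
  have r_\<sigma>: "?r (\<sigma> x v) b = w b x * ?r v b" if "b \<in> B" for x v b
  proof -
    have "\<sigma> x v = \<sigma> x (\<Sum>c\<in>B. scale (?r v c) c)"
      by (simp only: r_eq)
    also have "\<dots> = (\<Sum>c\<in>B. scale (?r v c * w c x) c)"
      using w by (simp add: lin_on_sum[OF \<sigma>_lin vector_space_axioms subspace_UNIV] \<sigma>_scale_right)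
    finally have "?r (\<sigma> x v) b = (\<Sum>c\<in>B. ?r v c * w c x * ?r c b)"
      by (simp add: r_sum r_scale)
    also have "\<dots> = (\<Sum>c\<in>B. if c = b then ?r v b * w b x else 0)"
      using representation_basis[OF B(2)] by (intro sum.cong) auto
    finally show ?thesis
      using that finB by (simp add: mult.commute)
  qed
  define T where "T b g xs = (case xs of [] \<Rightarrow> 0 | x # ys \<Rightarrow> ?r x b * g ys)"
    for b and g :: "'s list \<Rightarrow> 'k" and xs
  have T_lin: "lin_on (\<lambda>c f xs. c * f xs) (\<lambda>c f xs. c * f xs) UNIV (T b)" for b
    by (auto simp: lin_on_def T_def fun_eq_iff algebra_simps split: list.split)
  have T_W: "T b g \<in> W (\<lambda>x. w b x + \<mu> x)" if "b \<in> B" "g \<in> W \<mu>" for b g \<mu>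
    unfolding W_iff
  proof (intro allI)
    fix x xs
    show "\<Theta> x (T b g) xs = (w b x + \<mu> x) * T b g xs"
    proof (cases xs)
      case (Cons y ys)
      have "\<Theta> x (T b g) (y # ys) = ?r (\<sigma> x y) b * g ys + ?r y b * \<Theta> x g ys"
        by (simp add: T_def slot_sum_scale)
      also have "\<dots> = (w b x + \<mu> x) * T b g (y # ys)"
        using that(2) r_\<sigma>[OF that(1)] by (simp add: T_def W_iff algebra_simps)
      finally show ?thesis
        using Cons by simp
    qed (simp add: T_def)
  qed
  have T_span: "T b g \<in> F.span (\<Union>\<mu>. W \<mu>)" if b: "b \<in> B" and "g \<in> F.span (\<Union>\<mu>. W \<mu>)" for b g
  proof -
    have "F.subspace {g. T b g \<in> F.span (\<Union>\<mu>. W \<mu>)}"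
      by (rule F.subspace_preimage_UNIV[OF T_lin F.subspace_span])
    moreover have "(\<Union>\<mu>. W \<mu>) \<subseteq> {g. T b g \<in> F.span (\<Union>\<mu>. W \<mu>)}"
      using T_W[OF b] by (auto intro!: F.span_base)
    ultimately have "F.span (\<Union>\<mu>. W \<mu>) \<subseteq> {g. T b g \<in> F.span (\<Union>\<mu>. W \<mu>)}"
      by (intro F.span_minimal)
    then show ?thesis using that(2) by blast
  qed
  show ?thesis if "f \<in> C p"
    using that
  proof (induction p arbitrary: f)
    case 0
    then have z: "f (y # ys) = 0" for y ys
      using C_length[OF 0] by simp
    then have "\<Theta> x f xs = 0" for x xs
      by (cases xs) simp_all
    then have "f \<in> W (\<lambda>_. 0)"
      by (simp add: W_iff)
    then show ?case
      by (intro F.span_base) blast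
  next
    case (Suc p)
    have "f = (\<Sum>b\<in>B. T b (\<lambda>ys. f (b # ys)))"
    proof
      fix xs
      have s: "(\<Sum>b\<in>B. T b (\<lambda>ys. f (b # ys))) zs = (\<Sum>b\<in>B. T b (\<lambda>ys. f (b # ys)) zs)" for zs
        by (induction B rule: infinite_finite_induct) simp_all
      show "f xs = (\<Sum>b\<in>B. T b (\<lambda>ys. f (b # ys))) xs"
      proof (cases xs)
        case Nil
        then show ?thesis
          using C_length[OF Suc.prems, of "[]"] by (simp add: s T_def)
      next
        case (Cons x ys)
        have "lin_on scale (*) UNIV (\<lambda>x. f (x # ys))"
          by (simp add: lin_on_def C_add_head[OF Suc.prems] C_scale_head[OF Suc.prems])
        moreover have "vector_space ((*) :: 'k \<Rightarrow> 'k \<Rightarrow> 'k)"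
          by unfold_locales (simp_all add: algebra_simps)
        ultimately have "f ((\<Sum>b\<in>B. scale (?r x b) b) # ys) = (\<Sum>b\<in>B. f (scale (?r x b) b # ys))"
          using lin_on_sum[where t = "(*)" and V = UNIV and f = "\<lambda>x. f (x # ys)" and g = "\<lambda>b. scale (?r x b) b" and M = B]
          by simp
        then show ?thesis
          by (simp add: Cons s T_def r_eq C_scale_head[OF Suc.prems])
      qed
    qed
    also have "\<dots> \<in> F.span (\<Union>\<mu>. W \<mu>)"
      using T_span Suc.IH[OF C_tail[OF Suc.prems]] by (intro F.span_sum) blast
    finally show ?case .
  qed
qed

section \<open>Weight components of a cochain\<close>

definition wcomp :: "('s list \<Rightarrow> 'k) \<Rightarrow> ('s \<Rightarrow> 'k) \<Rightarrow> 's list \<Rightarrow> 'k" where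
  "wcomp f = (SOME g. decomposes W f g)"

lemma wcomp_eqI: "decomposes W f g \<Longrightarrow> wcomp f = g"
  unfolding wcomp_def
  by (rule some_equality)
     (auto intro: F.decomposes_unique[OF F.indep_family_wt_space[OF \<Theta>_lin] subspace_W])

lemma decomposes_wcomp: "f \<in> C p \<Longrightarrow> decomposes W f (wcomp f)"
  using F.decomposes_span[OF subspace_W C_span_W, of f p] wcomp_eqI by blast

lemma wcomp_W: "f \<in> C p \<Longrightarrow> wcomp f \<mu> \<in> W \<mu>"
  using decomposesD(1)[OF decomposes_wcomp] .

lemma finite_wcomp: "f \<in> C p \<Longrightarrow> finite {\<mu>. wcomp f \<mu> \<noteq> 0}"
  using decomposesD(2)[OF decomposes_wcomp] .

lemma sum_wcomp: "f \<in> C p \<Longrightarrow> f = (\<Sum>\<mu> | wcomp f \<mu> \<noteq> 0. wcomp f \<mu>)"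
  using decomposesD(3)[OF decomposes_wcomp] .

lemma wcomp_C:
  assumes "f \<in> C p"
  shows "wcomp f \<mu> \<in> C p"
proof (cases "wcomp f \<mu> = 0")
  case True
  then show ?thesis
    using F.subspace_0[OF subspace_C] by simp
next
  case False
  show ?thesis
  proof (rule F.wt_components_closed[where \<Theta> = \<Theta>, OF \<Theta>_lin subspace_C \<Theta>_C finite_wcomp[OF assms]])
    show "sum (wcomp f) {\<mu>. wcomp f \<mu> \<noteq> 0} \<in> C p"
      using sum_wcomp[OF assms] assms by simp
  qed (use False wcomp_W[OF assms] in auto)
qed

lemma wcomp_add: "f \<in> C p \<Longrightarrow> g \<in> C p \<Longrightarrow> wcomp (f + g) \<mu> = wcomp f \<mu> + wcomp g \<mu>"
  using wcomp_eqI[OF F.decomposes_add[OF subspace_W decomposes_wcomp decomposes_wcomp]] by simp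

lemma wcomp_scale: "f \<in> C p \<Longrightarrow> wcomp (\<lambda>xs. c * f xs) \<mu> = (\<lambda>xs. c * wcomp f \<mu> xs)"
  using wcomp_eqI[OF F.decomposes_scale[OF subspace_W decomposes_wcomp]] by simp

lemma wcomp_single: "f \<in> W \<mu> \<Longrightarrow> wcomp f = (\<lambda>\<nu>. if \<nu> = \<mu> then f else 0)"
  using wcomp_eqI[OF F.decomposes_single[where E = W and i = \<mu>, OF subspace_W]] by simp

text \<open>The weight is read off at a list where f does not vanish, so it inherits the way
  \<open>\<sigma> x\<close> depends on x. Since brackets lie in N, every weight that occurs is a
  character.\<close>

lemma weight_add:
  assumes "f \<in> C p" "f \<in> W \<mu>" "f \<noteq> 0"
  shows "\<mu> (x + y) = \<mu> x + \<mu> y"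
    and "\<mu> (scale c x) = c * \<mu> x"
    and "x \<in> N \<Longrightarrow> \<mu> x = 0"
proof -
  obtain xs where xs: "f xs \<noteq> 0"
    using assms(3) by (auto simp: fun_eq_iff)
  have w: "\<Theta> x f xs = \<mu> x * f xs" for x
    using assms(2) by (simp add: W_iff)
  have "\<Theta> (x + y) f xs = \<Theta> x f xs + \<Theta> y f xs"
    using slot_sum_add_op[OF assms(1), of "\<sigma> x" "\<sigma> y" xs] by (simp add: \<sigma>_add_left[abs_def] cong: if_cong)
  then show "\<mu> (x + y) = \<mu> x + \<mu> y"
    using xs by (simp add: w flip: distrib_right)
  have zero: "\<mu> x = 0" if "\<And>v. \<sigma> x v = 0" for x
  proof -
    have "\<Theta> x f xs = slot_sum (\<lambda>_. 0 - 0) f xs"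
      using that by (metis diff_zero ext)
    also have "\<dots> = 0"
      by (subst slot_sum_diff_op[OF assms(1)]) simp
    finally show ?thesis
      using w xs by simp
  qed
  then show "x \<in> N \<Longrightarrow> \<mu> x = 0"
    using \<sigma>_N by blast
  have "slot_sum (\<lambda>v. scale c (\<sigma> x v)) f ys = c * \<Theta> x f ys" for ys
    using assms(1)
  proof (induction ys arbitrary: f p)
    case (Cons y ys)
    show ?case
    proof (cases p)
      case 0
      then have "f (z # zs) = 0" for z zs
        using C_length[OF Cons.prems] by simp
      then show ?thesis by simp
    next
      case (Suc q)
      then show ?thesis
        using Cons.IH[OF C_tail] Cons.prems C_scale_head[OF Cons.prems] by (simp add: distrib_left)
    qed
  qed simp
  then have "\<Theta> (scale c x) f xs = c * \<Theta> x f xs"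
    by (simp add: \<sigma>_scale_left[abs_def])
  then show "\<mu> (scale c x) = c * \<mu> x"
    using xs by (simp add: w)
qed

subsection \<open>Cocycles and coboundaries\<close>

definition Z :: "('s \<Rightarrow> 's \<Rightarrow> 's) \<Rightarrow> ('s \<Rightarrow> 'k) \<Rightarrow> nat \<Rightarrow> ('s list \<Rightarrow> 'k) set" where
  "Z b l p = {f \<in> C p. cob b l f = 0}"

definition Bd :: "('s \<Rightarrow> 's \<Rightarrow> 's) \<Rightarrow> ('s \<Rightarrow> 'k) \<Rightarrow> nat \<Rightarrow> ('s list \<Rightarrow> 'k) set" where
  "Bd b l p = (case p of 0 \<Rightarrow> {0} | Suc q \<Rightarrow> cob b l ` C q)"

lemma subspace_Z: "F.subspace (Z b l p)"
  using subspace_C F.lin_on_self_zero[OF cob_lin F.subspace_UNIV]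
  by (auto simp: Z_def F.subspace_def lin_onD_add[OF cob_lin] lin_onD_scale[OF cob_lin])

lemma subspace_Bd: "F.subspace (Bd b l p)"
proof (cases p)
  case 0
  then show ?thesis by (simp add: Bd_def F.subspace_def zero_fun_def)
next
  case (Suc q)
  show ?thesis
  proof (rule F.subspaceI)
    show "0 \<in> Bd b l p"
      using F.lin_on_self_zero[OF cob_lin F.subspace_UNIV] F.subspace_0[OF subspace_C]
      by (auto simp: Bd_def Suc intro!: image_eqI[of _ _ 0])
    show "x + y \<in> Bd b l p" if xy: "x \<in> Bd b l p" "y \<in> Bd b l p" for x y
    proof -
      obtain f g where "x = cob b l f" "f \<in> C q" "y = cob b l g" "g \<in> C q"
        using xy by (auto simp: Bd_def Suc)
      then show ?thesis
        using F.subspace_add[OF subspace_C, of f q g]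
        by (auto simp: Bd_def Suc lin_onD_add[OF cob_lin] intro!: image_eqI[of _ _ "f + g"])
    qed
    show "(\<lambda>xs. c * x xs) \<in> Bd b l p" if x: "x \<in> Bd b l p" for c x
    proof -
      obtain f where "x = cob b l f" "f \<in> C q"
        using x by (auto simp: Bd_def Suc)
      then show ?thesis
        using F.subspace_scale[OF subspace_C, of f q c] lin_onD_scale[OF cob_lin, of f b l c]
        by (auto simp: Bd_def Suc intro!: image_eqI[of _ _ "\<lambda>xs. c * f xs"])
    qed
  qed
qed

section \<open>Cartan's homotopy and acyclicity\<close>

definition character :: "('s \<Rightarrow> 'k) \<Rightarrow> bool" where
  "character l \<longleftrightarrow> (\<forall>x y. l (x + y) = l x + l y) \<and> (\<forall>c x. l (scale c x) = c * l x) \<and> (\<forall>x y. l (br x y) = 0)"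

text \<open>The recursion for \<open>cob\<close> at the list \<open>x # xs\<close> is Cartan's
  formula, and its left side vanishes for a cocycle. The primitive is the contraction of f with
  x.\<close>

lemma homotopy:
  assumes f: "f \<in> Z br l p"
  shows "(\<lambda>xs. l x * f xs - slot_sum (br x) f xs) \<in> Bd br l p"
proof -
  have "cob br l f (x # xs) = 0" for xs
    using f by (simp add: Z_def)
  then have eq: "l x * f xs - slot_sum (br x) f xs = cob br l (\<lambda>ys. f (x # ys)) xs" for xs
    by (simp add: algebra_simps)
  have C: "f \<in> C p"
    using f by (simp add: Z_def)
  show ?thesis
  proof (cases p)
    case 0
    then have "(\<lambda>ys. f (x # ys)) = (\<lambda>_. 0)"
      using C_length[OF C] by auto
    then show ?thesis
      using 0 by (simp add: eq Bd_def zero_fun_def)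
  next
    case (Suc q)
    then have "(\<lambda>ys. f (x # ys)) \<in> C q"
      using C C_tail by simp
    then show ?thesis
      using Suc by (simp add: eq Bd_def)
  qed
qed

text \<open>By \<open>homotopy\<close> the action of x sends cocycles to coboundaries, while by
  \<open>eq\<close> it is the scalar c minus a nilpotent operator. Hence f is, up to a coboundary,
  1/c times \<open>slot_sum D f\<close>, a cocycle killed by a smaller power. The predicate P
  selects the part of the complex where \<open>eq\<close> holds.\<close>

lemma acyclic:
  assumes l: "character l" and c: "c \<noteq> 0"
    and eq: "\<And>g xs. g \<in> C p \<Longrightarrow> P g \<Longrightarrow> l x * g xs - slot_sum (br x) g xs = c * g xs - slot_sum D g xs"
    and P: "\<And>g. g \<in> C p \<Longrightarrow> P g \<Longrightarrow> P (slot_sum D g)"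
    and D: "lin_on scale scale UNIV D" and nil: "\<And>v. \<exists>n. (D ^^ n) v = 0"
    and f: "f \<in> Z br l p" "P f"
  shows "f \<in> Bd br l p"
proof -
  obtain k where k: "D ^^ k = (\<lambda>_. 0)"
    using locally_nilpotent_funpow[OF fin_dim_L D nil] by blast
  have "f \<in> Bd br l p" if "(slot_sum D ^^ n) f = (\<lambda>_. 0)" "f \<in> Z br l p" "P f" for n f
    using that
  proof (induction n arbitrary: f)
    case 0
    then have "f = 0" by (simp add: zero_fun_def)
    then show ?case
      by (simp only: F.subspace_0[OF subspace_Bd])
  next
    case (Suc n)
    have fC: "f \<in> C p" and f0: "cob br l f = (\<lambda>_. 0)"
      using Suc.prems(2) by (simp_all add: Z_def zero_fun_def)
    let ?t = "\<lambda>xs. l x * f xs - slot_sum (br x) f xs"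
    have t: "?t \<in> Bd br l p"
      by (rule homotopy[OF Suc.prems(2)])
    have sD: "slot_sum D f = (\<lambda>xs. (c - l x) * f xs + slot_sum (br x) f xs)"
      using eq[OF fC Suc.prems(3)] by (simp add: fun_eq_iff algebra_simps)
    have "cob br l (slot_sum (br x) f) xs = slot_sum (br x) (cob br l f) xs" for xs
      using l fC by (intro cob_slot_sum[where p = p] br_leibniz lin_on_br br_add_left) (simp_all add: character_def)
    then have "cob br l (slot_sum D f) = 0"
      unfolding sD by (simp add: cob_add cob_scale f0 fun_eq_iff)
    then have "slot_sum D f \<in> Z br l p"
      using slot_sum_C[OF D fC] by (simp add: Z_def)
    moreover have "(slot_sum D ^^ n) (slot_sum D f) = (\<lambda>_. 0)"
      using Suc.prems(1) by (simp add: funpow_swap1)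
    ultimately have "slot_sum D f \<in> Bd br l p"
      using Suc.IH P[OF fC Suc.prems(3)] by blast
    then have "(\<lambda>xs. inverse c * (?t + slot_sum D f) xs) \<in> Bd br l p"
      using t by (intro F.subspace_scale[OF subspace_Bd] F.subspace_add[OF subspace_Bd])
    moreover have "(\<lambda>xs. inverse c * (?t + slot_sum D f) xs) = f"
      using c by (simp add: sD fun_eq_iff algebra_simps)
    ultimately show ?case by simp
  qed
  moreover have "f \<in> C p"
    using f(1) by (simp add: Z_def)
  ultimately show ?thesis
    using slot_sum_nilpotent[OF D k] f by blast
qed

lemma cob_W:
  assumes "\<And>x y z. \<sigma> x (b y z) = b (\<sigma> x y) z + b y (\<sigma> x z)" "\<And>x. x \<in> N \<Longrightarrow> l x = 0"
    and "\<And>x. lin_on scale scale UNIV (b x)" "\<And>x y z. b (x + y) z = b x z + b y z"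
    and f: "f \<in> C p" "f \<in> W \<mu>"
  shows "cob b l f \<in> W \<mu>"
proof -
  have "\<Theta> x (cob b l f) xs = \<mu> x * cob b l f xs" for x xs
  proof -
    have "\<Theta> x (cob b l f) xs = cob b l (\<Theta> x f) xs"
      using assms \<sigma>_in_N by (intro cob_slot_sum[symmetric, where p = p]) simp_all
    also have "\<Theta> x f = (\<lambda>ys. \<mu> x * f ys)"
      using f(2) by (simp add: W_iff fun_eq_iff)
    finally show ?thesis
      by (simp add: cob_scale)
  qed
  then show ?thesis by (simp add: W_iff)
qed

lemma cob_br_W: "(\<And>x. x \<in> N \<Longrightarrow> l x = 0) \<Longrightarrow> f \<in> C p \<Longrightarrow> f \<in> W \<mu> \<Longrightarrow> cob br l f \<in> W \<mu>"
  by (rule cob_W[OF \<sigma>_derivation _ lin_on_br br_add_left])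

lemma nbr_derivation: "\<sigma> x (nbr y z) = nbr (\<sigma> x y) z + nbr y (\<sigma> x z)"
  using \<sigma>_commute[of x y z] \<sigma>_commute[of x z y]
  by (simp add: nbr_def \<sigma>_add_right \<sigma>_diff_right \<sigma>_derivation \<sigma>_N[OF \<sigma>_in_N])

lemma cob_nbr_W: "f \<in> C p \<Longrightarrow> f \<in> W \<mu> \<Longrightarrow> cob nbr (\<lambda>_. 0) f \<in> W \<mu>"
proof (rule cob_W[OF nbr_derivation])
  show "lin_on scale scale UNIV (nbr x)" for x
    using lie_algebra.br_linear_right[OF lie_algebra_nbr] by simp
  show "nbr (x + y) z = nbr x z + nbr y z" for x y z
    using lin_onD_add[OF lie_algebra.br_linear_left[OF lie_algebra_nbr]] by simp
qed simp_all

text \<open>The alternating sum of the \<open>\<Theta> y f\<close> that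
  \<open>cob_deformation\<close> adds becomes, on weight \<mu>, the character term split off in
  \<open>cob_split\<close>.\<close>

lemma cob_nbr_eq: "f \<in> C p \<Longrightarrow> f \<in> W \<mu> \<Longrightarrow> cob nbr (\<lambda>_. 0) f = cob br \<mu> f"
proof
  fix xs assume f: "f \<in> C p" "f \<in> W \<mu>"
  have "(\<lambda>y. \<Theta> y f) = (\<lambda>y ys. \<mu> y * f ys)"
    using f(2) by (simp add: W_iff fun_eq_iff)
  then show "cob nbr (\<lambda>_. 0) f xs = cob br \<mu> f xs"
    using cob_deformation[OF f(1), of br \<sigma> xs] cob_split[of br \<mu> f xs] by (simp add: nbr_def[abs_def])
qed

lemma wcomp_cob:
  assumes "\<And>f \<mu>. f \<in> C p \<Longrightarrow> f \<in> W \<mu> \<Longrightarrow> cob b l f \<in> W \<mu>" and f: "f \<in> C p"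
  shows "wcomp (cob b l f) = (\<lambda>\<mu>. cob b l (wcomp f \<mu>))"
proof (rule wcomp_eqI)
  have c0: "cob b l 0 = (0 :: 's list \<Rightarrow> 'k)"
    by (rule F.lin_on_self_zero[OF cob_lin F.subspace_UNIV])
  have sub: "{\<mu>. cob b l (wcomp f \<mu>) \<noteq> 0} \<subseteq> {\<mu>. wcomp f \<mu> \<noteq> 0}"
    using c0 by force
  have "cob b l f = cob b l (\<Sum>\<mu> | wcomp f \<mu> \<noteq> 0. wcomp f \<mu>)"
    using sum_wcomp[OF f] by simp
  also have "\<dots> = (\<Sum>\<mu> | wcomp f \<mu> \<noteq> 0. cob b l (wcomp f \<mu>))"
    by (rule F.lin_on_sum[OF cob_lin F.vector_space_axioms F.subspace_UNIV UNIV_I])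
  finally have "cob b l f = Sum_any (\<lambda>\<mu>. cob b l (wcomp f \<mu>))"
    using Sum_any.expand_superset[OF finite_wcomp[OF f] sub] by simp
  then show "decomposes W (cob b l f) (\<lambda>\<mu>. cob b l (wcomp f \<mu>))"
    using assms(1)[OF wcomp_C[OF f] wcomp_W[OF f]] finite_subset[OF sub finite_wcomp[OF f]]
    by (simp add: decomposes_def)
qed

lemma wcomp_zero: "wcomp 0 = (\<lambda>_. 0)"
  using F.subspace_0[OF subspace_W] by (intro wcomp_eqI) (simp add: decomposes_def)

lemma Z_wcomp_cob:
  assumes "\<And>f \<mu>. f \<in> C p \<Longrightarrow> f \<in> W \<mu> \<Longrightarrow> cob b l f \<in> W \<mu>" and f: "f \<in> Z b l p"
  shows "wcomp f \<mu> \<in> Z b l p"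
proof -
  have fC: "f \<in> C p" and f0: "cob b l f = 0"
    using f by (simp_all add: Z_def)
  have "cob b l (wcomp f \<mu>) = 0"
    using fun_cong[OF wcomp_cob[OF assms(1) fC], of \<mu>] by (simp add: f0 wcomp_zero)
  then show ?thesis
    using wcomp_C[OF fC] by (simp add: Z_def)
qed

text \<open>Components of weight other than l turn out to be coboundaries, so every class has a
  representative of weight l. The proof needs two cases because a character may be nonzero on
  N.\<close>

lemma diff_wcomp_Bd:
  assumes l: "character l" and f: "f \<in> Z br l p"
  shows "f - wcomp f l \<in> Bd br l p"
proof -
  have fC: "f \<in> C p"
    using f by (simp add: Z_def)
  show ?thesis
  proof (cases "\<forall>x\<in>N. l x = 0")
    case True
    have cW: "cob br l g \<in> W \<mu>" if "g \<in> C p" "g \<in> W \<mu>" for g \<mu>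
      using cob_br_W[OF _ that, of l] True by blast
    have "wcomp f \<mu> \<in> Bd br l p" if "\<mu> \<noteq> l" for \<mu>
    proof (cases "wcomp f \<mu> = 0")
      case True
      then show ?thesis
        using F.subspace_0[OF subspace_Bd] by simp
    next
      case False
      note w = weight_add[OF wcomp_C[OF fC] wcomp_W[OF fC] False]
      obtain y where y: "\<mu> y \<noteq> l y" using \<open>\<mu> \<noteq> l\<close> by blast
      \<comment> \<open>Both \<mu> and l vanish on N, so they differ already at an element of A. For
        such an element ad x - \<open>\<sigma> x\<close> is nilpotent and commutes with every
        \<open>\<sigma> z\<close>, so it preserves the weight space.\<close>
      let ?x = "pr y"
      have "\<mu> (?x + (y - ?x)) = \<mu> ?x + 0"
        using w(1)[of ?x "y - ?x"] w(3)[OF diff_pr_in_N] by metis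
      moreover have "l (?x + (y - ?x)) = l ?x + 0"
        using l True diff_pr_in_N[of y] unfolding character_def by metis
      ultimately have x: "l ?x - \<mu> ?x \<noteq> 0"
        using y by simp
      let ?D = "\<lambda>v. br ?x v - \<sigma> ?x v"
      have D: "lin_on scale scale UNIV ?D"
        by (simp add: lin_on_def br_add_right br_scale_right \<sigma>_add_right \<sigma>_scale_right scale_right_diff_distrib)
      show ?thesis
      proof (rule acyclic[where P = "\<lambda>g. g \<in> W \<mu>", OF l x _ _ D])
        show "l ?x * g xs - slot_sum (br ?x) g xs = (l ?x - \<mu> ?x) * g xs - slot_sum ?D g xs"
          if "g \<in> C p" "g \<in> W \<mu>" for g xs
          using that(2) slot_sum_diff_op[OF that(1), of "br ?x" "\<sigma> ?x"] by (simp add: W_iff algebra_simps)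
        show "slot_sum ?D g \<in> W \<mu>" if "g \<in> C p" "g \<in> W \<mu>" for g
        proof -
          have "\<sigma> z (?D v) = ?D (\<sigma> z v)" for z v
            by (simp add: \<sigma>_diff_right \<sigma>_br_A[OF pr_in_A] \<sigma>_commute[of z])
          then have "\<Theta> z (slot_sum ?D g) = slot_sum ?D (\<Theta> z g)" for z
            by (rule slot_sum_commute[OF that(1)])
          moreover have "\<Theta> z g = (\<lambda>xs. \<mu> z * g xs)" for z
            using that(2) by (simp add: W_iff fun_eq_iff)
          ultimately show ?thesis
            by (simp add: W_iff slot_sum_scale)
        qed
        show "\<exists>n. (?D ^^ n) v = 0" for v
          by (rule nilpotent_A[OF pr_in_A])
        show "wcomp f \<mu> \<in> Z br l p"
          by (rule Z_wcomp_cob[OF cW f])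
      qed (rule wcomp_W[OF fC])
    qed
    then have "(\<Sum>\<mu> \<in> {\<mu>. wcomp f \<mu> \<noteq> 0} - {l}. wcomp f \<mu>) \<in> Bd br l p"
      by (intro F.subspace_sum[OF subspace_Bd]) simp
    moreover have "f - wcomp f l = (\<Sum>\<mu> \<in> {\<mu>. wcomp f \<mu> \<noteq> 0} - {l}. wcomp f \<mu>)"
    proof -
      have "(\<Sum>\<mu> | wcomp f \<mu> \<noteq> 0. wcomp f \<mu>)
          = wcomp f l + (\<Sum>\<mu> \<in> {\<mu>. wcomp f \<mu> \<noteq> 0} - {l}. wcomp f \<mu>)"
        using finite_wcomp[OF fC] by (cases "wcomp f l = 0") (simp_all add: sum.remove)
      from trans[OF sum_wcomp[OF fC] this] show ?thesis
        unfolding diff_eq_eq by (subst add.commute)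
    qed
    ultimately show ?thesis by simp
  next
    case False
    \<comment> \<open>As ad x is nilpotent for x in N, l x is the only eigenvalue of x on cochains
      and the whole complex is acyclic. Moreover l is no weight, so the component of weight l is
      0.\<close>
    then obtain x where x: "x \<in> N" "l x \<noteq> 0" by blast
    have "f \<in> Bd br l p"
      by (rule acyclic[where P = "\<lambda>_. True" and D = "br x", OF l x(2) _ _ lin_on_br nilpotent_N[OF x(1)] f])
        simp_all
    moreover have "wcomp f l = 0"
      using weight_add(3)[OF wcomp_C[OF fC] wcomp_W[OF fC] _ x(1)] x(2) by blast
    ultimately show ?thesis by simp
  qed
qed

lemma wcomp_Z_nbr:
  assumes g: "g \<in> Z nbr (\<lambda>_. 0) p"
  shows "wcomp g l \<in> Z br l p"
proof -
  have gC: "g \<in> C p"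
    using g by (simp add: Z_def)
  have "wcomp g l \<in> Z nbr (\<lambda>_. 0) p"
    by (rule Z_wcomp_cob[OF cob_nbr_W g])
  then show ?thesis
    using cob_nbr_eq[OF wcomp_C[OF gC] wcomp_W[OF gC]] by (simp add: Z_def)
qed

lemma wcomp_Z_br:
  assumes l: "character l" and f: "f \<in> Z br l p"
  shows "wcomp f l \<in> Z nbr (\<lambda>_. 0) p"
proof (cases "wcomp f l = 0")
  case True
  then show ?thesis
    using F.subspace_0[OF subspace_Z] by simp
next
  case False
  have fC: "f \<in> C p"
    using f by (simp add: Z_def)
  have "l x = 0" if "x \<in> N" for x
    using weight_add(3)[OF wcomp_C[OF fC] wcomp_W[OF fC] False that] .
  then have "wcomp f l \<in> Z br l p"
    by (intro Z_wcomp_cob[OF _ f] cob_br_W)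
  then show ?thesis
    using cob_nbr_eq[OF wcomp_C[OF fC] wcomp_W[OF fC]] by (simp add: Z_def)
qed

lemma wcomp_Bd_nbr:
  assumes "g \<in> Bd nbr (\<lambda>_. 0) p"
  shows "wcomp g l \<in> Bd br l p"
proof (cases p)
  case 0
  then show ?thesis
    using assms by (simp add: Bd_def wcomp_zero)
next
  case (Suc q)
  then obtain h where h: "g = cob nbr (\<lambda>_. 0) h" "h \<in> C q"
    using assms by (auto simp: Bd_def)
  have "wcomp g l = cob br l (wcomp h l)"
    using wcomp_cob[OF cob_nbr_W h(2)] cob_nbr_eq[OF wcomp_C[OF h(2)] wcomp_W[OF h(2)]] by (simp add: h(1))
  then show ?thesis
    using wcomp_C[OF h(2)] by (simp add: Bd_def Suc)
qed

lemma Bd_nbrI: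
  assumes g: "g \<in> C p" and B: "\<And>\<mu>. wcomp g \<mu> \<noteq> 0 \<Longrightarrow> wcomp g \<mu> \<in> Bd br \<mu> p"
  shows "g \<in> Bd nbr (\<lambda>_. 0) p"
proof -
  have "wcomp g \<mu> \<in> Bd nbr (\<lambda>_. 0) p" if nz: "wcomp g \<mu> \<noteq> 0" for \<mu>
  proof (cases p)
    case 0
    then show ?thesis
      using B[OF nz] by (simp add: Bd_def)
  next
    case (Suc q)
    then obtain h where h: "wcomp g \<mu> = cob br \<mu> h" "h \<in> C q"
      using B[OF nz] by (auto simp: Bd_def)
    have "\<mu> x = 0" if "x \<in> N" for x
      using weight_add(3)[OF wcomp_C[OF g] wcomp_W[OF g] nz that] .
    \<comment> \<open>The primitive h may be replaced by its component of weight \<mu>, on which the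
      two coboundaries agree.\<close>
    then have "wcomp (cob br \<mu> h) = (\<lambda>\<nu>. cob br \<mu> (wcomp h \<nu>))"
      using cob_br_W by (intro wcomp_cob[OF _ h(2)]) blast
    then have "wcomp (wcomp g \<mu>) \<mu> = cob br \<mu> (wcomp h \<mu>)"
      using h(1) by simp
    moreover have "wcomp (wcomp g \<mu>) \<mu> = wcomp g \<mu>"
      using wcomp_single[OF wcomp_W[OF g]] by simp
    ultimately have "wcomp g \<mu> = cob nbr (\<lambda>_. 0) (wcomp h \<mu>)"
      using cob_nbr_eq[OF wcomp_C[OF h(2)] wcomp_W[OF h(2)]] by simp
    then show ?thesis
      using wcomp_C[OF h(2)] by (simp add: Bd_def Suc)
  qed
  then have "(\<Sum>\<mu> | wcomp g \<mu> \<noteq> 0. wcomp g \<mu>) \<in> Bd nbr (\<lambda>_. 0) p"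
    by (intro F.subspace_sum[OF subspace_Bd]) simp
  then show ?thesis
    using sum_wcomp[OF g] by simp
qed

end

section \<open>Quotient spaces and direct sums\<close>

text \<open>Spares the module axioms for a direct sum of quotients: they are carried over from the
  single quotient with which it is in bijection.\<close>

lemma vectorspace_transport:
  assumes "vectorspace K V" and bij: "bij_betw f (carrier V) (carrier W)" and zero: "f \<zero>\<^bsub>V\<^esub> = \<zero>\<^bsub>W\<^esub>"
    and add: "\<And>x y. x \<in> carrier V \<Longrightarrow> y \<in> carrier V \<Longrightarrow> f (x \<oplus>\<^bsub>V\<^esub> y) = f x \<oplus>\<^bsub>W\<^esub> f y"
    and smult: "\<And>c x. c \<in> carrier K \<Longrightarrow> x \<in> carrier V \<Longrightarrow> f (c \<odot>\<^bsub>V\<^esub> x) = c \<odot>\<^bsub>W\<^esub> f x"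
  shows "vectorspace K W"
proof -
  interpret V: vectorspace K V by fact
  have W: "carrier W = f ` carrier V"
    using bij by (auto simp: bij_betw_def)
  have neg: "f x \<oplus>\<^bsub>W\<^esub> f (\<ominus>\<^bsub>V\<^esub> x) = \<zero>\<^bsub>W\<^esub>" if "x \<in> carrier V" for x
    using that add[of x "\<ominus>\<^bsub>V\<^esub> x"] zero V.r_neg[of x] by simp
  have "module K W"
  proof (rule module_criteria)
    show "cring K" by (rule V.R.cring_axioms)
    show "\<zero>\<^bsub>W\<^esub> \<in> carrier W"
      unfolding W zero[symmetric] by (intro imageI) simp
    show "\<forall>v w. v \<in> carrier W \<and> w \<in> carrier W \<longrightarrow> v \<oplus>\<^bsub>W\<^esub> w \<in> carrier W"
      unfolding W by (auto simp flip: add)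
    show "\<forall>v\<in>carrier W. \<exists>neg_v\<in>carrier W. v \<oplus>\<^bsub>W\<^esub> neg_v = \<zero>\<^bsub>W\<^esub>"
      unfolding W using neg by (auto intro!: bexI[of _ "\<ominus>\<^bsub>V\<^esub> _"])
    show "\<forall>c v. c \<in> carrier K \<and> v \<in> carrier W \<longrightarrow> c \<odot>\<^bsub>W\<^esub> v \<in> carrier W"
      unfolding W by (auto simp flip: smult)
    show "\<forall>v w. v \<in> carrier W \<and> w \<in> carrier W \<longrightarrow> v \<oplus>\<^bsub>W\<^esub> w = w \<oplus>\<^bsub>W\<^esub> v"
      unfolding W by (auto simp: V.a_comm simp flip: add)
    show "\<forall>v w x. v \<in> carrier W \<and> w \<in> carrier W \<and> x \<in> carrier W \<longrightarrow>
        v \<oplus>\<^bsub>W\<^esub> w \<oplus>\<^bsub>W\<^esub> x = v \<oplus>\<^bsub>W\<^esub> (w \<oplus>\<^bsub>W\<^esub> x)"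
      unfolding W by (auto simp: V.a_assoc simp flip: add)
    show "\<forall>v\<in>carrier W. v \<oplus>\<^bsub>W\<^esub> \<zero>\<^bsub>W\<^esub> = v"
      unfolding W by (auto simp flip: add zero)
    show "\<forall>a b v. a \<in> carrier K \<and> b \<in> carrier K \<and> v \<in> carrier W \<longrightarrow>
        (a \<otimes>\<^bsub>K\<^esub> b) \<odot>\<^bsub>W\<^esub> v = a \<odot>\<^bsub>W\<^esub> (b \<odot>\<^bsub>W\<^esub> v)"
      unfolding W by (auto simp: V.smult_assoc1 simp flip: smult)
    show "\<forall>v\<in>carrier W. \<one>\<^bsub>K\<^esub> \<odot>\<^bsub>W\<^esub> v = v"
      unfolding W by (auto simp flip: smult)
    show "\<forall>a b v. a \<in> carrier K \<and> b \<in> carrier K \<and> v \<in> carrier W \<longrightarrow>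
        (a \<oplus>\<^bsub>K\<^esub> b) \<odot>\<^bsub>W\<^esub> v = a \<odot>\<^bsub>W\<^esub> v \<oplus>\<^bsub>W\<^esub> b \<odot>\<^bsub>W\<^esub> v"
      unfolding W by (auto simp: V.smult_l_distr simp flip: smult add)
    show "\<forall>a v w. a \<in> carrier K \<and> v \<in> carrier W \<and> w \<in> carrier W \<longrightarrow>
        a \<odot>\<^bsub>W\<^esub> (v \<oplus>\<^bsub>W\<^esub> w) = a \<odot>\<^bsub>W\<^esub> v \<oplus>\<^bsub>W\<^esub> a \<odot>\<^bsub>W\<^esub> w"
      unfolding W by (auto simp: V.smult_r_distr simp flip: smult add)
  qed
  then show ?thesis
    using V.field_axioms by (simp add: vectorspace_def)
qed

text \<open>The equality also holds in the infinite dimensional case, where \<open>dim\<close> has an unspecified value that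
  does not depend on the space.\<close>

lemma vectorspace_dim_transport:
  assumes V: "vectorspace K V" and bij: "bij_betw f (carrier V) (carrier W)" and zero: "f \<zero>\<^bsub>V\<^esub> = \<zero>\<^bsub>W\<^esub>"
    and add: "\<And>x y. x \<in> carrier V \<Longrightarrow> y \<in> carrier V \<Longrightarrow> f (x \<oplus>\<^bsub>V\<^esub> y) = f x \<oplus>\<^bsub>W\<^esub> f y"
    and smult: "\<And>c x. c \<in> carrier K \<Longrightarrow> x \<in> carrier V \<Longrightarrow> f (c \<odot>\<^bsub>V\<^esub> x) = c \<odot>\<^bsub>W\<^esub> f x"
  shows "vectorspace.dim K W = vectorspace.dim K V"
proof -
  interpret V: vectorspace K V by fact
  interpret W: vectorspace K W
    by (rule vectorspace_transport[OF V bij zero add smult])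
  have img: "f ` carrier V = carrier W" and inj: "inj_on f (carrier V)"
    using bij by (auto simp: bij_betw_def)
  have fV: "f \<in> carrier V \<rightarrow> carrier W"
    using img by blast
  have "f \<in> LinearCombinations.module_hom K V W"
    unfolding LinearCombinations.module_hom_def using fV by (intro CollectI conjI allI impI add smult) simp_all
  then interpret f: linear_map K V W f
    by unfold_locales
  let ?g = "inv_into (carrier V) f"
  have gV: "?g y \<in> carrier V" if "y \<in> carrier W" for y
    using that img inv_into_into[of y f "carrier V"] by simp
  have fg: "f (?g y) = y" if "y \<in> carrier W" for y
    using that img by (intro f_inv_into_f) simp
  have gf: "?g (f x) = x" if "x \<in> carrier V" for x
    using that inj by simp
  have g_add: "?g (x \<oplus>\<^bsub>W\<^esub> y) = ?g x \<oplus>\<^bsub>V\<^esub> ?g y" if "x \<in> carrier W" "y \<in> carrier W" for x y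
    using gf[of "?g x \<oplus>\<^bsub>V\<^esub> ?g y"] that by (simp add: add gV fg)
  have g_smult: "?g (c \<odot>\<^bsub>W\<^esub> x) = c \<odot>\<^bsub>V\<^esub> ?g x" if "c \<in> carrier K" "x \<in> carrier W" for c x
    using gf[of "c \<odot>\<^bsub>V\<^esub> ?g x"] that by (simp add: smult gV fg)
  have "?g \<in> LinearCombinations.module_hom K W V"
    unfolding LinearCombinations.module_hom_def by (intro CollectI conjI allI impI g_add g_smult) (simp_all add: gV)
  then interpret g: linear_map K W V ?g
    by unfold_locales
  have "?g ` carrier W = carrier V"
    unfolding img[symmetric] by (rule inv_into_image_cancel[OF inj subset_refl])
  then have fin: "V.fin_dim \<longleftrightarrow> W.fin_dim"
    using f.surj_fin_dim[OF _ img] g.surj_fin_dim by blast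
  show ?thesis
  proof (cases "V.fin_dim")
    case True
    then show ?thesis
      using f.dim_eq[OF True inj img] by simp
  next
    case False
    have "(\<exists>A. finite A \<and> card A = n \<and> A \<subseteq> carrier V \<and> V.gen_set A) = False" for n
      using False unfolding V.fin_dim_def by auto
    moreover have "(\<exists>A. finite A \<and> card A = n \<and> A \<subseteq> carrier W \<and> W.gen_set A) = False" for n
      using False unfolding fin W.fin_dim_def by auto
    ultimately show ?thesis
      unfolding V.dim_def W.dim_def by (simp only:)
  qed
qed

context linear_space
begin

definition coset :: "'v set \<Rightarrow> 'v \<Rightarrow> 'v set" where
  "coset B z = (\<lambda>b. z + b) ` B"

lemma carrier_quotient_space: "carrier (quotient_space scale Z B) = coset B ` Z"
  by (auto simp: quotient_space_def coset_def)

lemma zero_quotient_space: "\<zero>\<^bsub>quotient_space scale Z B\<^esub> = coset B 0"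
  by (simp add: quotient_space_def coset_def)

context
  fixes B
  assumes B: "subspace B"
begin

lemma coset_eq_iff: "coset B z = coset B w \<longleftrightarrow> z - w \<in> B"
proof
  assume "coset B z = coset B w"
  moreover have "z + 0 \<in> coset B z"
    unfolding coset_def using subspace_0[OF B] by blast
  ultimately obtain b where "b \<in> B" "z + 0 = w + b"
    by (auto simp: coset_def)
  then show "z - w \<in> B" by simp
next
  have sub: "coset B z \<subseteq> coset B w" if "z - w \<in> B" for z w
  proof
    fix x assume "x \<in> coset B z"
    then obtain b where "b \<in> B" "x = z + b"
      by (auto simp: coset_def)
    then have "(z - w) + b \<in> B" "x = w + ((z - w) + b)"
      using that subspace_add[OF B] by simp_all
    then show "x \<in> coset B w"
      unfolding coset_def by blast
  qed
  assume *: "z - w \<in> B"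
  then have "w - z \<in> B"
    using subspace_neg[OF B, of "z - w"] by simp
  then show "coset B z = coset B w"
    using sub * by blast
qed

lemma add_quotient_space: "coset B z \<oplus>\<^bsub>quotient_space scale Z B\<^esub> coset B w = coset B (z + w)"
proof -
  have "{c + d |c d. c \<in> coset B z \<and> d \<in> coset B w} = coset B (z + w)"
  proof
    show "{c + d |c d. c \<in> coset B z \<and> d \<in> coset B w} \<subseteq> coset B (z + w)"
    proof clarify
      fix c d assume "c \<in> coset B z" "d \<in> coset B w"
      then obtain a b where "a \<in> B" "b \<in> B" "c = z + a" "d = w + b"
        by (auto simp: coset_def)
      then show "c + d \<in> coset B (z + w)"
        unfolding coset_def using subspace_add[OF B] by (intro image_eqI[of _ _ "a + b"]) (auto simp: ac_simps)
    qed
    show "coset B (z + w) \<subseteq> {c + d |c d. c \<in> coset B z \<and> d \<in> coset B w}"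
    proof
      fix x assume "x \<in> coset B (z + w)"
      then obtain b where b: "b \<in> B" "x = z + w + b"
        by (auto simp: coset_def)
      have "z + 0 \<in> coset B z" "w + b \<in> coset B w"
        unfolding coset_def using b(1) subspace_0[OF B] by blast+
      moreover have "x = (z + 0) + (w + b)"
        using b(2) by (simp add: ac_simps)
      ultimately show "x \<in> {c + d |c d. c \<in> coset B z \<and> d \<in> coset B w}" by blast
    qed
  qed
  then show ?thesis
    by (simp add: quotient_space_def)
qed

lemma smult_quotient_space: "a \<odot>\<^bsub>quotient_space scale Z B\<^esub> coset B z = coset B (scale a z)"
proof -
  have "{scale a c + b |c b. c \<in> coset B z \<and> b \<in> B} = coset B (scale a z)"
  proof
    show "{scale a c + b |c b. c \<in> coset B z \<and> b \<in> B} \<subseteq> coset B (scale a z)"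
    proof clarify
      fix c b assume "c \<in> coset B z" "b \<in> B"
      then obtain d where "d \<in> B" "c = z + d" "b \<in> B"
        by (auto simp: coset_def)
      then show "scale a c + b \<in> coset B (scale a z)"
        unfolding coset_def using subspace_add[OF B] subspace_scale[OF B]
        by (intro image_eqI[of _ _ "scale a d + b"]) (auto simp: scale_right_distrib ac_simps)
    qed
    show "coset B (scale a z) \<subseteq> {scale a c + b |c b. c \<in> coset B z \<and> b \<in> B}"
    proof
      fix x assume "x \<in> coset B (scale a z)"
      then obtain b where b: "b \<in> B" "x = scale a (z + 0) + b"
        by (auto simp: coset_def)
      have "z + 0 \<in> coset B z"
        unfolding coset_def using subspace_0[OF B] by blast
      then show "x \<in> {scale a c + b |c b. c \<in> coset B z \<and> b \<in> B}"
        using b by blast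
    qed
  qed
  then show ?thesis
    by (simp add: quotient_space_def)
qed

lemma vectorspace_quotient_space:
  assumes Z: "subspace Z"
  shows "vectorspace class_ring (quotient_space scale Z B)"
proof -
  note simps = carrier_quotient_space zero_quotient_space add_quotient_space smult_quotient_space
  have cl: "0 \<in> Z" "\<And>x y. x \<in> Z \<Longrightarrow> y \<in> Z \<Longrightarrow> x + y \<in> Z" "\<And>c x. x \<in> Z \<Longrightarrow> scale c x \<in> Z"
    "\<And>x. x \<in> Z \<Longrightarrow> - x \<in> Z"
    using Z subspace_0 subspace_add subspace_scale subspace_neg by blast+
  have "module class_ring (quotient_space scale Z B)"
  proof (rule module_criteria)
    show "cring (class_ring :: 'k ring)"
      using class_field field.axioms(1) domain.axioms(1) by blast
    show "\<forall>v\<in>carrier (quotient_space scale Z B). \<exists>neg_v\<in>carrier (quotient_space scale Z B).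
        v \<oplus>\<^bsub>quotient_space scale Z B\<^esub> neg_v = \<zero>\<^bsub>quotient_space scale Z B\<^esub>"
    proof
      fix v assume "v \<in> carrier (quotient_space scale Z B)"
      then obtain z where "z \<in> Z" "v = coset B z"
        by (auto simp: simps)
      then show "\<exists>neg_v\<in>carrier (quotient_space scale Z B).
        v \<oplus>\<^bsub>quotient_space scale Z B\<^esub> neg_v = \<zero>\<^bsub>quotient_space scale Z B\<^esub>"
        using cl(4) by (intro bexI[of _ "coset B (- z)"]) (auto simp: simps)
    qed
  qed (auto simp: simps cl ac_simps scale_left_distrib scale_right_distrib)
  then show ?thesis
    using class_field by (simp add: vectorspace_def)
qed

end

end

text \<open>The maps \<open>\<Phi> i\<close> induce one map from Z / B to the direct sum:
  \<open>ker\<close> makes it well defined and injective, \<open>fin\<close> gives finite support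
  and \<open>surj\<close> makes it onto. All conditions concern representatives, which keeps cosets
  out of the application.\<close>

lemma dim_direct_sum_quotients:
  fixes s :: "'k::field \<Rightarrow> 'v::ab_group_add \<Rightarrow> 'v" and t :: "'k \<Rightarrow> 'w::ab_group_add \<Rightarrow> 'w"
  assumes vs: "vector_space s" "vector_space t"
    and Z: "lin_subspace s Z" and B: "lin_subspace s B"
    and B': "\<And>i. i \<in> I \<Longrightarrow> lin_subspace t (B' i)"
    and lin: "\<And>i. i \<in> I \<Longrightarrow> lin_on s t Z (\<Phi> i)"
    and Phi: "\<And>i z. i \<in> I \<Longrightarrow> z \<in> Z \<Longrightarrow> \<Phi> i z \<in> Z' i"
    and fin: "\<And>z. z \<in> Z \<Longrightarrow> finite {i \<in> I. \<Phi> i z \<notin> B' i}"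
    and ker: "\<And>z. z \<in> Z \<Longrightarrow> z \<in> B \<longleftrightarrow> (\<forall>i\<in>I. \<Phi> i z \<in> B' i)"
    and surj: "\<And>w. (\<And>i. i \<in> I \<Longrightarrow> w i \<in> Z' i) \<Longrightarrow> finite {i \<in> I. w i \<notin> B' i} \<Longrightarrow>
      \<exists>z\<in>Z. \<forall>i\<in>I. \<Phi> i z - w i \<in> B' i"
  shows "vectorspace.dim class_ring (direct_sum_space I (\<lambda>i. quotient_space t (Z' i) (B' i)))
    = vectorspace.dim class_ring (quotient_space s Z B)"
proof -
  interpret s: linear_space s using vs(1) by (simp add: linear_space_def)
  interpret t: linear_space t using vs(2) by (simp add: linear_space_def)
  let ?Q = "quotient_space s Z B" and ?M = "\<lambda>i. quotient_space t (Z' i) (B' i)"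
  let ?D = "direct_sum_space I ?M"
  define F where "F z = (\<lambda>i\<in>I. t.coset (B' i) (\<Phi> i z))" for z
  \<comment> \<open>A representative of the coset is chosen; by \<open>F_eq\<close> the value does
    not depend on the choice.\<close>
  define f where "f X = F (SOME z. z \<in> Z \<and> X = s.coset B z)" for X
  have diff: "\<Phi> i (x - y) = \<Phi> i x - \<Phi> i y" if "i \<in> I" "x \<in> Z" "y \<in> Z" for i x y
    by (rule s.lin_onD_diff[OF lin[OF that(1)] vs(2) Z that(2,3)])
  have F_eq: "F x = F y \<longleftrightarrow> s.coset B x = s.coset B y" if "x \<in> Z" "y \<in> Z" for x y
  proof -
    have "F x = F y \<longleftrightarrow> (\<forall>i\<in>I. \<Phi> i x - \<Phi> i y \<in> B' i)"
      using t.coset_eq_iff[OF B'] by (auto simp: F_def fun_eq_iff restrict_def)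
    also have "\<dots> \<longleftrightarrow> x - y \<in> B"
      using ker[of "x - y"] that diff s.subspace_diff[OF Z] by simp
    finally show ?thesis
      using s.coset_eq_iff[OF B] by simp
  qed
  have f: "f (s.coset B z) = F z" if "z \<in> Z" for z
  proof -
    let ?z = "SOME w. w \<in> Z \<and> s.coset B z = s.coset B w"
    have "?z \<in> Z \<and> s.coset B z = s.coset B ?z"
      by (rule someI[of _ z]) (simp add: that)
    then show ?thesis
      using F_eq[of z ?z] that by (simp add: f_def)
  qed
  have coset0: "t.coset (B' i) w = t.coset (B' i) 0 \<longleftrightarrow> w \<in> B' i" if "i \<in> I" for i w
    using t.coset_eq_iff[OF B'[OF that], of w 0] by simp
  show ?thesis
  proof (rule vectorspace_dim_transport[where f = f])
    show "vectorspace class_ring ?Q"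
      by (rule s.vectorspace_quotient_space[OF B Z])
    show "bij_betw f (carrier ?Q) (carrier ?D)"
      unfolding bij_betw_def
    proof
      show "inj_on f (carrier ?Q)"
        by (auto simp: inj_on_def s.carrier_quotient_space f F_eq)
      show "f ` carrier ?Q = carrier ?D"
      proof
        show "f ` carrier ?Q \<subseteq> carrier ?D"
        proof clarify
          fix X assume "X \<in> carrier ?Q"
          then obtain z where z: "z \<in> Z" "X = s.coset B z"
            by (auto simp: s.carrier_quotient_space)
          have "{i \<in> I. F z i \<noteq> \<zero>\<^bsub>?M i\<^esub>} = {i \<in> I. \<Phi> i z \<notin> B' i}"
            using coset0 by (auto simp: F_def t.zero_quotient_space)
          moreover have "F z \<in> (\<Pi>\<^sub>E i\<in>I. carrier (?M i))"
            using Phi z(1) by (auto simp: F_def t.carrier_quotient_space)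
          ultimately show "f X \<in> carrier ?D"
            using fin[OF z(1)] z by (simp add: f direct_sum_space_def)
        qed
        show "carrier ?D \<subseteq> f ` carrier ?Q"
        proof
          fix \<phi> assume "\<phi> \<in> carrier ?D"
          then have \<phi>: "\<phi> \<in> (\<Pi>\<^sub>E i\<in>I. carrier (?M i))" "finite {i \<in> I. \<phi> i \<noteq> \<zero>\<^bsub>?M i\<^esub>}"
            by (simp_all add: direct_sum_space_def)
          have "\<forall>i\<in>I. \<exists>w. w \<in> Z' i \<and> \<phi> i = t.coset (B' i) w"
            using \<phi>(1) by (auto simp: PiE_iff t.carrier_quotient_space)
          then obtain w where w: "\<And>i. i \<in> I \<Longrightarrow> w i \<in> Z' i \<and> \<phi> i = t.coset (B' i) (w i)"
            by metis
          have "w i \<notin> B' i \<longleftrightarrow> \<phi> i \<noteq> \<zero>\<^bsub>?M i\<^esub>" if "i \<in> I" for i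
            using w[OF that] coset0[OF that, of "w i"] by (simp add: t.zero_quotient_space)
          then have "{i \<in> I. w i \<notin> B' i} = {i \<in> I. \<phi> i \<noteq> \<zero>\<^bsub>?M i\<^esub>}"
            by blast
          then obtain z where z: "z \<in> Z" "\<forall>i\<in>I. \<Phi> i z - w i \<in> B' i"
            using surj[of w] w \<phi>(2) by auto
          have "F z i = \<phi> i" for i
            using z(2) w t.coset_eq_iff[OF B'] PiE_arb[OF \<phi>(1)] by (cases "i \<in> I") (auto simp: F_def)
          then have "f (s.coset B z) = \<phi>"
            using f[OF z(1)] by (simp add: fun_eq_iff)
          then show "\<phi> \<in> f ` carrier ?Q"
            using z(1) by (auto simp: s.carrier_quotient_space)
        qed
      qed
    qed
    show "f \<zero>\<^bsub>?Q\<^esub> = \<zero>\<^bsub>?D\<^esub>"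
      using f[OF s.subspace_0[OF Z]] s.lin_onD_zero[OF lin vs(2) Z]
      by (auto simp: s.zero_quotient_space direct_sum_space_def F_def t.zero_quotient_space intro!: restrict_ext)
    show "f (X \<oplus>\<^bsub>?Q\<^esub> Y) = f X \<oplus>\<^bsub>?D\<^esub> f Y" if "X \<in> carrier ?Q" "Y \<in> carrier ?Q" for X Y
    proof -
      obtain x y where xy: "x \<in> Z" "X = s.coset B x" "y \<in> Z" "Y = s.coset B y"
        using \<open>X \<in> carrier ?Q\<close> \<open>Y \<in> carrier ?Q\<close> by (auto simp: s.carrier_quotient_space)
      have "F (x + y) = (\<lambda>i\<in>I. F x i \<oplus>\<^bsub>?M i\<^esub> F y i)"
        using xy lin_onD_add[OF lin] by (auto simp: F_def t.add_quotient_space[OF B'] intro!: restrict_ext)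
      then show ?thesis
        using xy by (simp add: s.add_quotient_space[OF B] f s.subspace_add[OF Z] direct_sum_space_def)
    qed
    show "f (c \<odot>\<^bsub>?Q\<^esub> X) = c \<odot>\<^bsub>?D\<^esub> f X" if "X \<in> carrier ?Q" for c X
    proof -
      obtain x where x: "x \<in> Z" "X = s.coset B x"
        using \<open>X \<in> carrier ?Q\<close> by (auto simp: s.carrier_quotient_space)
      have "F (s c x) = (\<lambda>i\<in>I. c \<odot>\<^bsub>?M i\<^esub> F x i)"
        using x lin_onD_scale[OF lin] by (auto simp: F_def t.smult_quotient_space[OF B'] intro!: restrict_ext)
      then show ?thesis
        using x by (simp add: s.smult_quotient_space[OF B] f s.subspace_scale[OF Z] direct_sum_space_def)
    qed
  qed
qed

section \<open>Irreducible modules and total cohomology\<close>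

lemma vector_space_seq_scale: "vector_space (seq_scale :: 'k::field \<Rightarrow> _)"
  by unfold_locales (auto simp: seq_scale_def fun_eq_iff algebra_simps)

lemma vector_space_seq_cochains: "vector_space (\<lambda>(c :: 'k::field) (f :: 'a \<Rightarrow> nat \<Rightarrow> 'k) xs. seq_scale c (f xs))"
  by unfold_locales (auto simp: seq_scale_def fun_eq_iff algebra_simps)

lemma seq_scale_scale: "seq_scale a (seq_scale b v) = seq_scale (a * b) v"
  and seq_scale_zero: "seq_scale 0 v = 0"
  and seq_scale_one: "seq_scale 1 v = v"
  and seq_scale_add: "seq_scale (a + b) v = seq_scale a v + seq_scale b v"
  and seq_scale_diff: "seq_scale (a - b) v = seq_scale a v - seq_scale b v"
  by (auto simp: seq_scale_def fun_eq_iff algebra_simps)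

lemma zero_in_line: "0 \<in> range (\<lambda>c. seq_scale c v)"
  by (rule image_eqI[where x = 0]) (simp_all add: seq_scale_zero)

lemma in_line: "v \<in> range (\<lambda>c. seq_scale c v)"
  by (rule image_eqI[where x = 1]) (simp_all add: seq_scale_one)

lemma seq_scale_cancel: "v \<noteq> 0 \<Longrightarrow> seq_scale a v = seq_scale b v \<longleftrightarrow> a = b"
  by (auto simp: seq_scale_def fun_eq_iff)

lemma seq_scale_sum: "seq_scale (sum g M) v = (\<Sum>i\<in>M. seq_scale (g i) v)"
  by (induction M rule: infinite_finite_induct) (simp_all add: seq_scale_zero seq_scale_add)

context nilshadow
begin

interpretation S: linear_space "seq_scale :: 'k \<Rightarrow> _"
  using vector_space_seq_scale by (simp add: linear_space_def)

interpretation SF: linear_space "\<lambda>(c :: 'k) (f :: 's list \<Rightarrow> nat \<Rightarrow> 'k) xs. seq_scale c (f xs)"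
  using vector_space_seq_cochains by (simp add: linear_space_def)

lemma cocycles_eq: "cocycles scale UNIV b (*) UNIV (\<lambda>x v. l x * v) p = Z b l p"
  by (auto simp: cocycles_def Z_def coboundary_eq_cob zero_fun_def)

lemma coboundaries_eq: "coboundaries scale UNIV b (*) UNIV (\<lambda>x v. l x * v) p = Bd b l p"
  by (auto simp: coboundaries_def Bd_def coboundary_eq_cob zero_fun_def split: nat.split)

lemma trivial_cohomology_eq:
  "trivial_cohomology scale UNIV b p =
    quotient_space (\<lambda>c f xs. c * f xs) (Z b (\<lambda>_. 0) p) (Bd b (\<lambda>_. 0) p)"
  using cocycles_eq[of b "\<lambda>_. 0" p] coboundaries_eq[of b "\<lambda>_. 0" p]
  by (simp add: trivial_cohomology_def lie_cohomology_def)

subsection \<open>One-dimensional modules\<close>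

text \<open>The spanning vector v is kept as a parameter because it identifies scalar cochains with
  cochains valued in the line (\<open>vec_cochain\<close>).\<close>

definition char_module :: "('k, 's) seq_module \<Rightarrow> ('s \<Rightarrow> 'k) \<Rightarrow> (nat \<Rightarrow> 'k) \<Rightarrow> bool" where
  "char_module m l v \<longleftrightarrow> character l \<and> v \<noteq> 0 \<and> fst m = range (\<lambda>c. seq_scale c v) \<and>
     (\<forall>x c. snd m x (seq_scale c v) = seq_scale (l x * c) v)"

definition vec_cochain :: "(nat \<Rightarrow> 'k) \<Rightarrow> ('s list \<Rightarrow> 'k) \<Rightarrow> 's list \<Rightarrow> nat \<Rightarrow> 'k" where
  "vec_cochain v g = (\<lambda>xs. seq_scale (g xs) v)"

lemma vec_cochain_lin: "lin_on (\<lambda>c f xs. c * f xs) (\<lambda>c f xs. seq_scale c (f xs)) UNIV (vec_cochain v)"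
  by (auto simp: lin_on_def vec_cochain_def seq_scale_add seq_scale_scale fun_eq_iff)

lemma vec_cochain_diff: "vec_cochain v (f - g) = vec_cochain v f - vec_cochain v g"
  by (auto simp: vec_cochain_def seq_scale_diff fun_eq_iff)

lemma vec_cochain_zero: "vec_cochain v 0 = 0"
  by (auto simp: vec_cochain_def seq_scale_zero fun_eq_iff)

lemma vec_cochain_inj:
  assumes "v \<noteq> 0" "vec_cochain v f = vec_cochain v g"
  shows "f = g"
proof
  show "f xs = g xs" for xs
    using fun_cong[OF assms(2), of xs] assms(1) by (simp add: vec_cochain_def seq_scale_cancel)
qed

lemma subspace_vec_cochain:
  assumes "F.subspace U"
  shows "SF.subspace (vec_cochain v ` U)"
proof (rule SF.subspaceI)
  show "0 \<in> vec_cochain v ` U"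
    by (rule image_eqI[where x = 0]) (simp_all add: vec_cochain_zero F.subspace_0[OF assms])
  show "x + y \<in> vec_cochain v ` U" if "x \<in> vec_cochain v ` U" "y \<in> vec_cochain v ` U" for x y
    using that F.subspace_add[OF assms] by (auto simp flip: lin_onD_add[OF vec_cochain_lin])
  show "(\<lambda>xs. seq_scale c (x xs)) \<in> vec_cochain v ` U" if "x \<in> vec_cochain v ` U" for c x
    using that F.subspace_scale[OF assms] by (auto simp flip: lin_onD_scale[OF vec_cochain_lin])
qed

lemma cochains_vec:
  assumes v: "v \<noteq> 0"
  shows "cochains scale UNIV seq_scale (range (\<lambda>c. seq_scale c v)) p = vec_cochain v ` C p"
proof
  show "vec_cochain v ` C p \<subseteq> cochains scale UNIV seq_scale (range (\<lambda>c. seq_scale c v)) p"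
    by (auto simp: cochains_def vec_cochain_def lin_on_def seq_scale_add seq_scale_scale seq_scale_zero)
  obtain i where i: "v i \<noteq> 0"
    using v by (auto simp: fun_eq_iff)
  show "cochains scale UNIV seq_scale (range (\<lambda>c. seq_scale c v)) p \<subseteq> vec_cochain v ` C p"
  proof
    fix f assume f: "f \<in> cochains scale UNIV seq_scale (range (\<lambda>c. seq_scale c v)) p"
    \<comment> \<open>On the line through v the scalar factor is recovered from a coordinate in
      which v does not vanish.\<close>
    let ?g = "\<lambda>xs. f xs i / v i"
    have rng: "f xs \<in> range (\<lambda>c. seq_scale c v)" for xs
    proof (cases "length xs = p")
      case False
      then show ?thesis
        using f zero_in_line[of v] by (simp add: cochains_def)
    qed (use f in \<open>simp add: cochains_def\<close>)
    have eq: "f xs = seq_scale (?g xs) v" for xs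
    proof -
      obtain c where "f xs = seq_scale c v"
        using rng[of xs] by blast
      then show ?thesis
        using i by (simp add: seq_scale_def)
    qed
    have "f = vec_cochain v ?g"
      unfolding vec_cochain_def by (rule ext) (rule eq)
    moreover have "?g \<in> C p"
      using f by (auto simp: cochains_def lin_on_def seq_scale_def add_divide_distrib)
    ultimately show "f \<in> vec_cochain v ` C p" by blast
  qed
qed

lemma coboundary_vec:
  assumes act: "\<And>x c. act x (seq_scale c v) = seq_scale (l x * c) v" and g: "g \<in> C p"
  shows "coboundary UNIV br seq_scale act p (vec_cochain v g) = vec_cochain v (cob br l g)"
  unfolding coboundary_eq_cob[OF g, symmetric]
proof
  fix xs
  show "coboundary UNIV br seq_scale act p (vec_cochain v g) xs
      = vec_cochain v (coboundary UNIV br (*) (\<lambda>x v. l x * v) p g) xs"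
    by (simp add: coboundary_def vec_cochain_def act seq_scale_scale seq_scale_add seq_scale_sum seq_scale_zero
        case_prod_unfold mult.assoc)
qed

context
  fixes m l v
  assumes m: "char_module m l v"
begin

lemma cocycles_vec: "cocycles scale UNIV br seq_scale (fst m) (snd m) p = vec_cochain v ` Z br l p"
proof -
  have v: "v \<noteq> 0" and V: "fst m = range (\<lambda>c. seq_scale c v)"
    and act: "\<And>x c. snd m x (seq_scale c v) = seq_scale (l x * c) v"
    using m by (auto simp: char_module_def)
  have "coboundary UNIV br seq_scale (snd m) p (vec_cochain v g) = 0 \<longleftrightarrow> cob br l g = 0" if "g \<in> C p" for g
    using coboundary_vec[OF act that] vec_cochain_inj[OF v, of "cob br l g" 0] vec_cochain_zero[of v] by auto
  then show ?thesis
    unfolding cocycles_def V cochains_vec[OF v] zero_fun_def[symmetric] Z_def by blast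
qed

lemma coboundaries_vec: "coboundaries scale UNIV br seq_scale (fst m) (snd m) p = vec_cochain v ` Bd br l p"
proof (cases p)
  case 0
  then show ?thesis
    using vec_cochain_zero by (simp add: coboundaries_def Bd_def zero_fun_def)
next
  case (Suc q)
  have v: "v \<noteq> 0" and V: "fst m = range (\<lambda>c. seq_scale c v)"
    and act: "\<And>x c. snd m x (seq_scale c v) = seq_scale (l x * c) v"
    using m by (auto simp: char_module_def)
  show ?thesis
    by (simp add: coboundaries_def Bd_def Suc V cochains_vec[OF v] image_image coboundary_vec[OF act])
qed

lemma seq_module_cohomology_nontrivial:
  assumes z: "z \<in> Z br l p" "z \<notin> Bd br l p"
  shows "carrier (seq_module_cohomology scale UNIV br p m) \<noteq> {zero (seq_module_cohomology scale UNIV br p m)}"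
proof -
  have v: "v \<noteq> 0"
    using m by (simp add: char_module_def)
  have sub: "SF.subspace (vec_cochain v ` Bd br l p)"
    by (rule subspace_vec_cochain[OF subspace_Bd])
  have "vec_cochain v z \<notin> vec_cochain v ` Bd br l p"
    using vec_cochain_inj[OF v] z(2) by blast
  then have "SF.coset (vec_cochain v ` Bd br l p) (vec_cochain v z) \<noteq> SF.coset (vec_cochain v ` Bd br l p) 0"
    using SF.coset_eq_iff[OF sub, of "vec_cochain v z" 0] by simp
  then show ?thesis
    using z(1) unfolding seq_module_cohomology_def lie_cohomology_def cocycles_vec coboundaries_vec
      SF.carrier_quotient_space SF.zero_quotient_space by blast
qed

end

text \<open>Lie's theorem modulo {0} yields a common eigenvector; its line is a submodule, hence
  everything.\<close>

lemma irreducible_imp_char_module: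
  assumes "m \<in> irreducible_modules scale UNIV br"
  shows "\<exists>l v. char_module m l v"
proof -
  obtain V act where m: "m = (V, act)" by (cases m)
  have irr: "irreducible_lie_module scale UNIV br seq_scale V act"
    using assms by (simp add: irreducible_modules_def m)
  interpret M: lie_module scale UNIV br seq_scale V act
    using irr by (simp add: irreducible_lie_module_def)
  interpret M: solvable_module scale br seq_scale V act
    by unfold_locales (rule solvable)
  have V: "S.subspace V" by (rule M.V_subspace)
  have "V \<noteq> {0}"
    using irr by (simp add: irreducible_lie_module_def)
  then have "{0} \<noteq> V" by (rule not_sym)
  then obtain v where v: "v \<in> V" "v \<noteq> 0" "\<And>x. \<exists>c. act x v = seq_scale c v"
    using M.lie_theorem_modulo[of "{0}"] S.subspace_0[OF V] M.act_zero_right by auto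
  then obtain l where l: "\<And>x. act x v = seq_scale (l x) v" by metis
  have act: "act x (seq_scale c v) = seq_scale (l x * c) v" for x c
    by (simp add: M.act_scale_right[OF v(1)] l seq_scale_scale mult.commute)
  let ?W = "range (\<lambda>c. seq_scale c v)"
  have "S.subspace ?W"
  proof (rule S.subspaceI)
    show "0 \<in> ?W" by (rule zero_in_line)
    show "x + y \<in> ?W" if "x \<in> ?W" "y \<in> ?W" for x y
      using that by (auto simp flip: seq_scale_add)
    show "seq_scale c x \<in> ?W" if "x \<in> ?W" for c x
      using that by (auto simp: seq_scale_scale)
  qed
  moreover have "?W \<subseteq> V"
    using S.subspace_scale[OF V v(1)] by blast
  moreover have "\<forall>x\<in>UNIV. \<forall>w\<in>?W. act x w \<in> ?W"
    using act by auto
  ultimately have "?W = {0} \<or> ?W = V"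
    using irr unfolding irreducible_lie_module_def by blast
  moreover have "v \<in> ?W"
    by (rule in_line)
  ultimately have "V = ?W"
    using v(2) by auto
  moreover have "character l"
    unfolding character_def
  proof (intro conjI allI)
    show "l (x + y) = l x + l y" for x y
      using M.act_add_left[OF v(1), of x y] v(2) by (simp add: l flip: seq_scale_add)
    show "l (scale c x) = c * l x" for c x
      using M.act_scale_left[OF v(1), of c x] v(2) by (simp add: l seq_scale_scale)
    show "l (br x y) = 0" for x y
      using M.act_br[of x y v] v(1,2)
      by (simp add: l act mult.commute flip: seq_scale_diff)
  qed
  ultimately show ?thesis
    using v(2) act by (auto simp: char_module_def m)
qed

lemma exists_char_module:
  assumes l: "character l"
  shows "\<exists>m v. m \<in> irreducible_modules scale UNIV br \<and> char_module m l v"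
proof -
  \<comment> \<open>Any nonzero sequence would serve to span the line.\<close>
  define v :: "nat \<Rightarrow> 'k" where "v = (\<lambda>_. 1)"
  let ?V = "range (\<lambda>c. seq_scale c v)" and ?act = "\<lambda>x. seq_scale (l x)"
  have v: "v \<noteq> 0"
    by (simp add: v_def fun_eq_iff)
  have l': "l (x + y) = l x + l y" "l (scale c x) = c * l x" "l (br x y) = 0" for x y c
    using l by (auto simp: character_def)
  have V: "?V = S.span {v}"
    using S.span_singleton by simp
  have "lie_module scale UNIV br seq_scale ?V ?act"
  proof
    show "fd_subspace seq_scale ?V"
      unfolding V fd_subspace_def by blast
    show "?act x u \<in> ?V" if "u \<in> ?V" for x u
      using that by (auto simp: seq_scale_scale)
    show "lin_on scale seq_scale UNIV (\<lambda>x. ?act x u)" for u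
      by (simp add: lin_on_def l' seq_scale_add seq_scale_scale)
    show "lin_on seq_scale seq_scale ?V (?act x)" for x
      by (auto simp: lin_on_def seq_scale_scale mult.commute) (auto simp: seq_scale_def fun_eq_iff algebra_simps)
    show "?act (br x y) u = ?act x (?act y u) - ?act y (?act x u)" for x y u
      by (simp add: l' seq_scale_scale seq_scale_zero mult.commute)
  qed
  moreover have "?V \<noteq> {0}"
    using v in_line[of v] by blast
  moreover have "U = {0} \<or> U = ?V" if U: "S.subspace U" "U \<subseteq> ?V" for U
  proof (cases "U = {0}")
    case False
    then obtain u where u: "u \<in> U" "u \<noteq> 0"
      using S.subspace_0[OF U(1)] by blast
    then obtain c where c: "u = seq_scale c v"
      using U(2) by blast
    then have "c \<noteq> 0"
      using u(2) seq_scale_zero by blast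
    then have "v = seq_scale (inverse c) u"
      by (simp add: c seq_scale_scale seq_scale_one)
    then have "v \<in> U"
      using S.subspace_scale[OF U(1) u(1)] by simp
    then have "?V \<subseteq> U"
      using S.subspace_scale[OF U(1)] by blast
    then show ?thesis
      using U(2) by blast
  qed simp
  ultimately have "(?V, ?act) \<in> irreducible_modules scale UNIV br"
    by (simp add: irreducible_modules_def irreducible_lie_module_def)
  moreover have "char_module (?V, ?act) l v"
    using l v by (simp add: char_module_def seq_scale_scale)
  ultimately show ?thesis by blast
qed

text \<open>An isomorphism carries v to an eigenvector with the same eigenvalues. Conversely, v to
  v' extends to an equivariant bijection of the lines.\<close>

lemma char_module_isomorphic:
  assumes m: "char_module m l v" and m': "char_module m' l' v'"
  shows "lie_module_isomorphic UNIV seq_scale (fst m) (snd m) seq_scale (fst m') (snd m') \<longleftrightarrow> l = l'"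
proof
  assume "lie_module_isomorphic UNIV seq_scale (fst m) (snd m) seq_scale (fst m') (snd m')"
  then obtain f where f: "lin_on seq_scale seq_scale (fst m) f" "bij_betw f (fst m) (fst m')"
    "\<And>x u. u \<in> fst m \<Longrightarrow> f (snd m x u) = snd m' x (f u)"
    unfolding lie_module_isomorphic_def by blast
  have v: "v \<noteq> 0" "v \<in> fst m" and "0 \<in> fst m"
    using m in_line[of v] zero_in_line[of v] by (simp_all add: char_module_def)
  have "snd m x (seq_scale 1 v) = seq_scale (l x * 1) v" for x
    using m unfolding char_module_def by blast
  then have act: "snd m x v = seq_scale (l x) v" for x
    by (simp add: seq_scale_one)
  have "f v \<noteq> f 0"
    using f(2) v \<open>0 \<in> fst m\<close> by (auto simp: bij_betw_def inj_on_def)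
  moreover have "f 0 = 0"
    using lin_onD_scale[OF f(1) v(2), of 0] by (simp only: seq_scale_zero)
  ultimately have fv: "f v \<noteq> 0" by simp
  have "f v \<in> fst m'"
    using f(2) v(2) by (auto simp: bij_betw_def)
  then obtain c where c: "f v = seq_scale c v'"
    using m' by (auto simp: char_module_def)
  have "seq_scale (l x) (f v) = seq_scale (l' x) (f v)" for x
    using f(3)[OF v(2), of x] lin_onD_scale[OF f(1) v(2)] m'
    by (simp add: act c seq_scale_scale char_module_def)
  then have "l x = l' x" for x
    using seq_scale_cancel[OF fv, of "l x" "l' x"] by blast
  then show "l = l'" by (rule ext)
next
  assume l: "l = l'"
  obtain i where i: "v i \<noteq> 0"
    using m by (auto simp: char_module_def fun_eq_iff)
  define f where "f u = seq_scale (u i / v i) v'" for u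
  have f: "f (seq_scale c v) = seq_scale c v'" for c
    using i by (simp add: f_def seq_scale_def)
  have V: "fst m = range (\<lambda>c. seq_scale c v)" "fst m' = range (\<lambda>c. seq_scale c v')" "v \<noteq> 0" "v' \<noteq> 0"
    using m m' by (auto simp: char_module_def)
  have "lin_on seq_scale seq_scale (fst m) f"
    by (auto simp: V lin_on_def f seq_scale_scale simp flip: seq_scale_add)
  moreover have "bij_betw f (fst m) (fst m')"
    unfolding bij_betw_def V(1,2)
    by (auto simp: inj_on_def f seq_scale_cancel V image_image)
  moreover have "f (snd m x u) = snd m' x (f u)" if "u \<in> fst m" for x u
    using that m m' by (auto simp: char_module_def f l)
  ultimately show "lie_module_isomorphic UNIV seq_scale (fst m) (snd m) seq_scale (fst m') (snd m')"
    unfolding lie_module_isomorphic_def by blast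
qed

lemma char_module_unique: "char_module m l v \<Longrightarrow> char_module m l' v' \<Longrightarrow> l = l'"
  using char_module_isomorphic[of m l v m l' v'] char_module_isomorphic[of m l v m l v] by simp

text \<open>Equivalence of irreducible modules is equality of their characters, so the character of
  one member determines the class.\<close>

lemma Gamma_classes_iff:
  assumes C: "K \<in> Gamma_classes scale UNIV br p" and m: "m \<in> K" "char_module m l v"
  shows "K = {m' \<in> irreducible_modules scale UNIV br. \<exists>v'. char_module m' l v'}"
proof -
  obtain m0 where m0: "m0 \<in> irreducible_modules scale UNIV br" "K = module_equivalence scale UNIV br `` {m0}"
    using C by (auto simp: Gamma_classes_def elim!: quotientE)
  then obtain l0 v0 where l0: "char_module m0 l0 v0"
    using irreducible_imp_char_module by blast
  have "l0 = l"
    using m char_module_isomorphic[OF l0 m(2)] by (auto simp: m0(2) module_equivalence_def)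
  have "m' \<in> K \<longleftrightarrow> m' \<in> irreducible_modules scale UNIV br \<and> (\<exists>v'. char_module m' l v')" for m'
  proof
    assume m': "m' \<in> K"
    then have irr: "m' \<in> irreducible_modules scale UNIV br"
      by (auto simp: m0(2) module_equivalence_def)
    then obtain l' v' where l': "char_module m' l' v'"
      using irreducible_imp_char_module by blast
    have "l0 = l'"
      using m' char_module_isomorphic[OF l0 l'] by (auto simp: m0(2) module_equivalence_def)
    then show "m' \<in> irreducible_modules scale UNIV br \<and> (\<exists>v'. char_module m' l v')"
      using irr l' \<open>l0 = l\<close> by auto
  next
    assume "m' \<in> irreducible_modules scale UNIV br \<and> (\<exists>v'. char_module m' l v')"
    then obtain v' where "m' \<in> irreducible_modules scale UNIV br" "char_module m' l v'" by blast
    then show "m' \<in> K"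
      using m0(1) char_module_isomorphic[OF l0, of m' l v'] \<open>l0 = l\<close>
      by (auto simp: m0(2) module_equivalence_def case_prod_unfold)
  qed
  then show ?thesis by blast
qed

lemma Gamma_classes_some:
  assumes "K \<in> Gamma_classes scale UNIV br p"
  shows "(SOME m. m \<in> K) \<in> K" "(SOME m. m \<in> K) \<in> irreducible_modules scale UNIV br"
proof -
  obtain m where m: "m \<in> irreducible_modules scale UNIV br" "K = module_equivalence scale UNIV br `` {m}"
    using assms by (auto simp: Gamma_classes_def elim!: quotientE)
  obtain l v where "char_module m l v"
    using irreducible_imp_char_module[OF m(1)] by blast
  then have "m \<in> K"
    using m(1) char_module_isomorphic[of m l v m l v]
    by (auto simp: m(2) module_equivalence_def case_prod_unfold)
  then show K: "(SOME m. m \<in> K) \<in> K"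
    by (rule someI)
  then show "(SOME m. m \<in> K) \<in> irreducible_modules scale UNIV br"
    unfolding m(2) module_equivalence_def by auto
qed

section \<open>Comparison of the total cohomology with the nilshadow\<close>

lemma wcomp_sum:
  assumes "\<And>i. i \<in> M \<Longrightarrow> f i \<in> C p"
  shows "wcomp (sum f M) \<mu> = (\<Sum>i\<in>M. wcomp (f i) \<mu>)"
  using assms
proof (induction M rule: infinite_finite_induct)
  case (insert i M)
  have "sum f M \<in> C p"
    using insert.prems by (intro F.subspace_sum[OF subspace_C]) simp
  moreover have "f i \<in> C p"
    using insert.prems by simp
  moreover have "wcomp (sum f M) \<mu> = (\<Sum>i\<in>M. wcomp (f i) \<mu>)"
    using insert.prems by (intro insert.IH) simp
  ultimately show ?case
    unfolding sum.insert[OF insert.hyps] by (simp only: wcomp_add)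
qed (simp_all add: wcomp_zero)

text \<open>A cocycle of the nilshadow is sent to its components of weight \<open>l K\<close>,
  viewed in the representing modules. A weight without a class K has vanishing cohomology in degree
  p, so its component is a coboundary and nothing is lost. Conversely, \<open>diff_wcomp_Bd\<close>
  moves a cocycle for \<open>l K\<close> into weight \<open>l K\<close>, where it is also a cocycle
  of the nilshadow.\<close>

theorem dim_total_cohomology:
  "vectorspace.dim class_ring (total_cohomology scale UNIV br p) =
   vectorspace.dim class_ring (trivial_cohomology scale UNIV nbr p)"
proof -
  let ?\<Gamma> = "Gamma_classes scale UNIV br p"
  let ?m = "\<lambda>K. SOME m. m \<in> (K :: ('k, 's) seq_module set)"
  let ?cocycles = "\<lambda>K. cocycles scale UNIV br seq_scale (fst (?m K)) (snd (?m K)) p"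
  let ?coboundaries = "\<lambda>K. coboundaries scale UNIV br seq_scale (fst (?m K)) (snd (?m K)) p"
  have "\<forall>K\<in>?\<Gamma>. \<exists>l v. char_module (?m K) l v"
    using irreducible_imp_char_module Gamma_classes_some(2) by blast
  from bchoice[OF this] obtain l where "\<forall>K\<in>?\<Gamma>. \<exists>v. char_module (?m K) (l K) v"
    by (rule exE)
  from bchoice[OF this] obtain v where "\<forall>K\<in>?\<Gamma>. char_module (?m K) (l K) (v K)"
    by (rule exE)
  then have lv: "char_module (?m K) (l K) (v K)" if "K \<in> ?\<Gamma>" for K
    using that by (rule bspec)
  have l_inj: "inj_on l ?\<Gamma>"
  proof (rule inj_onI)
    fix K K' assume K: "K \<in> ?\<Gamma>" "K' \<in> ?\<Gamma>" "l K = l K'"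
    show "K = K'"
      using Gamma_classes_iff[OF K(1) Gamma_classes_some(1)[OF K(1)] lv[OF K(1)]]
        Gamma_classes_iff[OF K(2) Gamma_classes_some(1)[OF K(2)] lv[OF K(2)]] K(3) by simp
  qed
  have l_char: "character (l K)" and v_nz: "v K \<noteq> 0" if "K \<in> ?\<Gamma>" for K
    using lv[OF that] by (simp_all add: char_module_def)
  have class_exists: "\<exists>K\<in>?\<Gamma>. l K = \<mu>" if \<mu>: "character \<mu>" and z: "z \<in> Z br \<mu> p" "z \<notin> Bd br \<mu> p" for \<mu> z
  proof -
    obtain m u where m: "m \<in> irreducible_modules scale UNIV br" "char_module m \<mu> u"
      using exists_char_module[OF \<mu>] by blast
    let ?K = "module_equivalence scale UNIV br `` {m}"
    have K: "?K \<in> ?\<Gamma>"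
      unfolding Gamma_classes_def using m(1) seq_module_cohomology_nontrivial[OF m(2) z]
      by (intro quotientI) simp
    have "m \<in> ?K"
      using m char_module_isomorphic[of m \<mu> u m \<mu> u]
      by (auto simp: module_equivalence_def case_prod_unfold)
    from Gamma_classes_iff[OF K this m(2)] obtain u' where "char_module (?m ?K) \<mu> u'"
      using Gamma_classes_some(1)[OF K] by blast
    then have "l ?K = \<mu>"
      using char_module_unique lv[OF K] by blast
    then show ?thesis using K by blast
  qed
  let ?\<Phi> = "\<lambda>K g. vec_cochain (v K) (wcomp g (l K))"
  let ?Z = "\<lambda>K. vec_cochain (v K) ` Z br (l K) p" and ?B = "\<lambda>K. vec_cochain (v K) ` Bd br (l K) p"
  have Z_C: "Z b \<mu> p \<subseteq> C p" for b \<mu>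
    by (auto simp: Z_def)
  have mem_B: "vec_cochain (v K) h \<in> ?B K \<longleftrightarrow> h \<in> Bd br (l K) p" if "K \<in> ?\<Gamma>" for K h
    using vec_cochain_inj[OF v_nz[OF that]] by blast
  have "vectorspace.dim class_ring (direct_sum_space ?\<Gamma>
      (\<lambda>K. quotient_space (\<lambda>c f xs. seq_scale c (f xs))
        (?cocycles K) (?coboundaries K))) =
    vectorspace.dim class_ring
      (quotient_space (\<lambda>c f xs. c * f xs) (Z nbr (\<lambda>_. 0) p) (Bd nbr (\<lambda>_. 0) p))"
  proof (rule dim_direct_sum_quotients[where \<Phi> = ?\<Phi>])
    show "vector_space (\<lambda>(c :: 'k) (f :: 's list \<Rightarrow> 'k) xs. c * f xs)"
      by (rule F.vector_space_axioms)
    show "vector_space (\<lambda>(c :: 'k) (f :: 's list \<Rightarrow> nat \<Rightarrow> 'k) xs. seq_scale c (f xs))"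
      by (rule vector_space_seq_cochains)
    show "F.subspace (Z nbr (\<lambda>_. 0) p)" "F.subspace (Bd nbr (\<lambda>_. 0) p)"
      by (rule subspace_Z subspace_Bd)+
    fix K assume K: "K \<in> ?\<Gamma>"
    show "SF.subspace (?coboundaries K)"
      unfolding coboundaries_vec[OF lv[OF K]] by (rule subspace_vec_cochain[OF subspace_Bd])
    show "lin_on (\<lambda>c f xs. c * f xs) (\<lambda>c f xs. seq_scale c (f xs)) (Z nbr (\<lambda>_. 0) p) (?\<Phi> K)"
      unfolding lin_on_def
    proof (intro conjI ballI allI)
      show "?\<Phi> K (x + y) = ?\<Phi> K x + ?\<Phi> K y" if "x \<in> Z nbr (\<lambda>_. 0) p" "y \<in> Z nbr (\<lambda>_. 0) p" for x y
      proof -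
        have "x \<in> C p" "y \<in> C p"
          using that Z_C[of nbr "\<lambda>_. 0"] by blast+
        then show ?thesis
          by (simp only: wcomp_add lin_onD_add[OF vec_cochain_lin UNIV_I UNIV_I])
      qed
      show "?\<Phi> K (\<lambda>xs. c * x xs) = (\<lambda>xs. seq_scale c (?\<Phi> K x xs))" if "x \<in> Z nbr (\<lambda>_. 0) p" for c x
      proof -
        have "x \<in> C p"
          using that Z_C[of nbr "\<lambda>_. 0"] by blast
        then show ?thesis
          by (simp only: wcomp_scale lin_onD_scale[OF vec_cochain_lin UNIV_I])
      qed
    qed
    show "?\<Phi> K z \<in> ?cocycles K"
      if "z \<in> Z nbr (\<lambda>_. 0) p" for z
      unfolding cocycles_vec[OF lv[OF K]] using wcomp_Z_nbr[OF that] by blast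
  next
    fix z assume z: "z \<in> Z nbr (\<lambda>_. 0) p"
    have zC: "z \<in> C p"
      by (rule subsetD[OF Z_C z])
    \<comment> \<open>A cochain has finitely many nonzero weight components, and l is injective on
      classes; this bounds the support without counting the classes.\<close>
    have "{K \<in> ?\<Gamma>. ?\<Phi> K z \<notin> ?coboundaries K}
        \<subseteq> l -` {\<mu>. wcomp z \<mu> \<noteq> 0} \<inter> ?\<Gamma>"
      using F.subspace_0[OF subspace_Bd] by (auto simp: coboundaries_vec[OF lv])
    moreover have "finite (l -` {\<mu>. wcomp z \<mu> \<noteq> 0} \<inter> ?\<Gamma>)"
      by (rule finite_vimage_IntI[OF finite_wcomp[OF zC] l_inj])
    ultimately show "finite {K \<in> ?\<Gamma>. ?\<Phi> K z \<notin> ?coboundaries K}"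
      by (rule finite_subset)
    have "z \<in> Bd nbr (\<lambda>_. 0) p \<longleftrightarrow> (\<forall>K\<in>?\<Gamma>. ?\<Phi> K z \<in> ?B K)"
    proof
      assume "z \<in> Bd nbr (\<lambda>_. 0) p"
      then show "\<forall>K\<in>?\<Gamma>. ?\<Phi> K z \<in> ?B K"
        using wcomp_Bd_nbr by blast
    next
      assume B: "\<forall>K\<in>?\<Gamma>. ?\<Phi> K z \<in> ?B K"
      show "z \<in> Bd nbr (\<lambda>_. 0) p"
      proof (rule Bd_nbrI[OF zC])
        fix \<mu> assume nz: "wcomp z \<mu> \<noteq> 0"
        note w = weight_add[OF wcomp_C[OF zC] wcomp_W[OF zC] nz]
        have \<mu>: "character \<mu>"
          unfolding character_def using w(1,2) w(3)[OF br_in_N] by blast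
        show "wcomp z \<mu> \<in> Bd br \<mu> p"
        proof (rule ccontr)
          assume "wcomp z \<mu> \<notin> Bd br \<mu> p"
          then obtain K where "K \<in> ?\<Gamma>" "l K = \<mu>"
            using class_exists[OF \<mu> wcomp_Z_nbr[OF z]] by blast
          then show False
            using B mem_B \<open>wcomp z \<mu> \<notin> Bd br \<mu> p\<close> by blast
        qed
      qed
    qed
    then show "z \<in> Bd nbr (\<lambda>_. 0) p \<longleftrightarrow>
        (\<forall>K\<in>?\<Gamma>. ?\<Phi> K z \<in> ?coboundaries K)"
      using coboundaries_vec[OF lv] by simp
  next
    fix w assume w: "\<And>K. K \<in> ?\<Gamma> \<Longrightarrow> w K \<in> ?cocycles K"
      and fin: "finite {K \<in> ?\<Gamma>. w K \<notin> ?coboundaries K}"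
    let ?F = "{K \<in> ?\<Gamma>. w K \<notin> ?B K}"
    have finF: "finite ?F"
      using fin coboundaries_vec[OF lv] by (simp cong: conj_cong)
    have "\<forall>K\<in>?\<Gamma>. \<exists>h. h \<in> Z br (l K) p \<and> w K = vec_cochain (v K) h"
    proof
      fix K assume K: "K \<in> ?\<Gamma>"
      show "\<exists>h. h \<in> Z br (l K) p \<and> w K = vec_cochain (v K) h"
        using w[OF K] unfolding cocycles_vec[OF lv[OF K]] by blast
    qed
    from bchoice[OF this]
    obtain h where "\<forall>K\<in>?\<Gamma>. h K \<in> Z br (l K) p \<and> w K = vec_cochain (v K) (h K)"
      by (rule exE)
    then have h: "h K \<in> Z br (l K) p" "w K = vec_cochain (v K) (h K)" if "K \<in> ?\<Gamma>" for K
      using that by simp_all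
    have hC: "h K \<in> C p" if "K \<in> ?\<Gamma>" for K
      by (rule subsetD[OF Z_C h(1)[OF that]])
    \<comment> \<open>Only the finitely many K for which \<open>w K\<close> is not a coboundary are
      summed; for the others the component 0 already represents the class of
      \<open>w K\<close>.\<close>
    let ?g = "\<Sum>K\<in>?F. wcomp (h K) (l K)"
    have g: "?g \<in> Z nbr (\<lambda>_. 0) p"
      by (intro F.subspace_sum[OF subspace_Z] wcomp_Z_br l_char h(1)) simp_all
    have "?\<Phi> K ?g - w K \<in> ?B K" if K: "K \<in> ?\<Gamma>" for K
    proof -
      have "wcomp ?g (l K) = (\<Sum>K'\<in>?F. wcomp (wcomp (h K') (l K')) (l K))"
        by (intro wcomp_sum[where p = p] wcomp_C hC) simp
      \<comment> \<open>Distinct classes have distinct characters, so the summand for K' has a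
        component of weight \<open>l K\<close> only if K' = K.\<close>
      also have "\<dots> = (\<Sum>K'\<in>?F. if K' = K then wcomp (h K) (l K) else 0)"
        using l_inj K wcomp_single[OF wcomp_W[OF hC]] by (intro sum.cong) (auto simp: inj_on_def)
      finally have g_K: "wcomp ?g (l K) = (if K \<in> ?F then wcomp (h K) (l K) else 0)"
        using finF by simp
      show ?thesis
      proof (cases "K \<in> ?F")
        case True
        have "- (h K - wcomp (h K) (l K)) \<in> Bd br (l K) p"
          by (intro F.subspace_neg[OF subspace_Bd] diff_wcomp_Bd l_char h(1) K)
        then have "vec_cochain (v K) (wcomp (h K) (l K) - h K) \<in> ?B K"
          by simp
        then show ?thesis
          using True g_K h(2)[OF K] by (simp add: vec_cochain_diff)
      next
        case False
        then have "w K \<in> ?B K"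
          using K by blast
        then have "- w K \<in> ?B K"
          by (rule SF.subspace_neg[OF subspace_vec_cochain[OF subspace_Bd]])
        moreover have "wcomp ?g (l K) = 0"
          using g_K False by (simp only: if_False)
        ultimately show ?thesis
          by (simp only: vec_cochain_zero diff_0)
      qed
    qed
    then show "\<exists>z\<in>Z nbr (\<lambda>_. 0) p. \<forall>K\<in>?\<Gamma>.
        ?\<Phi> K z - w K \<in> ?coboundaries K"
      using g coboundaries_vec[OF lv] by (intro bexI[of _ ?g]) auto
  qed
  then show ?thesis
    by (simp add: total_cohomology_def seq_module_cohomology_def lie_cohomology_def trivial_cohomology_eq)
qed

end

theorem theorem8p3:
  fixes scale :: "'k::{field_char_0,alg_closed_field} \<Rightarrow> 's::ab_group_add \<Rightarrow> 's"
    and br :: "'s \<Rightarrow> 's \<Rightarrow> 's" and N H A :: "'s set"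
  assumes "lie_algebra scale UNIV br"
    and "solvable_lie scale UNIV br"
    and "is_nilradical scale UNIV br N"
    and "cartan_subalgebra scale UNIV br H"
    and "A \<subseteq> H"
    and "direct_decomposition scale UNIV A N"
  shows
    "(\<exists>\<beta>. elementary_linear_deformation scale A (\<lambda>_ _. 0) scale N br br br \<beta> \<and>
        lie_isomorphism
          (prod_scale scale scale) (A \<times> N) (extension_bracket (\<lambda>_ _. 0) br br br)
          scale UNIV br (\<lambda>(X, K). X + K) \<and>
        lie_isomorphism
          (prod_scale scale scale) (A \<times> N) (extension_bracket (\<lambda>_ _. 0) br (\<lambda>X K. br X K + \<beta> X K) br)
          scale UNIV (nilshadow_bracket scale br A N) (\<lambda>(X, K). X + K)) \<and>
     (\<forall>p \<le> vector_space.dim scale (UNIV :: 's set).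
        vectorspace.dim class_ring (total_cohomology scale UNIV br p) =
        vectorspace.dim class_ring (trivial_cohomology scale UNIV (nilshadow_bracket scale br A N) p))"
proof -
  interpret lie_algebra scale UNIV br by fact
  interpret nilshadow scale br N H A
    by unfold_locales (use assms in auto)
  show ?thesis
    unfolding nilshadow_bracket_eq
    using elementary_deformation lie_isomorphism_br lie_isomorphism_nbr dim_total_cohomology by blast
qed

end
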